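(* Let $1\le p<n$, $k>0$ and $A,B\in S^+(p,n)$. Let $V_A,V_B\in V_{n,p}$ have column spaces $\mathrm{range}(A)$ and $\mathrm{range}(B)$, and let $O_A,O_B\in O(p)$ be given by a singular value decomposition $$O_A^TV_A^TV_BO_B=\mathrm{diag}(\sigma_1,\dots,\sigma_p),\qquad 1\ge\sigma_1\ge\cdots\ge\sigma_p\ge0,\qquad \sigma_i=\cos\theta_i,\ 0\le\theta_1\le\dots\le\theta_p\le\pi/2 .$$ Put $U_A=V_AO_A$, $U_B=V_BO_B$, $\Theta=\mathrm{diag}(\theta_1,\dots,\theta_p)$, $X=(I-U_AU_A^T)U_BF$ where $F$ is the pseudoinverse of $\mathrm{diag}(\sin\theta_1,\dots,\sin\theta_p)$, and let $R_A,R_B\in P_p$ be such that $R_A^2=U_A^TAU_A$, $R_B^2=U_B^TBU_B$. Define $$U(t)=U_A\cos(\Theta t)+X\sin(\Theta t),\qquad R^2(t)=R_A\exp\!\big(t\log(R_A^{-1}R_B^2R_A^{-1})\big)R_A,$$ $$\gamma_{A\to B}(t)=U(t)R^2(t)U(t)^T .$$ Then: (i) $\gamma_{A\to B}$ connects $A$ and $B$ in $S^+(p,n)$, that is, $\gamma_{A\to B}(0)=A$, $\gamma_{A\to B}(1)=B$ and $\gamma_{A\to B}(t)\in S^+(p,n)$ for all $t\in[0,1]$. (ii) The curve $(U(t),R^2(t))$ is a horizontal lift of $\gamma_{A\to B}(t)$ and it is a geodesic in the structure space $V_{n,p}\times P_p$. (iii) The squared total length of $\gamma_{A\to B}$ (on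 $[0,1]$) in the Riemannian manifold $(S^+(p,n),g)$ is $$l^2(\gamma_{A\to B})=\|\Theta\|_F^2+k\,\|\log (R_A^{-1}R_B^2R_A^{-1})\|_F^2 .$$ It is invariant with respect to pseudoinversion ($(A,B)\mapsto(A^\dagger,B^\dagger)$) and to the group action by congruence of orthogonal transformations ($(A,B)\mapsto(OAO^T,OBO^T)$, $O\in O(n)$) and scalings ($(A,B)\mapsto(\mu^2A,\mu^2B)$, $\mu\in\mathbb R\setminus\{0\}$). (iv) Furthermore, the curve $\gamma_{A\to B}$ is uniquely defined (independent of the choices of $V_A,V_B,O_A,O_B$) provided that the $(p-1)$th principal angle satisfies $\theta_{p-1}\ne\pi/2$.
   Context: $S^+(p,n)$ is the set of real symmetric positive semidefinite $n\times n$ matrices of rank $p$; $V_{n,p}=\{U\in\mathbb R^{n\times p}:U^TU=I_p\}$; $P_p$ is the set of symmetric positive definite $p\times p$ matrices; $\exp$ and $\log$ are the matrix exponential and logarithm (on symmetric, resp. symmetric positive definite, matrices); $\|\cdot\|_F$ is the Frobenius norm; $A^\dagger$ is the Moore–Penrose pseudoinverse. Every $A\in S^+(p,n)$ can be written $A=UR^2U^T$ with $(U,R^2)\in V_{n,p}\times P_p$, $R\in P_p$, uniquely up to $(U,R^2)\mapsto(UO,O^TR^2O)$, $O\in O(p)$, so $S^+(p,n)\cong(V_{n,p}\times P_p)/O(p)$. The structure space $V_{n,p}\times P_p$ carries the Riemannian metric $$g^{SP}_{(U,R^2)}(X_1,X_2)=\mathrm{Tr}(\Omega_1^T\Omega_2+\Delta_1^T\Delta_2)+k\,\mathrm{Tr}(D_1R^{-2}D_2R^{-2}),\quad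 X_i=(U\Omega_i+\Delta_i,D_i),$$ with $\Omega_i$ skew-symmetric $p\times p$, $\Delta_i=U_\perp B_i$, $B_i\in\mathbb R^{(n-p)\times p}$, $D_i$ symmetric, where $U_\perp\in V_{n,n-p}$ satisfies $U^TU_\perp=0$. The horizontal space is $\mathcal H_{(U,R^2)}=\{(\Delta,D):\Delta=U_\perp B,\ B\in\mathbb R^{(n-p)\times p},\ D=RD_0R,\ D_0\in\mathrm{Sym}(p)\}$, where $\mathrm{Sym}(p)$ denotes symmetric $p\times p$ matrices; it is complementary to the tangent space of the $O(p)$-orbit and represents $T_{UR^2U^T}S^+(p,n)$ via the differential of the quotient map. The Riemannian metric $g$ on $S^+(p,n)$ is $g_{(U,R^2)}((\Delta_1,D_1),(\Delta_2,D_2))=\mathrm{Tr}(\Delta_1^T\Delta_2)+k\,\mathrm{Tr}(R^{-1}D_1R^{-2}D_2R^{-1})$ on horizontal vectors. A horizontal lift of a curve in $S^+(p,n)$ is a curve in $V_{n,p}\times P_p$ projecting onto it under $(U,R^2)\mapsto UR^2U^T$ whose velocity is everywhere in the horizontal space.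
   Formalization: Part (iv) is false as printed when θ_p = π/2 (e.g. A=diag(1,1,0), B=diag(1,0,1)). Proved instead: if θ_{p-1} ≠ π/2 the curve is unique, except that when θ_p = π/2 it may also be the curve obtained by changing the sign of the last column of U_B. *)

theory Defs
  imports "HOL-Analysis.Analysis"
begin

subsection \<open>Matrices\<close>

definition diag :: "real^'p \<Rightarrow> real^'p^'p" where
  "diag v = (\<chi> i j. if i = j then v $ i else 0)"

definition symmetric_mats :: "(real^'p^'p) set" where
  "symmetric_mats = {A. transpose A = A}"

definition skew_mats :: "(real^'p^'p) set" where
  "skew_mats = {A. transpose A = - A}"

definition spd :: "(real^'p^'p) set" where
  "spd = {A \<in> symmetric_mats. \<forall>x. x \<noteq> 0 \<longrightarrow> 0 < x \<bullet> (A *v x)}"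

definition spsd :: "nat \<Rightarrow> (real^'n^'n) set" where
  "spsd p = {A \<in> symmetric_mats. (\<forall>x. 0 \<le> x \<bullet> (A *v x)) \<and> rank A = p}"

definition stiefel :: "(real^'p^'n) set" where
  "stiefel = {U. transpose U ** U = mat 1}"

definition msqrt :: "real^'p^'p \<Rightarrow> real^'p^'p" where
  "msqrt S = (THE R. R \<in> spd \<and> R ** R = S)"

definition mexp :: "real^'p^'p \<Rightarrow> real^'p^'p" where
  "mexp A = (\<Sum>m. (1 / fact m) *\<^sub>R (((**) A ^^ m) (mat 1)))"

text \<open>The principal logarithm; it is meant for arguments in \<^const>\<open>spd\<close> only.\<close>

definition mlog :: "real^'p^'p \<Rightarrow> real^'p^'p" where
  "mlog A = (THE L. L \<in> symmetric_mats \<and> mexp L = A)"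

text \<open>The Moore--Penrose pseudoinverse, by the four Penrose equations.\<close>

definition pinv :: "real^'m^'n \<Rightarrow> real^'n^'m" where
  "pinv A = (THE M. A ** M ** A = A \<and> M ** A ** M = M \<and>
     transpose (A ** M) = A ** M \<and> transpose (M ** A) = M ** A)"


subsection \<open>Smooth maps, length, energy and geodesics\<close>

text \<open>For open \<open>W\<close> this is C-infinity on \<open>W\<close>: \<open>f\<close> belongs to a family of maps that are
  differentiable on \<open>W\<close> and closed under taking directional derivatives.\<close>

coinductive smooth_on ::
  "'a::real_normed_vector set \<Rightarrow> ('a \<Rightarrow> 'b::real_normed_vector) \<Rightarrow> bool" for W where
  "\<lbrakk>\<forall>z\<in>W. (f has_derivative D z) (at z); \<forall>h. smooth_on W (\<lambda>z. D z h)\<rbrakk> \<Longrightarrow> smooth_on W f"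

text \<open>Manifolds are subsets \<open>M\<close> of a Euclidean space; \<open>g x v w\<close> is the metric at \<open>x\<close>, and only
  its values at \<open>x \<in> M\<close> and tangent vectors \<open>v, w\<close> matter.\<close>

definition riemannian_length ::
  "('e::euclidean_space \<Rightarrow> 'e \<Rightarrow> 'e \<Rightarrow> real) \<Rightarrow> (real \<Rightarrow> 'e) \<Rightarrow> real \<Rightarrow> real \<Rightarrow> real" where
  "riemannian_length g c a b =
     integral {a..b} (\<lambda>t. sqrt (g (c t) (vector_derivative c (at t within {a..b}))
                                        (vector_derivative c (at t within {a..b}))))"

definition riemannian_energy ::
  "('e::euclidean_space \<Rightarrow> 'e \<Rightarrow> 'e \<Rightarrow> real) \<Rightarrow> (real \<Rightarrow> 'e) \<Rightarrow> real \<Rightarrow> real \<Rightarrow> real" where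
  "riemannian_energy g c a b = 1 / 2 *
     integral {a..b} (\<lambda>t. g (c t) (vector_derivative c (at t within {a..b}))
                                  (vector_derivative c (at t within {a..b})))"

text \<open>A geodesic is a smooth curve whose restriction to every compact interval is a critical point
  of the energy for smooth variations in \<open>M\<close> with fixed end points. In \<open>H (s, t)\<close> the variation
  parameter is \<open>s\<close> and the curve parameter is \<open>t\<close>.\<close>

definition riemannian_geodesic ::
  "'e::euclidean_space set \<Rightarrow> ('e \<Rightarrow> 'e \<Rightarrow> 'e \<Rightarrow> real) \<Rightarrow> (real \<Rightarrow> 'e) \<Rightarrow> bool" where
  "riemannian_geodesic M g c \<longleftrightarrow>
     smooth_on UNIV c \<and> range c \<subseteq> M \<and>
     (\<forall>a b \<epsilon>. \<forall>H :: real \<times> real \<Rightarrow> 'e.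
        a < b \<longrightarrow> 0 < \<epsilon> \<longrightarrow>
        smooth_on ({-\<epsilon><..<\<epsilon>} \<times> {a-\<epsilon><..<b+\<epsilon>}) H \<longrightarrow>
        H ` ({-\<epsilon><..<\<epsilon>} \<times> {a-\<epsilon><..<b+\<epsilon>}) \<subseteq> M \<longrightarrow>
        (\<forall>t\<in>{a-\<epsilon><..<b+\<epsilon>}. H (0, t) = c t) \<longrightarrow>
        (\<forall>s\<in>{-\<epsilon><..<\<epsilon>}. H (s, a) = c a \<and> H (s, b) = c b) \<longrightarrow>
        ((\<lambda>s. riemannian_energy g (\<lambda>t. H (s, t)) a b) has_real_derivative 0) (at 0))"


subsection \<open>The structure space and its quotient\<close>

text \<open>A point of the structure space is a pair \<open>(U, S)\<close> with \<open>S = R\<^sup>2\<close>.\<close>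

definition structure_space :: "((real^'p^'n) \<times> (real^'p^'p)) set" where
  "structure_space = stiefel \<times> spd"

definition quotient_proj :: "(real^'p^'n) \<times> (real^'p^'p) \<Rightarrow> real^'n^'n" where
  "quotient_proj = (\<lambda>(U, S). U ** S ** transpose U)"

text \<open>The matrices \<open>U\<^sub>\<bottom> B\<close>. As \<open>n - p\<close> is not the size of an index type, \<open>U\<^sub>\<bottom>\<close> is given by its
  columns \<open>Up 0, \<dots>, Up (n - p - 1)\<close> and \<open>B\<close> by its rows.\<close>

definition normal_mats :: "real^'p^'n \<Rightarrow> (real^'p^'n) set" where
  "normal_mats U = {\<Delta>. \<exists>(Up :: nat \<Rightarrow> real^'n) (B :: nat \<Rightarrow> real^'p).
     (\<forall>i < CARD('n) - CARD('p). \<forall>j < CARD('n) - CARD('p).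
        Up i \<bullet> Up j = (if i = j then 1 else 0)) \<and>
     (\<forall>i < CARD('n) - CARD('p). transpose U *v Up i = 0) \<and>
     \<Delta> = (\<chi> a b. \<Sum>i < CARD('n) - CARD('p). Up i $ a * B i $ b)}"

definition structure_metric ::
  "real \<Rightarrow> (real^'p^'n) \<times> (real^'p^'p) \<Rightarrow> (real^'p^'n) \<times> (real^'p^'p) \<Rightarrow> (real^'p^'n) \<times> (real^'p^'p) \<Rightarrow> real"
  where
  "structure_metric k = (\<lambda>(U, S) (X1, D1) (X2, D2). THE r.
     \<exists>\<Omega>1\<in>skew_mats. \<exists>\<Omega>2\<in>skew_mats. \<exists>\<Delta>1\<in>normal_mats U. \<exists>\<Delta>2\<in>normal_mats U.
       X1 = U ** \<Omega>1 + \<Delta>1 \<and> X2 = U ** \<Omega>2 + \<Delta>2 \<and>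
       D1 \<in> symmetric_mats \<and> D2 \<in> symmetric_mats \<and>
       r = trace (transpose \<Omega>1 ** \<Omega>2 + transpose \<Delta>1 ** \<Delta>2)
           + k * trace (D1 ** matrix_inv S ** D2 ** matrix_inv S))"

definition horizontal_space ::
  "(real^'p^'n) \<times> (real^'p^'p) \<Rightarrow> ((real^'p^'n) \<times> (real^'p^'p)) set" where
  "horizontal_space = (\<lambda>(U, S).
     {(\<Delta>, D). \<Delta> \<in> normal_mats U \<and> (\<exists>D0\<in>symmetric_mats. D = msqrt S ** D0 ** msqrt S)})"

definition horizontal_metric ::
  "real \<Rightarrow> (real^'p^'n) \<times> (real^'p^'p) \<Rightarrow> (real^'p^'n) \<times> (real^'p^'p) \<Rightarrow> (real^'p^'n) \<times> (real^'p^'p) \<Rightarrow> real"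
  where
  "horizontal_metric k = (\<lambda>(U, S) (\<Delta>1, D1) (\<Delta>2, D2).
     trace (transpose \<Delta>1 ** \<Delta>2)
     + k * trace (matrix_inv (msqrt S) ** D1 ** matrix_inv S ** D2 ** matrix_inv (msqrt S)))"

text \<open>The metric \<open>g\<close> on \<open>S\<^sup>+(p,n)\<close>: a tangent vector at \<open>A\<close> is evaluated through a horizontal
  vector over any point of the fibre of \<open>A\<close>. The type argument carries \<open>p\<close>.\<close>

definition spsd_metric ::
  "'p::finite itself \<Rightarrow> real \<Rightarrow> real^'n^'n \<Rightarrow> real^'n^'n \<Rightarrow> real^'n^'n \<Rightarrow> real" where
  "spsd_metric _ k A Z1 Z2 = (THE r.
     \<exists>z \<in> (structure_space :: ((real^'p^'n) \<times> (real^'p^'p)) set).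
     \<exists>\<xi>1\<in>horizontal_space z. \<exists>\<xi>2\<in>horizontal_space z.
       quotient_proj z = A \<and>
       frechet_derivative quotient_proj (at z) \<xi>1 = Z1 \<and>
       frechet_derivative quotient_proj (at z) \<xi>2 = Z2 \<and>
       r = horizontal_metric k z \<xi>1 \<xi>2)"

definition horizontal_lift ::
  "(real \<Rightarrow> (real^'p^'n) \<times> (real^'p^'p)) \<Rightarrow> (real \<Rightarrow> real^'n^'n) \<Rightarrow> bool" where
  "horizontal_lift c \<gamma> \<longleftrightarrow>
     (\<forall>t. c t \<in> structure_space \<and> quotient_proj (c t) = \<gamma> t \<and>
          (\<exists>v\<in>horizontal_space (c t). (c has_vector_derivative v) (at t)))"


subsection \<open>The curve\<close>

text \<open>The index type \<open>'p\<close> is linearly ordered, so that the singular values and the principal angles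
  are listed in the order of their indices.\<close>

definition principal_choice ::
  "real^'n^'n \<Rightarrow> real^'n^'n \<Rightarrow>
   real^('p::{finite,linorder})^'n \<Rightarrow> real^('p::{finite,linorder})^'n \<Rightarrow>
   real^('p::{finite,linorder})^('p::{finite,linorder}) \<Rightarrow>
   real^('p::{finite,linorder})^('p::{finite,linorder}) \<Rightarrow>
   real^('p::{finite,linorder}) \<Rightarrow> real^('p::{finite,linorder}) \<Rightarrow> bool" where
  "principal_choice A B V_A V_B O_A O_B \<sigma> \<theta> \<longleftrightarrow>
     V_A \<in> stiefel \<and> V_B \<in> stiefel \<and>
     range ((*v) V_A) = range ((*v) A) \<and> range ((*v) V_B) = range ((*v) B) \<and>
     orthogonal_matrix O_A \<and> orthogonal_matrix O_B \<and>
     transpose O_A ** transpose V_A ** V_B ** O_B = diag \<sigma> \<and>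
     (\<forall>i. 0 \<le> \<sigma> $ i \<and> \<sigma> $ i \<le> 1) \<and> (\<forall>i j. i \<le> j \<longrightarrow> \<sigma> $ j \<le> \<sigma> $ i) \<and>
     (\<forall>i. \<sigma> $ i = cos (\<theta> $ i) \<and> 0 \<le> \<theta> $ i \<and> \<theta> $ i \<le> pi / 2) \<and>
     (\<forall>i j. i \<le> j \<longrightarrow> \<theta> $ i \<le> \<theta> $ j)"

definition stiefel_curve ::
  "real^'p^'n \<Rightarrow> real^'p^'n \<Rightarrow> real^'p \<Rightarrow> real \<Rightarrow> real^'p^'n" where
  "stiefel_curve U_A U_B \<theta> t =
     (let X = (mat 1 - U_A ** transpose U_A) ** U_B ** pinv (diag (\<chi> i. sin (\<theta> $ i)))
      in U_A ** diag (\<chi> i. cos (\<theta> $ i * t)) + X ** diag (\<chi> i. sin (\<theta> $ i * t)))"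

definition compressed_sqrt :: "real^'n^'n \<Rightarrow> real^'p^'n \<Rightarrow> real^'p^'p" where
  "compressed_sqrt A U = msqrt (transpose U ** A ** U)"

definition log_ratio ::
  "real^'n^'n \<Rightarrow> real^'n^'n \<Rightarrow> real^'p^'n \<Rightarrow> real^'p^'n \<Rightarrow> real^'p^'p" where
  "log_ratio A B U_A U_B =
     (let R_A = compressed_sqrt A U_A; R_B = compressed_sqrt B U_B
      in mlog (matrix_inv R_A ** (R_B ** R_B) ** matrix_inv R_A))"

definition spd_curve ::
  "real^'n^'n \<Rightarrow> real^'n^'n \<Rightarrow> real^'p^'n \<Rightarrow> real^'p^'n \<Rightarrow> real \<Rightarrow> real^'p^'p" where
  "spd_curve A B U_A U_B t =
     (let R_A = compressed_sqrt A U_A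
      in R_A ** mexp (t *\<^sub>R log_ratio A B U_A U_B) ** R_A)"

definition lifted_curve ::
  "real^'n^'n \<Rightarrow> real^'n^'n \<Rightarrow> real^'p^'n \<Rightarrow> real^'p^'n \<Rightarrow> real^'p \<Rightarrow> real \<Rightarrow>
   (real^'p^'n) \<times> (real^'p^'p)" where
  "lifted_curve A B U_A U_B \<theta> t = (stiefel_curve U_A U_B \<theta> t, spd_curve A B U_A U_B t)"

definition spsd_curve ::
  "real^'n^'n \<Rightarrow> real^'n^'n \<Rightarrow> real^'p^'n \<Rightarrow> real^'p^'n \<Rightarrow> real^'p \<Rightarrow> real \<Rightarrow> real^'n^'n" where
  "spsd_curve A B U_A U_B \<theta> t =
     stiefel_curve U_A U_B \<theta> t ** spd_curve A B U_A U_B t ** transpose (stiefel_curve U_A U_B \<theta> t)"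

definition spsd_curve_sq_length ::
  "real \<Rightarrow> real^'n^'n \<Rightarrow> real^'n^'n \<Rightarrow> real^'p^'n \<Rightarrow> real^'p^'n \<Rightarrow> real^'p \<Rightarrow> real" where
  "spsd_curve_sq_length k A B U_A U_B \<theta> =
     (riemannian_length (spsd_metric TYPE('p) k) (spsd_curve A B U_A U_B \<theta>) 0 1)\<^sup>2"

text \<open>When the largest principal angle is \<open>pi / 2\<close>, \<open>O\<^sub>B\<close> may be replaced by
  \<open>O\<^sub>B ** flip_last\<close> while \<open>O\<^sub>A\<close> is kept: the result is again a singular value decomposition
  with the same singular values, but the curve it gives is in general a different one.\<close>

definition flip_last :: "real^('p::{finite,linorder})^('p::{finite,linorder})" where
  "flip_last = diag (\<chi> i. if i = Max UNIV then - 1 else 1)"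

end

theory Submission
  imports Defs
begin

text \<open>
  Write \<open>S\<close> for the component \<open>R\<^sup>2\<close> of a point \<open>(U, S)\<close> of the structure space, \<open>L\<close> for the
  logarithm of \<open>R\<^sub>A\<inverse> R\<^sub>B\<^sup>2 R\<^sub>A\<inverse>\<close>, and indices \<open>s\<close>, \<open>t\<close> for partial derivatives.

  A tangent vector \<open>X = U \<Omega> + \<Delta>\<close> of the Stiefel manifold satisfies
  \<open>X\<^sub>1\<^sup>T X\<^sub>2 = \<Omega>\<^sub>1\<^sup>T \<Omega>\<^sub>2 + \<Delta>\<^sub>1\<^sup>T \<Delta>\<^sub>2\<close>, so the structure metric is the product of the Euclidean metric
  and \<open>k\<close> times the affine invariant metric of the positive definite cone
  (\<open>structure_metric_tangent\<close>). Along a fibre of the quotient, horizontal vectors with the same image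
  differ by the isometry \<open>(\<Delta>, D) \<mapsto> (\<Delta> Q, Q\<^sup>T D Q)\<close>, so the metric of the quotient is well defined and the
  length of \<open>\<gamma>\<close> is the length of any horizontal lift (\<open>spsd_metric_horizontal\<close>).

  The columns of \<open>U\<^sub>A\<close> and those columns of \<open>(1 - U\<^sub>A U\<^sub>A\<^sup>T) U\<^sub>B F\<close> that belong to nonzero
  angles form an orthonormal system,
  and \<open>U(t)\<close> rotates each principal vector of \<open>A\<close> towards its partner for \<open>B\<close> in their common plane.
  All Gram matrices of such combinations are diagonal (\<open>frame_gram\<close>): this shows that
  \<open>U(t)\<^sup>T U(t) = 1\<close>, that \<open>U(t)\<^sup>T U'(t) = 0\<close>, and that \<open>U'\<close> has the constant norm of \<open>\<Theta>\<close>. In the other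
  factor \<open>S\<inverse> S' = R\<^sub>A\<inverse> L R\<^sub>A\<close> is constant, and the trace of its square is the squared norm of \<open>L\<close>.

  For the geodesic property, let \<open>(U, S)(s, t)\<close> be a variation and \<open>W = S\<inverse> S\<^sub>t\<close>. Differentiating the
  energy under the integral sign gives the integral of \<open>\<langle>U\<^sub>t, U\<^sub>s\<^sub>t\<rangle> + k Tr(W W\<^sub>s)\<close>
  (\<open>energy_first_variation\<close>). At \<open>s = 0\<close> the acceleration \<open>U\<^sub>t\<^sub>t = - U \<Theta>\<^sup>2\<close> is orthogonal to \<open>U\<^sub>s\<close>, because
  \<open>U\<^sup>T U\<^sub>s\<close> is skew, and \<open>W = K\<close> is constant, so the integrand is the \<open>t\<close>-derivative of
  \<open>\<langle>U\<^sub>t, U\<^sub>s\<rangle> + k Tr(K S\<inverse> S\<^sub>s)\<close>; this function vanishes at the two fixed end points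
  (\<open>lift_geodesic\<close>).

  Pseudoinversion, orthogonal congruences and scalings keep the principal angles. The last two
  also keep \<open>L\<close>, and the first replaces \<open>L\<close> by \<open>- L\<close>.

  Two choices of the data differ by orthogonal matrices, \<open>U\<^sub>A' = U\<^sub>A P\<close> and \<open>U\<^sub>B' = U\<^sub>B Q\<close>, with
  \<open>P\<^sup>T cos(\<Theta>) Q = cos(\<Theta>')\<close>. Sortedness forces \<open>\<Theta>' = \<Theta>\<close>, and then \<open>P\<close> commutes with every function of
  \<open>\<Theta>\<close> and \<open>P\<^sup>T Q\<close> fixes every coordinate whose angle is not \<open>\<pi>/2\<close>. If at most the last angle is \<open>\<pi>/2\<close>,
  then \<open>P\<^sup>T Q\<close> is the identity or the reflection of the last coordinate, and the common factor \<open>P\<close>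
  does not change the curve (\<open>spsd_curve_equivariant\<close>).

  The square root, logarithm and exponential of symmetric matrices act on the eigenvalues in an
  orthonormal eigenbasis (\<open>spectral_theorem\<close>, \<open>spectral_function_cong\<close>).
\<close>

section \<open>Algebra of real matrices\<close>

lemma bounded_bilinear_matrix_mult:
  "bounded_bilinear ((**) :: real^'n^'m \<Rightarrow> real^'p^'n \<Rightarrow> real^'p^'m)"
  unfolding bilinear_conv_bounded_bilinear[symmetric] bilinear_def
  by (auto intro!: linearI simp: vec_eq_iff matrix_matrix_mult_def algebra_simps
      sum.distrib sum_distrib_left)

lemmas matrix_mult_simps =
  bounded_bilinear.add_left[OF bounded_bilinear_matrix_mult]
  bounded_bilinear.add_right[OF bounded_bilinear_matrix_mult]
  bounded_bilinear.diff_left[OF bounded_bilinear_matrix_mult]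
  bounded_bilinear.diff_right[OF bounded_bilinear_matrix_mult]
  bounded_bilinear.minus_left[OF bounded_bilinear_matrix_mult]
  bounded_bilinear.minus_right[OF bounded_bilinear_matrix_mult]
  bounded_bilinear.scaleR_left[OF bounded_bilinear_matrix_mult]
  bounded_bilinear.scaleR_right[OF bounded_bilinear_matrix_mult]
  matrix_mul_assoc

lemma bounded_linear_transpose: "bounded_linear (transpose :: real^'n^'m \<Rightarrow> real^'m^'n)"
  unfolding linear_conv_bounded_linear[symmetric]
  by (auto intro!: linearI simp: vec_eq_iff transpose_def)

lemmas transpose_simps =
  linear_add[OF bounded_linear.linear[OF bounded_linear_transpose]]
  linear_diff[OF bounded_linear.linear[OF bounded_linear_transpose]]
  linear_neg[OF bounded_linear.linear[OF bounded_linear_transpose]]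
  linear_scale[OF bounded_linear.linear[OF bounded_linear_transpose]]
  matrix_transpose_mul transpose_transpose transpose_mat

lemma inner_matrix_eq_trace: "A \<bullet> B = trace (transpose A ** B)" for A B :: "real^'n^'m"
  unfolding inner_vec_def trace_def matrix_matrix_mult_def transpose_def
  by (simp add: sum.swap[of _ "UNIV::'m set"])

lemma trace_mult_cyclic: "trace (A ** B ** C) = trace (B ** C ** A)"
  for A :: "real^'n^'m" and B :: "real^'k^'n" and C :: "real^'m^'k"
  by (metis matrix_mul_assoc trace_mul_sym)

lemma trace_transpose: "trace (transpose A) = trace A" for A :: "real^'n^'n"
  by (simp add: trace_def transpose_def)

lemma trace_scaleR: "trace (c *\<^sub>R A) = c * trace A" for A :: "real^'n^'n"
  by (simp add: trace_def sum_distrib_left)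

lemma trace_skew_symmetric:
  fixes S W :: "real^'n^'n"
  assumes "transpose S = S" "transpose W = - W"
  shows "trace (S ** W) = 0"
proof -
  have "trace (S ** W) = trace (transpose (S ** W))" by (simp add: trace_transpose)
  also have "transpose (S ** W) = - (W ** S)"
    by (simp only: matrix_transpose_mul assms matrix_mult_simps)
  also have "trace (- (W ** S)) = - trace (W ** S)"
    by (simp add: trace_def sum_negf)
  finally show ?thesis using trace_mul_sym[of S W] by simp
qed

lemma transpose_mult_self_eq_0_iff: "transpose A ** A = 0 \<longleftrightarrow> A = 0" for A :: "real^'n^'m"
proof
  assume "transpose A ** A = 0"
  then have "A \<bullet> A = 0"
    by (simp add: inner_matrix_eq_trace trace_def)
  then show "A = 0" by simp
qed (simp add: transpose_def vec_eq_iff matrix_matrix_mult_def)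

text \<open>The form that a relation \<open>B ** C = mat 1\<close> takes inside the products that \<open>matrix_mult_simps\<close>
  nests to the left.\<close>

lemma mult_cancel_middle:
  fixes A :: "real^'n^'m" and B :: "real^'k^'n" and C :: "real^'n^'k"
  assumes "B ** C = mat 1" shows "A ** B ** C = A"
  by (metis assms matrix_mul_assoc matrix_mul_rid)

subsection \<open>Inverses\<close>

lemma matrix_inv_unique:
  fixes A B :: "real^'n^'n"
  assumes "A ** B = mat 1"
  shows "matrix_inv A = B"
proof -
  have B: "B ** A = mat 1" using assms matrix_left_right_inverse by blast
  have "A ** matrix_inv A = mat 1 \<and> matrix_inv A ** A = mat 1"
    unfolding matrix_inv_def by (rule someI[of _ B]) (use assms B in auto)
  then show ?thesis by (metis B matrix_mul_assoc matrix_mul_lid matrix_mul_rid)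
qed

lemma matrix_inv_inverse:
  fixes A :: "real^'n^'n"
  assumes "invertible A"
  shows "A ** matrix_inv A = mat 1" "matrix_inv A ** A = mat 1"
  proof -
  obtain B where B: "A ** B = mat 1" "B ** A = mat 1" using assms unfolding invertible_def by blast
  then have "matrix_inv A = B" by (simp add: matrix_inv_unique)
  then show "A ** matrix_inv A = mat 1" "matrix_inv A ** A = mat 1" using B by simp_all
qed

lemma matrix_inv_mult:
  fixes A B :: "real^'n^'n"
  assumes "invertible A" "invertible B"
  shows "matrix_inv (A ** B) = matrix_inv B ** matrix_inv A"
  using assms
  by (intro matrix_inv_unique) (simp add: matrix_mul_assoc mult_cancel_middle matrix_inv_inverse)

lemma invertible_matrix_inv: "invertible A \<Longrightarrow> invertible (matrix_inv A)" for A :: "real^'n^'n"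
  using matrix_inv_inverse invertible_def by blast

lemma matrix_inv_matrix_inv: "invertible A \<Longrightarrow> matrix_inv (matrix_inv A) = A" for A :: "real^'n^'n"
  by (simp add: matrix_inv_inverse matrix_inv_unique)

lemma invertible_orthogonal: "orthogonal_matrix Q \<Longrightarrow> invertible Q" for Q :: "real^'n^'n"
  unfolding orthogonal_matrix_def invertible_def by blast

lemma orthogonal_matrix_cancel:
  fixes Q :: "real^'n^'n" and A :: "real^'n^'m"
  assumes "orthogonal_matrix Q"
  shows "transpose Q ** Q = mat 1" "Q ** transpose Q = mat 1"
    "A ** Q ** transpose Q = A" "A ** transpose Q ** Q = A"
  using assms unfolding orthogonal_matrix_def by (simp_all add: mult_cancel_middle)

subsection \<open>Diagonal matrices\<close>

lemma transpose_diag [simp]: "transpose (diag v) = diag v"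
  by (auto simp: diag_def vec_eq_iff transpose_def)

lemma diag_one: "diag (\<chi> i. 1) = mat 1"
  by (auto simp: diag_def vec_eq_iff mat_def)

lemma matrix_mult_diag_nth: "(A ** diag v) $ i $ j = A $ i $ j * v $ j"
  by (simp add: diag_def matrix_matrix_mult_def if_distrib if_distribR cong: if_cong)

lemma diag_mult_matrix_nth: "(diag v ** A) $ i $ j = v $ i * A $ i $ j"
  by (simp add: diag_def matrix_matrix_mult_def if_distrib if_distribR cong: if_cong)

lemma diag_nth: "diag v $ i $ j = (if i = j then v $ i else 0)"
  by (simp add: diag_def)

lemma diag_mult: "diag u ** diag v = diag (\<chi> i. u $ i * v $ i)" for u v :: "real^'n"
  by (simp add: vec_eq_iff matrix_mult_diag_nth diag_nth)

lemma norm_diag: "(norm (diag v))\<^sup>2 = (\<Sum>i\<in>UNIV. (v $ i)\<^sup>2)"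
proof -
  have "(norm (diag v))\<^sup>2 = diag v \<bullet> diag v" by (simp add: power2_norm_eq_inner)
  also have "\<dots> = (\<Sum>i\<in>UNIV. (v $ i)\<^sup>2)"
    by (simp add: inner_vec_def diag_def power2_eq_square if_distrib if_distribR cong: if_cong)
  finally show ?thesis .
qed

section \<open>Spectral theorem and functional calculus\<close>

lemma symmetric_inner: "transpose A = A \<Longrightarrow> x \<bullet> (A *v y) = (A *v x) \<bullet> y" for A :: "real^'n^'n"
  by (metis dot_lmul_matrix vector_transpose_matrix)

text \<open>A maximiser \<open>v\<close> of the Rayleigh quotient on the unit sphere of \<open>S\<close> is an eigenvector: the residual
  \<open>w = A v - l v\<close> is orthogonal to \<open>v\<close>, and unless it vanishes the quotient grows to first order from
  \<open>v\<close> in the direction of \<open>w\<close>.\<close>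

lemma symmetric_eigenvector_exists:
  fixes A :: "real^'n^'n"
  assumes sym: "transpose A = A" and S: "subspace S" and inv: "\<And>x. x \<in> S \<Longrightarrow> A *v x \<in> S"
    and ne: "x0 \<in> S" "x0 \<noteq> 0"
  obtains v l where "v \<in> S" "norm v = 1" "A *v v = l *\<^sub>R v"
proof -
  let ?K = "S \<inter> sphere 0 1"
  have "compact ?K"
    using closed_subspace[OF S] by (intro closed_Int_compact) auto
  moreover have "(1 / norm x0) *\<^sub>R x0 \<in> ?K"
    using ne S by (auto intro: subspace_scale)
  moreover have "continuous_on ?K (\<lambda>x. x \<bullet> (A *v x))"
    by (intro continuous_intros matrix_vector_mult_linear_continuous_on)
  ultimately obtain v where v: "v \<in> ?K" and
      max: "\<And>y. y \<in> ?K \<Longrightarrow> y \<bullet> (A *v y) \<le> v \<bullet> (A *v v)"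
    using continuous_attains_sup[of ?K "\<lambda>x. x \<bullet> (A *v x)"] by blast
  define l where "l = v \<bullet> (A *v v)"
  have vv: "v \<bullet> v = 1" using v by (simp add: norm_eq_1)
  have max': "y \<bullet> (A *v y) \<le> l * (y \<bullet> y)" if "y \<in> S" for y
  proof (cases "y = 0")
    case False
    have "(1 / norm y) *\<^sub>R y \<in> ?K" using that False S by (auto intro: subspace_scale)
    from max[OF this] show ?thesis
      using False by (simp add: l_def matrix_vector_mult_scaleR divide_simps dot_square_norm power2_eq_square)
  qed simp
  define w where "w = A *v v - l *\<^sub>R v"
  have wS: "w \<in> S" using v inv S by (auto simp: w_def intro: subspace_diff subspace_scale)
  have wv: "w \<bullet> v = 0" by (simp add: w_def inner_diff_left vv l_def inner_commute[of "A *v v"])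
  have "A *v v = w + l *\<^sub>R v" by (simp add: w_def)
  then have ww: "w \<bullet> (A *v v) = w \<bullet> w" using wv by (simp add: inner_add_right)
  have vw: "v \<bullet> (A *v w) = w \<bullet> w"
    using ww symmetric_inner[OF sym, of v w] inner_commute[of "A *v v" w] by simp
  \<comment> \<open>Maximality of \<open>v\<close>, tested at \<open>v + t w\<close>.\<close>
  have *: "2 * t * (w \<bullet> w) \<le> t\<^sup>2 * (l * (w \<bullet> w) - w \<bullet> (A *v w))" for t
  proof -
    have "v + t *\<^sub>R w \<in> S" using v wS S by (auto intro: subspace_add subspace_scale)
    from max'[OF this] show ?thesis
      using wv ww vw vv inner_commute[of v w]
      by (simp add: matrix_vector_right_distrib matrix_vector_mult_scaleR inner_add_left
          inner_add_right l_def[symmetric] power2_eq_square algebra_simps)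
  qed
  \<comment> \<open>A positive linear term in \<open>t\<close> is not dominated by a quadratic one near zero.\<close>
  have "w \<bullet> w \<le> 0"
  proof (rule ccontr)
    assume "\<not> w \<bullet> w \<le> 0"
    then have pos: "w \<bullet> w > 0" by (simp only: not_le)
    define c where "c = \<bar>l * (w \<bullet> w) - w \<bullet> (A *v w)\<bar>"
    define t where "t = (w \<bullet> w) / (c + 1)"
    have c: "c \<ge> 0" by (simp add: c_def)
    have t: "t > 0" using pos c by (simp add: t_def)
    have "2 * t * (w \<bullet> w) \<le> t\<^sup>2 * c"
      using *[of t] by (smt (verit) c_def mult_left_mono zero_le_power2)
    then have "2 * (w \<bullet> w) \<le> t * c" using t by (simp add: power2_eq_square)
    also have "t * c \<le> w \<bullet> w" using c pos by (simp add: t_def field_simps)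
    finally show False using pos by simp
  qed
  then have "w = 0" using inner_gt_zero_iff[of w] by (simp only: not_le[symmetric]) simp
  then have "A *v v = l *\<^sub>R v" by (simp add: w_def)
  then show ?thesis using that v by auto
qed

text \<open>Induction on the dimension: since \<open>A\<close> is symmetric, the orthogonal complement of an eigenvector in
  \<open>S\<close> is invariant as well.\<close>

lemma orthonormal_eigenbasis_exists:
  fixes A :: "real^'n^'n"
  assumes sym: "transpose A = A"
  shows "subspace S \<Longrightarrow> (\<And>x. x \<in> S \<Longrightarrow> A *v x \<in> S) \<Longrightarrow> dim S = k \<Longrightarrow>
    \<exists>B. B \<subseteq> S \<and> finite B \<and> card B = k \<and> pairwise orthogonal B \<and>
      (\<forall>v\<in>B. norm v = 1 \<and> (\<exists>l. A *v v = l *\<^sub>R v))"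
proof (induction k arbitrary: S)
  case 0
  then show ?case by (intro exI[of _ "{}"]) (auto simp: pairwise_def)
next
  case (Suc k)
  then obtain x0 where "x0 \<in> S" "x0 \<noteq> 0"
    by (metis dim_eq_0 nat.distinct(1) singletonI subsetI)
  from symmetric_eigenvector_exists[OF sym Suc.prems(1,2) this]
  obtain v l where v: "v \<in> S" "norm v = 1" "A *v v = l *\<^sub>R v" by metis
  have vv: "v \<bullet> v = 1" using v by (simp add: norm_eq_1)
  define S' where "S' = S \<inter> {y. v \<bullet> y = 0}"
  have sub: "subspace S'"
    unfolding S'_def by (intro subspace_inter Suc.prems(1) subspace_hyperplane)
  have inv: "A *v x \<in> S'" if "x \<in> S'" for x
    using that Suc.prems(2) v symmetric_inner[OF sym, of v x] by (auto simp: S'_def)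
  have "S = span (insert v S')"
  proof
    show "S \<subseteq> span (insert v S')"
    proof
      fix x assume x: "x \<in> S"
      have "x - (v \<bullet> x) *\<^sub>R v \<in> S'"
        using x v Suc.prems(1) vv
        by (auto simp: S'_def inner_diff_right intro: subspace_diff subspace_scale)
      then have "(x - (v \<bullet> x) *\<^sub>R v) + (v \<bullet> x) *\<^sub>R v \<in> span (insert v S')"
        by (intro span_add span_scale span_base) auto
      then show "x \<in> span (insert v S')" by simp
    qed
    show "span (insert v S') \<subseteq> S"
      using v Suc.prems(1) by (intro span_minimal) (auto simp: S'_def)
  qed
  then have "dim S = dim (insert v S')" by (metis dim_span)
  moreover have "v \<notin> span S'" unfolding span_eq_iff[THEN iffD2, OF sub] using vv by (simp add: S'_def)
  ultimately have "dim S' = k" using Suc.prems(3) by (simp add: dim_insert)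
  from Suc.IH[OF sub inv this] obtain B where
    B: "B \<subseteq> S'" "finite B" "card B = k" "pairwise orthogonal B"
      "\<forall>v\<in>B. norm v = 1 \<and> (\<exists>l. A *v v = l *\<^sub>R v)" by auto
  have "v \<notin> B" using B(1) vv by (auto simp: S'_def)
  have "orthogonal v y \<and> orthogonal y v" if "y \<in> B" for y
    using that B(1) by (auto simp: S'_def orthogonal_def inner_commute)
  then have "pairwise orthogonal (insert v B)"
    using B(4) by (simp add: pairwise_insert)
  moreover have "insert v B \<subseteq> S" using B(1) v(1) by (auto simp: S'_def)
  moreover have "card (insert v B) = Suc k" using B(2,3) \<open>v \<notin> B\<close> by simp
  moreover have "\<forall>w\<in>insert v B. norm w = 1 \<and> (\<exists>l. A *v w = l *\<^sub>R w)" using B(5) v by blast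
  ultimately show ?case using B(2) by (intro exI[of _ "insert v B"]) blast
qed

theorem spectral_theorem:
  fixes A :: "real^'n^'n"
  assumes "transpose A = A"
  obtains P d where "orthogonal_matrix P" "A = P ** diag d ** transpose P"
proof -
  obtain B where B: "finite B" "card B = CARD('n)" "pairwise orthogonal B"
      "\<forall>v\<in>B. norm v = 1 \<and> (\<exists>l. A *v v = l *\<^sub>R v)"
    using orthonormal_eigenbasis_exists[OF assms subspace_UNIV, of "CARD('n)"] by auto
  then obtain f where f: "bij_betw f (UNIV::'n set) B"
    by (metis finite_class.finite_UNIV finite_same_card_bij)
  have fB: "f i \<in> B" for i using f by (auto simp: bij_betw_def)
  then have "\<forall>i. \<exists>l. A *v f i = l *\<^sub>R f i" using B(4) by blast
  from choice[OF this] obtain e where e: "\<And>i. A *v f i = e i *\<^sub>R f i" by blast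
  define P :: "real^'n^'n" where "P = (\<chi> i j. f j $ i)"
  have P: "orthogonal_matrix P"
    unfolding orthogonal_matrix_orthonormal_columns
  proof (intro conjI allI impI)
    have col: "column i P = f i" for i by (simp add: P_def column_def)
    show "norm (column i P) = 1" for i using B(4) fB col by simp
    show "orthogonal (column i P) (column j P)" if "i \<noteq> j" for i j
      using that B(3) f fB[of i] fB[of j] col
      by (metis UNIV_I bij_betw_def inj_on_def pairwiseD)
  qed
  have "(A ** P) $ i $ j = (P ** diag (\<chi> i. e i)) $ i $ j" for i j
    using arg_cong[OF e[of j], of "\<lambda>x. x $ i"]
    unfolding matrix_mult_diag_nth
    by (simp add: P_def matrix_matrix_mult_def matrix_vector_mult_def mult.commute)
  then have "A ** P = P ** diag (\<chi> i. e i)" by (simp add: vec_eq_iff)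
  then have "A = P ** diag (\<chi> i. e i) ** transpose P"
    using P by (metis orthogonal_matrix_cancel(3))
  then show ?thesis using P that by blast
qed

text \<open>The functional calculus is well defined. The matrix \<open>W = Q\<^sup>T P\<close> intertwines the two diagonal
  matrices, so an entry \<open>W\<^sub>i\<^sub>j\<close> is nonzero only if \<open>a\<^sub>j = b\<^sub>i\<close>, and then \<open>f(a\<^sub>j) = f(b\<^sub>i)\<close>. With \<open>sqrt\<close>
  and \<open>ln\<close> for \<open>f\<close> this gives the uniqueness of square roots and logarithms.\<close>

lemma spectral_function_cong:
  fixes P Q :: "real^'n^'n"
  assumes P: "orthogonal_matrix P" and Q: "orthogonal_matrix Q"
    and eq: "P ** diag a ** transpose P = Q ** diag b ** transpose Q"
  shows "P ** diag (\<chi> i. f (a $ i)) ** transpose P = Q ** diag (\<chi> i. f (b $ i)) ** transpose Q"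
proof -
  define W where "W = transpose Q ** P"
  have "W ** diag a = transpose Q ** (P ** diag a ** transpose P) ** P"
    by (simp add: W_def matrix_mul_assoc orthogonal_matrix_cancel P)
  also have "\<dots> = diag b ** W"
    by (simp add: W_def eq matrix_mul_assoc orthogonal_matrix_cancel Q)
  finally have "(W ** diag a) $ i $ j = (diag b ** W) $ i $ j" for i j by simp
  then have "W $ i $ j = 0 \<or> a $ j = b $ i" for i j
    by (simp add: matrix_mult_diag_nth diag_mult_matrix_nth mult.commute)
  then have W: "W ** diag (\<chi> i. f (a $ i)) = diag (\<chi> i. f (b $ i)) ** W"
    by (auto simp: vec_eq_iff matrix_mult_diag_nth diag_mult_matrix_nth)
      (metis mult.commute mult_zero_left)
  have "P ** diag (\<chi> i. f (a $ i)) ** transpose P = Q ** (W ** diag (\<chi> i. f (a $ i))) ** transpose P"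
    by (simp add: W_def matrix_mul_assoc orthogonal_matrix_cancel Q)
  also have "\<dots> = Q ** diag (\<chi> i. f (b $ i)) ** transpose Q"
    unfolding W by (simp add: W_def matrix_mul_assoc orthogonal_matrix_cancel P)
  finally show ?thesis .
qed

lemma transpose_spectral:
  "transpose (P ** diag d ** transpose P) = P ** diag d ** transpose P" for P :: "real^'n^'m"
  by (simp add: matrix_transpose_mul matrix_mul_assoc)

lemma spectral_mult:
  fixes P :: "real^'n^'n"
  assumes "orthogonal_matrix P"
  shows "(P ** diag a ** transpose P) ** (P ** diag b ** transpose P)
    = P ** diag (\<chi> i. a $ i * b $ i) ** transpose P"
proof -
  have "(P ** diag a ** transpose P) ** (P ** diag b ** transpose P)
      = P ** (diag a ** diag b) ** transpose P"
    by (simp add: matrix_mul_assoc orthogonal_matrix_cancel assms)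
  then show ?thesis by (simp add: diag_mult)
qed

lemma spectral_one:
  fixes P :: "real^'n^'n"
  assumes "orthogonal_matrix P"
  shows "P ** diag (\<chi> i. 1) ** transpose P = mat 1"
  using assms by (simp add: diag_one orthogonal_matrix_cancel)

lemma bounded_linear_diag: "bounded_linear (diag :: real^'n \<Rightarrow> _)"
  unfolding linear_conv_bounded_linear[symmetric]
  by (auto intro!: linearI simp: vec_eq_iff diag_def)

lemma bounded_linear_conjugation:
  "bounded_linear (\<lambda>D. A ** D ** B)" for A :: "real^'n^'m" and B :: "real^'k^'l"
  by (intro bounded_linear_compose[OF bounded_bilinear.bounded_linear_left[OF bounded_bilinear_matrix_mult]]
      bounded_bilinear.bounded_linear_right[OF bounded_bilinear_matrix_mult])

lemmas spectral_bounded_linear = bounded_linear_compose[OF bounded_linear_conjugation bounded_linear_diag]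

lemma spectral_scaleR:
  "c *\<^sub>R (A ** diag d ** B) = A ** diag (\<chi> i. c * d $ i) ** B"
  for A :: "real^'n^'m" and B :: "real^'k^'n"
proof -
  have "(\<chi> i. c * d $ i) = c *\<^sub>R d" by (simp add: vec_eq_iff)
  then show ?thesis
    using linear_scale[OF bounded_linear.linear[OF spectral_bounded_linear[of A B]], of c d] by simp
qed

subsection \<open>The exponential of a symmetric matrix\<close>

text \<open>Every power of the matrix is diagonalised by \<open>P\<close>, so the exponential series can be summed on the
  diagonal.\<close>

lemma mexp_spectral:
  fixes P :: "real^'n^'n"
  assumes P: "orthogonal_matrix P"
  shows "mexp (P ** diag d ** transpose P) = P ** diag (\<chi> i. exp (d $ i)) ** transpose P"
proof -
  let ?A = "P ** diag d ** transpose P"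
  have pow: "((**) ?A ^^ m) (mat 1) = P ** diag (\<chi> i. d $ i ^ m) ** transpose P" for m
    by (induction m) (use P in \<open>simp_all add: spectral_one spectral_mult\<close>)
  have "(\<lambda>m. \<chi> i. (1 / fact m) * d $ i ^ m) sums (\<chi> i. exp (d $ i))"
    unfolding sums_def
  proof (rule vec_tendstoI)
    fix i
    show "(\<lambda>n. (\<Sum>m<n. \<chi> i. (1 / fact m) * d $ i ^ m) $ i)
        \<longlonglongrightarrow> (\<chi> i. exp (d $ i)) $ i"
      using exp_converges[of "d $ i"] by (simp add: sums_def divide_inverse mult.commute)
  qed
  from bounded_linear.sums[OF spectral_bounded_linear[of P "transpose P"] this]
  show ?thesis
    unfolding mexp_def pow spectral_scaleR by (simp add: sums_iff)
qed

lemma mexp_symmetric: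
  fixes L :: "real^'n^'n"
  assumes "transpose L = L"
  shows "transpose (mexp L) = mexp L"
  by (rule spectral_theorem[OF assms]) (metis mexp_spectral transpose_spectral)

lemma mexp_0: "mexp (0 :: real^'n^'n) = mat 1"
proof -
  have "(0 :: real^'n^'n) = mat 1 ** diag (\<chi> i. 0) ** transpose (mat 1)"
    by (simp add: vec_eq_iff diag_def)
  then show ?thesis
    using mexp_spectral[of "mat 1 :: real^'n^'n" "\<chi> i. 0"] by (simp add: orthogonal_matrix_id diag_one)
qed

lemma mexp_minus:
  fixes L :: "real^'n^'n"
  assumes "transpose L = L"
  shows "mexp L ** mexp (- L) = mat 1"
proof -
  obtain P d where P: "orthogonal_matrix P" and L: "L = P ** diag d ** transpose P"
    using spectral_theorem[OF assms] .
  have "- L = P ** diag (\<chi> i. - d $ i) ** transpose P"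
    using spectral_scaleR[of "-1" P d "transpose P"] by (simp add: L)
  then show ?thesis
    using P by (simp add: L mexp_spectral spectral_mult spectral_one mult_exp_exp)
qed

lemma has_vector_derivative_vec_lambda:
  assumes "\<And>i. (f i has_real_derivative f' i) (at t)"
  shows "((\<lambda>t. \<chi> i. f i t) has_vector_derivative (\<chi> i. f' i)) (at t)"
  using assms
  by (subst has_vector_derivative_def, subst has_derivative_componentwise_within)
    (auto simp: Basis_vec_def inner_axis has_field_derivative_def mult.commute[of _ "f' _"])

lemma mexp_scaleR_vector_derivative:
  fixes L :: "real^'n^'n"
  assumes "transpose L = L"
  shows "((\<lambda>t. mexp (t *\<^sub>R L)) has_vector_derivative L ** mexp (t *\<^sub>R L)) (at t)"
proof -
  obtain P d where P: "orthogonal_matrix P" and L: "L = P ** diag d ** transpose P"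
    using spectral_theorem[OF assms] .
  have "((\<lambda>t. \<chi> i. exp (t * d $ i)) has_vector_derivative (\<chi> i. d $ i * exp (t * d $ i))) (at t)"
    by (rule has_vector_derivative_vec_lambda) (auto intro!: derivative_eq_intros)
  from bounded_linear.has_vector_derivative[OF spectral_bounded_linear[of P "transpose P"] this]
  show ?thesis
    using P by (simp add: L spectral_scaleR mexp_spectral spectral_mult)
qed

subsection \<open>Positive definite matrices\<close>

lemma spd_symmetric: "S \<in> spd \<Longrightarrow> transpose S = S"
  by (simp add: spd_def symmetric_mats_def)

lemma inner_congruence: "x \<bullet> ((transpose G ** S ** G) *v x) = (G *v x) \<bullet> (S *v (G *v x))"
  for S :: "real^'n^'n" and G :: "real^'m^'n"
proof -
  have "(transpose G ** S ** G) *v x = transpose G *v (S *v (G *v x))"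
    by (simp add: matrix_vector_mul_assoc matrix_mul_assoc del: transpose_matrix_vector)
  then show ?thesis using dot_lmul_matrix[of "S *v (G *v x)" G x] by (simp add: inner_commute)
qed

lemma spd_congruence:
  fixes S :: "real^'n^'n" and G :: "real^'m^'n"
  assumes "S \<in> spd" "\<And>x. x \<noteq> 0 \<Longrightarrow> G *v x \<noteq> 0"
  shows "transpose G ** S ** G \<in> spd"
  unfolding spd_def symmetric_mats_def
  using assms
  by (auto simp: inner_congruence spd_symmetric matrix_transpose_mul matrix_mul_assoc)
    (simp add: spd_def)

lemma invertible_injective: "invertible G \<Longrightarrow> x \<noteq> 0 \<Longrightarrow> G *v x \<noteq> 0" for G :: "real^'n^'n"
  using inj_matrix_vector_mult[of G] by (metis injD matrix_vector_mult_0_right)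

lemma spd_diag: "(\<And>i. 0 < d $ i) \<Longrightarrow> diag d \<in> spd" for d :: "real^'n"
proof -
  assume d: "\<And>i. 0 < d $ i"
  have "0 < x \<bullet> (diag d *v x)" if x: "x \<noteq> 0" for x
  proof -
    have "diag d *v x = (\<chi> i. d $ i * x $ i)"
      by (simp add: vec_eq_iff matrix_vector_mult_def diag_def if_distribR if_distrib cong: if_cong)
    then have eq: "x \<bullet> (diag d *v x) = (\<Sum>i\<in>UNIV. d $ i * (x $ i)\<^sup>2)"
      by (simp add: inner_vec_def power2_eq_square mult.left_commute)
    obtain i where "x $ i \<noteq> 0" using x by (auto simp: vec_eq_iff)
    then have "0 < d $ i * (x $ i)\<^sup>2" using d by simp
    then show ?thesis unfolding eq
      using less_imp_le[OF d] by (intro sum_pos2[of UNIV i]) auto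
  qed
  then show ?thesis by (simp add: spd_def symmetric_mats_def)
qed

lemma spd_spectral:
  fixes P :: "real^'n^'n"
  assumes P: "orthogonal_matrix P" and d: "\<And>i. 0 < d $ i"
  shows "P ** diag d ** transpose P \<in> spd"
  using spd_congruence[OF spd_diag, of d "transpose P"] d invertible_injective[of "transpose P"]
    invertible_orthogonal[of "transpose P"] P by simp

lemma spd_spectral_obtain:
  fixes S :: "real^'n^'n"
  assumes "S \<in> spd"
  obtains P d where "orthogonal_matrix P" "S = P ** diag d ** transpose P" "\<And>i. 0 < d $ i"
proof -
  obtain P d where P: "orthogonal_matrix P" and S: "S = P ** diag d ** transpose P"
    using spectral_theorem[OF spd_symmetric[OF assms]] .
  have "diag d = transpose P ** S ** P"
    by (simp add: S matrix_mul_assoc orthogonal_matrix_cancel P)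
  also have "\<dots> \<in> spd"
    using assms invertible_orthogonal[OF P] by (intro spd_congruence invertible_injective)
  finally have D: "diag d \<in> spd" .
  have "0 < d $ i" for i
  proof -
    have "axis i (1::real) \<bullet> (diag d *v axis i 1) = d $ i"
      by (simp add: inner_axis' matrix_vector_mult_basis column_def diag_def)
    moreover have "axis i (1::real) \<noteq> 0" by (simp add: axis_eq_0_iff)
    ultimately show ?thesis using D unfolding spd_def by (smt (verit) mem_Collect_eq)
  qed
  then show ?thesis using that P S by blast
qed

lemma spectral_inverse:
  fixes P :: "real^'n^'n"
  assumes P: "orthogonal_matrix P" and d: "\<And>i. d $ i \<noteq> 0"
  shows "matrix_inv (P ** diag d ** transpose P) = P ** diag (\<chi> i. inverse (d $ i)) ** transpose P"
  by (rule matrix_inv_unique) (simp add: spectral_mult P d spectral_one)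

lemma spd_invertible: "S \<in> spd \<Longrightarrow> invertible S" for S :: "real^'n^'n"
proof -
  assume "S \<in> spd"
  then obtain P d where P: "orthogonal_matrix P" "S = P ** diag d ** transpose P" "\<And>i. 0 < d $ i"
    by (rule spd_spectral_obtain) blast
  then have "S ** (P ** diag (\<chi> i. inverse (d $ i)) ** transpose P) = mat 1"
    by (simp add: spectral_mult spectral_one less_imp_neq[symmetric])
  then show ?thesis using invertible_right_inverse by blast
qed

lemmas spd_inv_cancel = matrix_inv_inverse[OF spd_invertible]

lemma spd_matrix_inv: "S \<in> spd \<Longrightarrow> matrix_inv S \<in> spd" for S :: "real^'n^'n"
  by (elim spd_spectral_obtain) (simp add: spectral_inverse less_imp_neq[symmetric] spd_spectral)

lemma mexp_spd:
  fixes L :: "real^'n^'n"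
  assumes "transpose L = L"
  shows "mexp L \<in> spd"
  by (rule spectral_theorem[OF assms]) (simp add: mexp_spectral spd_spectral)

subsection \<open>Square root and logarithm\<close>

lemma spd_root_unique:
  fixes Q R :: "real^'n^'n"
  assumes Q: "Q \<in> spd" and R: "R \<in> spd" and eq: "Q ** Q = R ** R"
  shows "Q = R"
proof -
  obtain U a where U: "orthogonal_matrix U" and Qe: "Q = U ** diag a ** transpose U" and a: "\<And>i. 0 < a $ i"
    using spd_spectral_obtain[OF Q] by blast
  obtain V b where V: "orthogonal_matrix V" and Re: "R = V ** diag b ** transpose V" and b: "\<And>i. 0 < b $ i"
    using spd_spectral_obtain[OF R] by blast
  have "U ** diag (\<chi> i. a $ i * a $ i) ** transpose U = V ** diag (\<chi> i. b $ i * b $ i) ** transpose V"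
    using eq U V by (simp add: Qe Re spectral_mult)
  from spectral_function_cong[OF U V this, of sqrt] show ?thesis
    using a b by (simp add: Qe Re less_imp_le)
qed

lemma msqrt_unique:
  fixes R :: "real^'n^'n"
  assumes "R \<in> spd" shows "msqrt (R ** R) = R"
  unfolding msqrt_def using assms spd_root_unique by (intro the_equality) auto

lemma spd_root_exists:
  fixes S :: "real^'n^'n"
  assumes "S \<in> spd"
  shows "\<exists>R\<in>spd. R ** R = S"
proof -
  obtain P d where P: "orthogonal_matrix P" "S = P ** diag d ** transpose P" "\<And>i. 0 < d $ i"
    using spd_spectral_obtain[OF assms] by blast
  then show ?thesis
    by (intro bexI[of _ "P ** diag (\<chi> i. sqrt (d $ i)) ** transpose P"])
      (simp_all add: spectral_mult less_imp_le spd_spectral)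
qed

lemma msqrt_spd: "S \<in> spd \<Longrightarrow> msqrt S \<in> spd"
  and msqrt_square: "S \<in> spd \<Longrightarrow> msqrt S ** msqrt S = S" for S :: "real^'n^'n"
  using spd_root_exists msqrt_unique by metis+

lemma mexp_inj:
  fixes K L :: "real^'n^'n"
  assumes K: "transpose K = K" and L: "transpose L = L" and eq: "mexp K = mexp L"
  shows "K = L"
proof -
  obtain U a where U: "orthogonal_matrix U" and Ke: "K = U ** diag a ** transpose U"
    using spectral_theorem[OF K] by blast
  obtain V b where V: "orthogonal_matrix V" and Le: "L = V ** diag b ** transpose V"
    using spectral_theorem[OF L] by blast
  have "U ** diag (\<chi> i. exp (a $ i)) ** transpose U = V ** diag (\<chi> i. exp (b $ i)) ** transpose V"
    using eq U V by (simp add: Ke Le mexp_spectral)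
  from spectral_function_cong[OF U V this, of ln] show ?thesis
    by (simp add: Ke Le)
qed

lemma mlog_unique:
  fixes L :: "real^'n^'n"
  assumes "transpose L = L" shows "mlog (mexp L) = L"
  unfolding mlog_def
  using assms mexp_inj by (intro the_equality) (auto simp: symmetric_mats_def)

lemma mexp_surj:
  fixes S :: "real^'n^'n"
  assumes "S \<in> spd"
  shows "\<exists>L. transpose L = L \<and> mexp L = S"
proof -
  obtain P d where P: "orthogonal_matrix P" "S = P ** diag d ** transpose P" "\<And>i. 0 < d $ i"
    using spd_spectral_obtain[OF assms] by blast
  then show ?thesis
    by (intro exI[of _ "P ** diag (\<chi> i. ln (d $ i)) ** transpose P"])
      (simp add: mexp_spectral transpose_spectral)
qed

lemma mlog_symmetric: "S \<in> spd \<Longrightarrow> transpose (mlog S) = mlog S"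
  and mexp_mlog: "S \<in> spd \<Longrightarrow> mexp (mlog S) = S" for S :: "real^'n^'n"
  using mexp_surj mlog_unique by metis+

lemma mlog_matrix_inv:
  fixes S :: "real^'n^'n"
  assumes "S \<in> spd" shows "mlog (matrix_inv S) = - mlog S"
proof -
  have "mexp (- mlog S) = matrix_inv S"
    using mexp_minus[OF mlog_symmetric[OF assms]] by (simp add: mexp_mlog assms matrix_inv_unique)
  then show ?thesis
    using mlog_unique[of "- mlog S"] mlog_symmetric[OF assms] by (simp add: transpose_simps)
qed

lemma msqrt_matrix_inv:
  fixes S :: "real^'n^'n"
  assumes "S \<in> spd" shows "msqrt (matrix_inv S) = matrix_inv (msqrt S)"
  using msqrt_unique[OF spd_matrix_inv[OF msqrt_spd[OF assms]]]
    matrix_inv_mult[of "msqrt S" "msqrt S"] msqrt_square[OF assms] spd_invertible[OF msqrt_spd[OF assms]]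
  by simp

subsection \<open>Orthogonal congruence\<close>

text \<open>These rules express that the functional calculus does not depend on the orthonormal basis; they
  carry the change of frame \<open>U \<mapsto> U Q\<close> through the definition of the curve.\<close>

lemma spd_orthogonal_congruence:
  fixes S Q :: "real^'n^'n"
  assumes "S \<in> spd" "orthogonal_matrix Q" shows "transpose Q ** S ** Q \<in> spd"
  using assms by (intro spd_congruence invertible_injective invertible_orthogonal)

lemma mexp_orthogonal_congruence:
  fixes L Q :: "real^'n^'n"
  assumes L: "transpose L = L" and Q: "orthogonal_matrix Q"
  shows "mexp (transpose Q ** L ** Q) = transpose Q ** mexp L ** Q"
proof -
  obtain P d where P: "orthogonal_matrix P" and Le: "L = P ** diag d ** transpose P"
    using spectral_theorem[OF L] by blast
  have QP: "orthogonal_matrix (transpose Q ** P)" using P Q by (simp add: orthogonal_matrix_mul)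
  show ?thesis
    using mexp_spectral[OF QP, of d]
    by (simp add: Le mexp_spectral P matrix_transpose_mul matrix_mul_assoc)
qed

lemma mlog_orthogonal_congruence:
  fixes S Q :: "real^'n^'n"
  assumes S: "S \<in> spd" and Q: "orthogonal_matrix Q"
  shows "mlog (transpose Q ** S ** Q) = transpose Q ** mlog S ** Q"
proof -
  have "transpose (transpose Q ** mlog S ** Q) = transpose Q ** mlog S ** Q"
    by (simp add: matrix_transpose_mul mlog_symmetric S matrix_mul_assoc)
  from mlog_unique[OF this] show ?thesis
    by (simp add: mexp_orthogonal_congruence mlog_symmetric S Q mexp_mlog)
qed

lemma msqrt_orthogonal_congruence:
  fixes S Q :: "real^'n^'n"
  assumes S: "S \<in> spd" and Q: "orthogonal_matrix Q"
  shows "msqrt (transpose Q ** S ** Q) = transpose Q ** msqrt S ** Q"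
proof -
  have "transpose Q ** msqrt S ** Q ** (transpose Q ** msqrt S ** Q) = transpose Q ** (msqrt S ** msqrt S) ** Q"
    by (simp add: matrix_mul_assoc orthogonal_matrix_cancel Q)
  then show ?thesis
    using msqrt_unique[OF spd_orthogonal_congruence[OF msqrt_spd[OF S] Q]] by (simp add: msqrt_square S)
qed

lemma matrix_inv_orthogonal_congruence:
  fixes S Q :: "real^'n^'n"
  assumes S: "invertible S" and Q: "orthogonal_matrix Q"
  shows "matrix_inv (transpose Q ** S ** Q) = transpose Q ** matrix_inv S ** Q"
proof (rule matrix_inv_unique)
  have "transpose Q ** S ** Q ** (transpose Q ** matrix_inv S ** Q) = transpose Q ** (S ** matrix_inv S) ** Q"
    by (simp add: matrix_mul_assoc orthogonal_matrix_cancel Q)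
  then show "transpose Q ** S ** Q ** (transpose Q ** matrix_inv S ** Q) = mat 1"
    by (simp add: matrix_inv_inverse S orthogonal_matrix_cancel Q)
qed

section \<open>The structure space and its quotient\<close>

lemma stiefelD: "U \<in> stiefel \<Longrightarrow> transpose U ** U = mat 1"
  by (simp add: stiefel_def)

lemma stiefel_cancel:
  fixes U :: "real^'p^'n" and M :: "real^'p^'m"
  assumes "U \<in> stiefel" shows "M ** transpose U ** U = M"
  using assms by (simp add: mult_cancel_middle stiefelD)

text \<open>\<open>U U\<^sup>T\<close> is the orthogonal projection onto the column space of \<open>U\<close>.\<close>

lemma stiefel_projection:
  fixes U :: "real^'p^'n" and M :: "real^'m^'n"
  assumes U: "U \<in> stiefel" and range: "range ((*v) M) \<subseteq> range ((*v) U)"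
  shows "U ** transpose U ** M = M"
  unfolding matrix_eq
proof
  fix x
  obtain y where y: "M *v x = U *v y" using range by (metis rangeE rangeI subsetD)
  have "(U ** transpose U ** M) *v x = (U ** transpose U ** U) *v y"
    using y by (metis matrix_vector_mul_assoc)
  then show "(U ** transpose U ** M) *v x = M *v x" by (simp add: stiefel_cancel U y)
qed

lemma stiefel_injective: "U \<in> stiefel \<Longrightarrow> x \<noteq> 0 \<Longrightarrow> U *v x \<noteq> 0" for U :: "real^'p^'n"
  by (metis matrix_vector_mul_assoc matrix_vector_mul_lid matrix_vector_mult_0_right stiefelD)

lemma rank_stiefel: "U \<in> stiefel \<Longrightarrow> rank U = CARD('p)" for U :: "real^'p^'n"
  using stiefel_injective[of U] full_rank_injective[of U]
  by (metis Real_Vector_Spaces.linear_injective_0 matrix_vector_mul_linear)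

lemma dim_stiefel_complement:
  fixes U :: "real^'p^'n"
  assumes "U \<in> stiefel"
  shows "dim {x. transpose U *v x = 0} = CARD('n) - CARD('p)"
proof -
  let ?R = "range ((*v) U)"
  have "{x. transpose U *v x = 0} = {y \<in> UNIV. \<forall>x \<in> ?R. orthogonal x y}"
  proof (intro set_eqI iffI; clarsimp simp del: transpose_matrix_vector)
    fix x y assume "transpose U *v x = 0"
    then show "orthogonal (U *v y) x"
      using dot_lmul_matrix[of x U y] by (simp add: orthogonal_def inner_commute)
  next
    fix x assume *: "\<forall>y. orthogonal (U *v y) x"
    have "(transpose U *v x) \<bullet> y = 0" for y
      using *[rule_format, of y] dot_lmul_matrix[of x U y] by (simp add: orthogonal_def inner_commute)
    then show "transpose U *v x = 0" using inner_eq_zero_iff by blast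
  qed
  moreover have "dim {y \<in> UNIV. \<forall>x \<in> ?R. orthogonal x y} + dim ?R = dim (UNIV :: (real^'n) set)"
    by (rule dim_subspace_orthogonal_to_vectors) (auto intro!: linear_subspace_image)
  moreover have "dim ?R = CARD('p)"
    using rank_stiefel[OF assms] by (simp add: rank_dim_range)
  ultimately show ?thesis by simp
qed

lemma transpose_mult_eq_0_iff_columns:
  "transpose U ** \<Delta> = 0 \<longleftrightarrow> (\<forall>j. transpose U *v column j \<Delta> = 0)" for U :: "real^'p^'n"
  by (auto simp: vec_eq_iff matrix_matrix_mult_def matrix_vector_mult_def column_def
      simp del: transpose_matrix_vector)

text \<open>Removes the choice of \<open>U\<^sub>\<bottom>\<close>. Conversely to the evident inclusion, an orthonormal basis of the
  complement of the column space of \<open>U\<close> serves as \<open>U\<^sub>\<bottom>\<close>, and the Fourier coefficients of the columns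
  of \<open>\<Delta>\<close> in this basis form \<open>B\<close>.\<close>

lemma normal_mats_stiefel:
  fixes U :: "real^'p^'n"
  assumes U: "U \<in> stiefel"
  shows "normal_mats U = {\<Delta>. transpose U ** \<Delta> = 0}"
proof (intro set_eqI iffI CollectI; (elim CollectE)?)
  fix \<Delta> assume "\<Delta> \<in> normal_mats U"
  then obtain Up :: "nat \<Rightarrow> real^'n" and B :: "nat \<Rightarrow> real^'p" where
    Up: "\<And>i. i < CARD('n) - CARD('p) \<Longrightarrow> transpose U *v Up i = 0" and
    \<Delta>: "\<Delta> = (\<chi> a b. \<Sum>i < CARD('n) - CARD('p). Up i $ a * B i $ b)"
    unfolding normal_mats_def by blast
  have "column b \<Delta> = (\<Sum>i < CARD('n) - CARD('p). B i $ b *\<^sub>R Up i)" for b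
    by (simp add: column_def \<Delta> vec_eq_iff mult.commute)
  then show "transpose U ** \<Delta> = 0"
    using Up unfolding transpose_mult_eq_0_iff_columns
    by (simp add: linear_sum[OF matrix_vector_mul_linear] matrix_vector_mult_scaleR
        del: transpose_matrix_vector)
next
  fix \<Delta> :: "real^'p^'n" assume \<Delta>: "transpose U ** \<Delta> = 0"
  let ?W = "{x. transpose U *v x = 0}"
  have "subspace ?W"
    using linear_subspace_kernel[OF matrix_vector_mul_linear, of "transpose U"] .
  then obtain C where C: "C \<subseteq> ?W" "pairwise orthogonal C" "\<And>x. x \<in> C \<Longrightarrow> norm x = 1"
      "independent C" "card C = dim ?W" "span C = ?W"
    using orthonormal_basis_subspace by blast
  then have fin: "finite C" by (simp add: independent_imp_finite)
  have cardC: "card C = CARD('n) - CARD('p)" using C dim_stiefel_complement[OF U] by simp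
  then obtain Up where bij: "bij_betw Up {..<CARD('n) - CARD('p)} C"
    using bij_betw_from_nat_into_finite[OF fin] by (metis lessThan_atLeast0 ex_bij_betw_nat_finite fin)
  define B :: "nat \<Rightarrow> real^'p" where "B i = (\<chi> b. column b \<Delta> \<bullet> Up i)" for i
  have col: "column b \<Delta> = (\<Sum>i < CARD('n) - CARD('p). (column b \<Delta> \<bullet> Up i) *\<^sub>R Up i)" for b
  proof -
    \<comment> \<open>Fourier expansion in the orthonormal basis \<open>C\<close>, by linearity.\<close>
    have "column b \<Delta> \<in> span C"
      using \<Delta> unfolding C(6) transpose_mult_eq_0_iff_columns by simp
    then have "column b \<Delta> = (\<Sum>v\<in>C. (column b \<Delta> \<bullet> v) *\<^sub>R v)"
    proof (induction rule: span_induct_alt)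
      case base
      then show ?case by simp
    next
      case (step c x y)
      have "(\<Sum>v\<in>C. (x \<bullet> v) *\<^sub>R v) = (\<Sum>v\<in>C. (if v = x then v else 0))"
        using C(2,3) step(1)
        by (intro sum.cong) (auto simp: pairwise_def orthogonal_def norm_eq_1)
      also have "\<dots> = x" using step(1) fin by simp
      finally have "(\<Sum>v\<in>C. (x \<bullet> v) *\<^sub>R v) = x" .
      then have "(\<Sum>v\<in>C. ((c *\<^sub>R x + y) \<bullet> v) *\<^sub>R v) = c *\<^sub>R x + (\<Sum>v\<in>C. (y \<bullet> v) *\<^sub>R v)"
        by (simp add: inner_add_left scaleR_add_left sum.distrib flip: scaleR_scaleR scaleR_sum_right)
      then show ?case using step by simp
    qed
    also have "\<dots> = (\<Sum>i < CARD('n) - CARD('p). (column b \<Delta> \<bullet> Up i) *\<^sub>R Up i)"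
      using bij by (simp add: sum.reindex_bij_betw[symmetric])
    finally show ?thesis .
  qed
  show "\<Delta> \<in> normal_mats U"
    unfolding normal_mats_def
  proof (intro CollectI exI[of _ Up] exI[of _ B] conjI allI impI)
    fix i j assume ij: "i < CARD('n) - CARD('p)" "j < CARD('n) - CARD('p)"
    then have "Up i \<in> C" "Up j \<in> C" "Up i = Up j \<longleftrightarrow> i = j"
      using bij by (auto simp: bij_betw_def inj_on_def)
    then show "Up i \<bullet> Up j = (if i = j then 1 else 0)"
      using C(2,3) by (auto simp: pairwise_def orthogonal_def norm_eq_1)
  next
    fix i assume "i < CARD('n) - CARD('p)"
    then have "Up i \<in> C" using bij by (auto simp: bij_betw_def)
    then show "transpose U *v Up i = 0" using C(1) by blast
  next
    have "\<Delta> $ a $ b = column b \<Delta> $ a" for a b by (simp add: column_def)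
    then show "\<Delta> = (\<chi> a b. \<Sum>i < CARD('n) - CARD('p). Up i $ a * B i $ b)"
      by (subst (asm) col) (simp add: vec_eq_iff B_def mult.commute)
  qed
qed

text \<open>The mixed terms in \<open>(U \<Omega>\<^sub>1 + \<Delta>\<^sub>1)\<^sup>T (U \<Omega>\<^sub>2 + \<Delta>\<^sub>2)\<close> vanish, so the Stiefel part of the metric is the
  ambient inner product, whatever the decomposition.\<close>

lemma structure_metric_tangent:
  fixes U X1 X2 :: "real^'p^'n" and S D1 D2 :: "real^'p^'p"
  assumes U: "U \<in> stiefel"
    and X: "transpose U ** X1 \<in> skew_mats" "transpose U ** X2 \<in> skew_mats"
    and D: "D1 \<in> symmetric_mats" "D2 \<in> symmetric_mats"
  shows "structure_metric k (U, S) (X1, D1) (X2, D2)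
    = X1 \<bullet> X2 + k * trace (D1 ** matrix_inv S ** D2 ** matrix_inv S)"
proof -
  have split: "X - U ** (transpose U ** X) \<in> normal_mats U" for X :: "real^'p^'n"
    by (simp add: normal_mats_stiefel U matrix_mult_simps stiefelD)
  have val: "trace (transpose \<Omega>1 ** \<Omega>2 + transpose \<Delta>1 ** \<Delta>2) = X1 \<bullet> X2"
    if N: "\<Delta>1 \<in> normal_mats U" "\<Delta>2 \<in> normal_mats U"
      and Xs: "X1 = U ** \<Omega>1 + \<Delta>1" "X2 = U ** \<Omega>2 + \<Delta>2" for \<Omega>1 \<Omega>2 \<Delta>1 \<Delta>2
  proof -
    have n: "transpose U ** \<Delta>2 = 0" "transpose \<Delta>1 ** U = 0"
      using N unfolding normal_mats_stiefel[OF U]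
      by (simp, metis (mono_tags) mem_Collect_eq matrix_transpose_mul transpose_transpose
          times0_left mat_0 transpose_mat)
    have "transpose X1 ** X2 = transpose \<Omega>1 ** (transpose U ** U) ** \<Omega>2
        + transpose \<Omega>1 ** (transpose U ** \<Delta>2) + transpose \<Delta>1 ** U ** \<Omega>2 + transpose \<Delta>1 ** \<Delta>2"
      by (simp add: Xs transpose_simps matrix_mult_simps)
    then show ?thesis by (simp add: inner_matrix_eq_trace n stiefelD U)
  qed
  show ?thesis
    unfolding structure_metric_def prod.case
  proof (rule the_equality, goal_cases)
    case 1
    show ?case
      by (intro bexI[of _ "transpose U ** X1"] bexI[of _ "transpose U ** X2"]
          bexI[of _ "X1 - U ** (transpose U ** X1)"] bexI[of _ "X2 - U ** (transpose U ** X2)"] conjI)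
        (use X D in \<open>simp_all add: split val\<close>)
  next
    case (2 r)
    then show ?case using val by auto
  qed
qed

definition quotient_differential ::
  "(real^'p^'n) \<times> (real^'p^'p) \<Rightarrow> (real^'p^'n) \<times> (real^'p^'p) \<Rightarrow> real^'n^'n" where
  "quotient_differential = (\<lambda>(U, S) (X, D).
     X ** S ** transpose U + U ** D ** transpose U + U ** S ** transpose X)"

lemma quotient_proj_has_derivative:
  fixes z :: "(real^'p^'n) \<times> (real^'p^'p)"
  shows "(quotient_proj has_derivative quotient_differential z) (at z)"
proof -
  note mult = bounded_bilinear.FDERIV[OF bounded_bilinear_matrix_mult]
  have "((\<lambda>z. fst z ** snd z ** transpose (fst z)) has_derivative
     (\<lambda>h. fst z ** snd z ** transpose (fst h) + (fst z ** snd h + fst h ** snd z) ** transpose (fst z))) (at z)"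
    by (intro mult bounded_linear.has_derivative[OF bounded_linear_transpose]
        bounded_linear_imp_has_derivative bounded_linear_fst bounded_linear_snd)
  moreover have "(\<lambda>h. fst z ** snd z ** transpose (fst h) + (fst z ** snd h + fst h ** snd z) ** transpose (fst z))
      = quotient_differential z"
    by (auto simp: quotient_differential_def fun_eq_iff split_beta matrix_mult_simps)
  moreover have "quotient_proj = (\<lambda>z :: (real^'p^'n) \<times> (real^'p^'p). fst z ** snd z ** transpose (fst z))"
    by (auto simp: quotient_proj_def fun_eq_iff split_beta)
  ultimately show ?thesis by simp
qed

lemma horizontal_space_iff:
  fixes U :: "real^'p^'n"
  assumes U: "U \<in> stiefel" and S: "S \<in> spd"
  shows "(\<Delta>, D) \<in> horizontal_space (U, S) \<longleftrightarrow> transpose U ** \<Delta> = 0 \<and> transpose D = D"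
proof -
  let ?R = "msqrt S"
  have R: "?R \<in> spd" and Rt: "transpose ?R = ?R" "transpose (matrix_inv ?R) = matrix_inv ?R"
    using spd_symmetric spd_matrix_inv msqrt_spd[OF S] by blast+
  have "(\<exists>D0\<in>symmetric_mats. D = ?R ** D0 ** ?R) \<longleftrightarrow> transpose D = D"
  proof
    assume "transpose D = D"
    then have "matrix_inv ?R ** D ** matrix_inv ?R \<in> symmetric_mats"
      by (simp add: symmetric_mats_def matrix_transpose_mul Rt matrix_mul_assoc)
    moreover have "?R ** (matrix_inv ?R ** D ** matrix_inv ?R) ** ?R = D"
      by (simp add: matrix_mul_assoc mult_cancel_middle spd_inv_cancel[OF R])
    ultimately show "\<exists>D0\<in>symmetric_mats. D = ?R ** D0 ** ?R" by metis
  qed (auto simp: symmetric_mats_def matrix_transpose_mul Rt matrix_mul_assoc)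
  then show ?thesis
    by (simp add: horizontal_space_def normal_mats_stiefel U)
qed

lemma horizontal_metric_eq:
  fixes U \<Delta>1 \<Delta>2 :: "real^'p^'n"
  assumes S: "S \<in> spd"
  shows "horizontal_metric k (U, S) (\<Delta>1, D1) (\<Delta>2, D2)
    = \<Delta>1 \<bullet> \<Delta>2 + k * trace (matrix_inv S ** D1 ** matrix_inv S ** D2)"
proof -
  let ?R = "matrix_inv (msqrt S)"
  have "matrix_inv S = ?R ** ?R"
    using matrix_inv_mult[of "msqrt S" "msqrt S"] spd_invertible[OF msqrt_spd[OF S]] msqrt_square[OF S]
    by simp
  moreover have "trace (?R ** D1 ** matrix_inv S ** D2 ** ?R) = trace (?R ** ?R ** D1 ** matrix_inv S ** D2)"
    by (metis matrix_mul_assoc trace_mul_sym)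
  ultimately show ?thesis by (simp add: horizontal_metric_def inner_matrix_eq_trace)
qed

text \<open>Over a common image, \<open>U U\<^sup>T\<close> and \<open>U' U'\<^sup>T\<close> are the projection onto the same range; hence
  \<open>U' = U (U\<^sup>T U')\<close>, and \<open>Q = U\<^sup>T U'\<close> is orthogonal.\<close>

lemma quotient_fibre:
  fixes U U' :: "real^'p^'n"
  assumes U: "U \<in> stiefel" "U' \<in> stiefel" and S: "S \<in> spd" "S' \<in> spd"
    and eq: "U ** S ** transpose U = U' ** S' ** transpose U'"
  obtains Q where "orthogonal_matrix Q" "U' = U ** Q" "S' = transpose Q ** S ** Q"
proof -
  have proj: "V ** transpose V ** W = W"
    if "V \<in> stiefel" "W \<in> stiefel" "T \<in> spd" "W ** T ** transpose W = V ** T' ** transpose V"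
    for V W :: "real^'p^'n" and T T'
  proof -
    have "V ** transpose V ** (W ** T ** transpose W) ** W ** matrix_inv T
        = (W ** T ** transpose W) ** W ** matrix_inv T"
      unfolding that(4) using that(1) by (simp add: matrix_mul_assoc stiefel_cancel)
    then show ?thesis using that(1-3)
      by (simp add: matrix_mul_assoc stiefel_cancel mult_cancel_middle spd_inv_cancel)
  qed
  define Q where "Q = transpose U ** U'"
  have U': "U' = U ** Q" using proj[OF U S(2) eq[symmetric]] by (simp add: Q_def matrix_mul_assoc)
  have "transpose Q ** Q = transpose U' ** (U ** transpose U ** U')"
    by (simp add: Q_def matrix_transpose_mul matrix_mul_assoc)
  then have "orthogonal_matrix Q"
    unfolding orthogonal_matrix using proj[OF U S(2) eq[symmetric]] U by (simp add: stiefelD)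
  moreover have "transpose Q ** S ** Q = transpose U' ** (U ** S ** transpose U) ** U'"
    by (simp add: Q_def matrix_transpose_mul matrix_mul_assoc)
  then have "transpose Q ** S ** Q = S'"
    using U(2) unfolding eq by (simp add: matrix_mul_assoc stiefelD stiefel_cancel)
  ultimately show ?thesis using that U' by simp
qed

text \<open>A horizontal vector can be recovered from its image \<open>Z\<close>, because \<open>U\<^sup>T \<Delta> = 0\<close> isolates \<open>D\<close> in
  \<open>U\<^sup>T Z U\<close>, and \<open>Z U = \<Delta> S + U D\<close> then yields \<open>\<Delta>\<close>. In particular the differential is injective on
  horizontal vectors.\<close>

lemma quotient_differential_horizontal:
  fixes U :: "real^'p^'n"
  assumes U: "U \<in> stiefel" and S: "S \<in> spd" and h: "(\<Delta>, D) \<in> horizontal_space (U, S)"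
    and Z: "Z = quotient_differential (U, S) (\<Delta>, D)"
  shows "D = transpose U ** Z ** U" "\<Delta> = (Z ** U - U ** D) ** matrix_inv S"
proof -
  have n: "transpose U ** \<Delta> = 0" using h by (simp add: horizontal_space_iff U S)
  then have n': "transpose \<Delta> ** U = 0"
    by (metis matrix_transpose_mul transpose_transpose mat_0 transpose_mat)
  have ZU: "Z ** U = \<Delta> ** S + U ** D"
    by (simp add: Z quotient_differential_def matrix_mult_simps stiefel_cancel U)
      (simp add: n' flip: matrix_mul_assoc)
  have "transpose U ** Z ** U = transpose U ** (Z ** U)" by (simp add: matrix_mul_assoc)
  also have "\<dots> = D" unfolding ZU by (simp add: matrix_mult_simps n stiefelD U)
  finally show "D = transpose U ** Z ** U" ..
  show "\<Delta> = (Z ** U - U ** D) ** matrix_inv S"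
    unfolding ZU by (simp add: mult_cancel_middle spd_inv_cancel S)
qed

text \<open>The metric on the quotient does not depend on the point of the fibre. Moving along the fibre to
  \<open>(U Q, Q\<^sup>T S Q)\<close> turns the recovery formulas for \<open>D\<close> and \<open>\<Delta>\<close> into \<open>Q\<^sup>T D Q\<close> and \<open>\<Delta> Q\<close>, and the
  horizontal metric consists of traces that are invariant under this substitution.\<close>

lemma spsd_metric_horizontal:
  fixes z \<xi>1 \<xi>2 :: "(real^'p^'n) \<times> (real^'p^'p)"
  assumes z: "z \<in> structure_space" and \<xi>: "\<xi>1 \<in> horizontal_space z" "\<xi>2 \<in> horizontal_space z"
  shows "spsd_metric TYPE('p) k (quotient_proj z) (quotient_differential z \<xi>1) (quotient_differential z \<xi>2)
    = horizontal_metric k z \<xi>1 \<xi>2"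
proof -
  obtain U S where zU: "z = (U, S)" by (cases z)
  have U: "U \<in> stiefel" and S: "S \<in> spd" using z by (auto simp: zU structure_space_def)
  have inv: "horizontal_metric k z' \<eta>1 \<eta>2 = horizontal_metric k z \<xi>1 \<xi>2"
    if z': "z' \<in> structure_space" and \<eta>: "\<eta>1 \<in> horizontal_space z'" "\<eta>2 \<in> horizontal_space z'"
      and eq: "quotient_proj z' = quotient_proj z"
        "quotient_differential z' \<eta>1 = quotient_differential z \<xi>1"
        "quotient_differential z' \<eta>2 = quotient_differential z \<xi>2" for z' \<eta>1 \<eta>2 :: "(real^'p^'n) \<times> (real^'p^'p)"
  proof -
    obtain U' S' where zU': "z' = (U', S')" by (cases z')
    have U': "U' \<in> stiefel" and S': "S' \<in> spd" using z' by (auto simp: zU' structure_space_def)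
    obtain Q where Q: "orthogonal_matrix Q" "U' = U ** Q" "S' = transpose Q ** S ** Q"
      using quotient_fibre[OF U U' S S'] eq(1) by (auto simp: zU zU' quotient_proj_def)
    have *: "\<Delta>' = \<Delta> ** Q \<and> D' = transpose Q ** D ** Q"
      if h': "(\<Delta>', D') \<in> horizontal_space (U', S')" and h: "(\<Delta>, D) \<in> horizontal_space (U, S)"
        and e: "quotient_differential (U', S') (\<Delta>', D') = quotient_differential (U, S) (\<Delta>, D)"
      for \<Delta> \<Delta>' D D'
    proof -
      let ?Z = "quotient_differential (U, S) (\<Delta>, D)"
      have "D' = transpose Q ** (transpose U ** ?Z ** U) ** Q"
        using quotient_differential_horizontal(1)[OF U' S' h' e[symmetric]]
        by (simp add: Q(2) matrix_transpose_mul matrix_mul_assoc)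
      then have D': "D' = transpose Q ** D ** Q"
        by (simp only: quotient_differential_horizontal(1)[OF U S h refl, symmetric])
      have "\<Delta>' = (?Z ** U' - U' ** D') ** matrix_inv S'"
        by (rule quotient_differential_horizontal(2)[OF U' S' h' e[symmetric]])
      also have "\<dots> = (?Z ** U - U ** D) ** matrix_inv S ** Q"
        by (simp add: D' Q(2,3) matrix_inv_orthogonal_congruence spd_invertible S Q(1)
            matrix_mult_simps orthogonal_matrix_cancel[OF Q(1)])
      also have "\<dots> = \<Delta> ** Q"
        using quotient_differential_horizontal(2)[OF U S h refl] by simp
      finally show ?thesis using D' by simp
    qed
    obtain \<Delta>1 D1 \<Delta>2 D2 where x: "\<xi>1 = (\<Delta>1, D1)" "\<xi>2 = (\<Delta>2, D2)" by (cases \<xi>1, cases \<xi>2)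
    have e1: "\<eta>1 = (\<Delta>1 ** Q, transpose Q ** D1 ** Q)"
      using *[of "fst \<eta>1" "snd \<eta>1" \<Delta>1 D1] \<eta> \<xi> eq by (cases \<eta>1) (auto simp: zU zU' x)
    have e2: "\<eta>2 = (\<Delta>2 ** Q, transpose Q ** D2 ** Q)"
      using *[of "fst \<eta>2" "snd \<eta>2" \<Delta>2 D2] \<eta> \<xi> eq by (cases \<eta>2) (auto simp: zU zU' x)
    have tr: "trace (transpose Q ** M ** Q) = trace M" for M :: "real^'p^'p"
      using trace_mult_cyclic[of "transpose Q" M Q] trace_mult_cyclic[of M Q "transpose Q"]
      by (simp add: orthogonal_matrix_cancel[OF Q(1)])
    have "(\<Delta>1 ** Q) \<bullet> (\<Delta>2 ** Q) = trace (transpose Q ** (transpose \<Delta>1 ** \<Delta>2) ** Q)"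
      by (simp add: inner_matrix_eq_trace matrix_transpose_mul matrix_mul_assoc)
    then have "(\<Delta>1 ** Q) \<bullet> (\<Delta>2 ** Q) = \<Delta>1 \<bullet> \<Delta>2"
      by (simp add: tr inner_matrix_eq_trace)
    moreover have "trace (matrix_inv S' ** (transpose Q ** D1 ** Q) ** matrix_inv S' ** (transpose Q ** D2 ** Q))
        = trace (transpose Q ** (matrix_inv S ** D1 ** matrix_inv S ** D2) ** Q)"
      by (simp add: Q(3) matrix_inv_orthogonal_congruence spd_invertible S Q(1)
          matrix_mul_assoc orthogonal_matrix_cancel[OF Q(1)])
    ultimately show ?thesis
      unfolding zU zU' x e1 e2 by (simp add: horizontal_metric_eq S S' tr)
  qed
  have fd: "frechet_derivative quotient_proj (at w) = quotient_differential w"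
    for w :: "(real^'p^'n) \<times> (real^'p^'p)"
    using frechet_derivative_at[OF quotient_proj_has_derivative] by metis
  show ?thesis
    unfolding spsd_metric_def fd
  proof (rule the_equality, goal_cases)
    case 1
    show ?case using z \<xi> by blast
  next
    case (2 r)
    then show ?case using inv by blast
  qed
qed

section \<open>Principal frames and the Grassmann part of the curve\<close>

lemma diag_add: "diag u + diag v = diag (\<chi> i. u $ i + v $ i)"
  by (auto simp: vec_eq_iff diag_nth)

text \<open>Two solutions \<open>M\<close>, \<open>N\<close> of the Penrose equations have the same projections \<open>A M = A N\<close> and
  \<open>M A = N A\<close>, whence \<open>N = N A N = M A M = M\<close>.\<close>

lemma pinv_unique:
  fixes A :: "real^'m^'n" and M :: "real^'n^'m"
  assumes M: "A ** M ** A = A" "M ** A ** M = M"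
    "transpose (A ** M) = A ** M" "transpose (M ** A) = M ** A"
  shows "pinv A = M"
  unfolding pinv_def
proof (rule the_equality)
  fix N assume N: "A ** N ** A = A \<and> N ** A ** N = N \<and>
    transpose (A ** N) = A ** N \<and> transpose (N ** A) = N ** A"
  have "A ** M ** (A ** N) = A ** N" "A ** N ** (A ** M) = A ** M"
    using M(1) N by (simp_all add: matrix_mul_assoc)
  then have AN: "A ** N = A ** M"
    using N M(3) matrix_transpose_mul[of "A ** M" "A ** N"] by simp
  have "N ** A ** (M ** A) = N ** A ** M ** A" "M ** A ** (N ** A) = M ** A ** N ** A"
    by (simp_all add: matrix_mul_assoc)
  moreover have "N ** A ** M ** A = N ** A" "M ** A ** N ** A = M ** A"
    using M(1) N by (metis matrix_mul_assoc)+
  ultimately have NA: "N ** A = M ** A"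
    using N M(4) matrix_transpose_mul[of "N ** A" "M ** A"] by simp
  have "N = N ** (A ** N)" using N by (simp add: matrix_mul_assoc)
  also have "\<dots> = M ** A ** M" by (simp add: AN matrix_mul_assoc NA)
  finally show "N = M" using M(2) by simp
qed (use M in blast)

lemma pinv_diag: "pinv (diag v) = diag (\<chi> i. inverse (v $ i))"
  by (rule pinv_unique) (auto simp: diag_mult vec_eq_iff diag_nth field_simps)

text \<open>The columns of \<open>U_A\<close> and \<open>U_B\<close> are principal vectors of two subspaces, with principal angles \<open>\<theta>\<close>.\<close>

locale principal_frames =
  fixes U_A U_B :: "real^'p^'n" and \<theta> :: "real^'p"
  assumes frame_A: "U_A \<in> stiefel" and frame_B: "U_B \<in> stiefel"
    and cosines: "transpose U_A ** U_B = diag (\<chi> i. cos (\<theta> $ i))"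
    and angle_nonneg: "0 \<le> \<theta> $ i" and angle_le: "\<theta> $ i \<le> pi / 2"
begin

definition direction :: "real^'p^'n" where
  "direction = (mat 1 - U_A ** transpose U_A) ** U_B ** pinv (diag (\<chi> i. sin (\<theta> $ i)))"

definition velocity :: "real \<Rightarrow> real^'p^'n" where
  "velocity t = U_A ** diag (\<chi> i. - \<theta> $ i * sin (\<theta> $ i * t))
    + direction ** diag (\<chi> i. \<theta> $ i * cos (\<theta> $ i * t))"

lemma stiefel_curve_eq:
  "stiefel_curve U_A U_B \<theta> t
    = U_A ** diag (\<chi> i. cos (\<theta> $ i * t)) + direction ** diag (\<chi> i. sin (\<theta> $ i * t))"
  by (simp add: stiefel_curve_def direction_def)

lemma sin_angle_eq_0_iff: "sin (\<theta> $ i) = 0 \<longleftrightarrow> \<theta> $ i = 0"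
  using angle_nonneg[of i] angle_le[of i] sin_gt_zero[of "\<theta> $ i"] pi_gt_zero
  by (cases "\<theta> $ i = 0") auto

text \<open>The components of the columns of \<open>U_B\<close> orthogonal to the column space of \<open>U_A\<close> remain pairwise
  orthogonal and, by Pythagoras, have the lengths \<open>sin \<theta>\<^sub>i\<close>.\<close>

lemma normal_part:
  defines "Y \<equiv> (mat 1 - U_A ** transpose U_A) ** U_B"
  shows "Y = U_B - U_A ** diag (\<chi> i. cos (\<theta> $ i))" "transpose U_A ** Y = 0"
    "transpose Y ** Y = diag (\<chi> i. (sin (\<theta> $ i))\<^sup>2)"
proof -
  show Y: "Y = U_B - U_A ** diag (\<chi> i. cos (\<theta> $ i))"
    by (simp add: Y_def matrix_mult_simps cosines flip: matrix_mul_assoc[of U_A])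
  show n: "transpose U_A ** Y = 0"
    by (simp add: Y matrix_mult_simps cosines stiefelD frame_A)
  have "transpose Y ** Y = transpose U_B ** Y - diag (\<chi> i. cos (\<theta> $ i)) ** (transpose U_A ** Y)"
    by (subst (1) Y) (simp add: transpose_simps matrix_mult_simps)
  also have "\<dots> = mat 1 - transpose (transpose U_A ** U_B) ** diag (\<chi> i. cos (\<theta> $ i))"
    unfolding n by (simp add: Y matrix_mult_simps stiefelD frame_B matrix_transpose_mul)
  also have "\<dots> = diag (\<chi> i. (sin (\<theta> $ i))\<^sup>2)"
    unfolding cosines transpose_diag diag_mult
    by (auto simp: vec_eq_iff mat_def diag_nth sin_squared_eq simp flip: power2_eq_square)
  finally show "transpose Y ** Y = diag (\<chi> i. (sin (\<theta> $ i))\<^sup>2)" .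
qed

lemma direction_normal: "transpose U_A ** direction = 0"
  using normal_part(2) by (simp add: direction_def matrix_mul_assoc)

lemma direction_gram: "transpose direction ** direction = diag (\<chi> i. if \<theta> $ i = 0 then 0 else 1)"
proof -
  let ?F = "diag (\<chi> i. inverse (sin (\<theta> $ i)))" and ?Y = "(mat 1 - U_A ** transpose U_A) ** U_B"
  have "transpose direction ** direction = ?F ** (transpose ?Y ** ?Y) ** ?F"
    by (simp add: direction_def pinv_diag matrix_transpose_mul matrix_mul_assoc)
  also have "\<dots> = diag (\<chi> i. if \<theta> $ i = 0 then 0 else 1)"
    unfolding normal_part(3) diag_mult
    by (auto simp: vec_eq_iff diag_nth power2_eq_square sin_angle_eq_0_iff field_simps)
  finally show ?thesis .
qed

text \<open>Where \<open>sin \<theta>\<^sub>i = 0\<close> the pseudoinverse annihilates the \<open>i\<close>th column of the normal part; nothing is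
  lost, since that column has length \<open>sin \<theta>\<^sub>i\<close>.\<close>

lemma direction_sin: "direction ** diag (\<chi> i. sin (\<theta> $ i)) = U_B - U_A ** diag (\<chi> i. cos (\<theta> $ i))"
proof -
  let ?E = "diag (\<chi> i. if sin (\<theta> $ i) = 0 then 1 else 0)"
  let ?Y = "(mat 1 - U_A ** transpose U_A) ** U_B"
  have "transpose (?Y ** ?E) ** (?Y ** ?E) = ?E ** (transpose ?Y ** ?Y) ** ?E"
    by (simp only: matrix_transpose_mul transpose_diag matrix_mul_assoc)
  also have "\<dots> = 0" unfolding normal_part(3) diag_mult by (auto simp: vec_eq_iff diag_nth)
  finally have YE: "?Y ** ?E = 0" by (simp only: transpose_mult_self_eq_0_iff)
  have *: "diag (\<chi> i. inverse (sin (\<theta> $ i))) ** diag (\<chi> i. sin (\<theta> $ i)) = mat 1 - ?E"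
    unfolding diag_mult by (auto simp: vec_eq_iff diag_nth mat_def)
  have "direction ** diag (\<chi> i. sin (\<theta> $ i))
      = ?Y ** (diag (\<chi> i. inverse (sin (\<theta> $ i))) ** diag (\<chi> i. sin (\<theta> $ i)))"
    by (simp add: direction_def pinv_diag matrix_mul_assoc)
  also have "\<dots> = ?Y - ?Y ** ?E"
    unfolding * by (simp add: bounded_bilinear.diff_right[OF bounded_bilinear_matrix_mult])
  also have "\<dots> = U_B - U_A ** diag (\<chi> i. cos (\<theta> $ i))"
    unfolding YE using normal_part(1) by simp
  finally show ?thesis .
qed

text \<open>The columns of \<open>U_A\<close> and the nonzero columns of \<open>direction\<close> are orthonormal. The
  orthonormality, the horizontality and the speed of the Stiefel curve are instances of this formula.\<close>

lemma frame_gram: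
  "transpose (U_A ** diag a + direction ** diag b) ** (U_A ** diag c + direction ** diag d)
    = diag (\<chi> i. a $ i * c $ i + (if \<theta> $ i = 0 then 0 else b $ i * d $ i))"
proof -
  have n: "transpose direction ** U_A = 0"
    using direction_normal by (metis matrix_transpose_mul transpose_transpose mat_0 transpose_mat)
  have "transpose (U_A ** diag a + direction ** diag b) ** (U_A ** diag c + direction ** diag d)
    = diag a ** (transpose U_A ** U_A) ** diag c + diag a ** (transpose U_A ** direction) ** diag d
      + diag b ** (transpose direction ** U_A) ** diag c
      + diag b ** (transpose direction ** direction) ** diag d"
    by (simp add: transpose_simps matrix_mult_simps)
  also have "\<dots> = diag (\<chi> i. a $ i * c $ i + (if \<theta> $ i = 0 then 0 else b $ i * d $ i))"
    by (simp add: stiefelD frame_A direction_normal n direction_gram diag_mult diag_add)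
      (auto simp: vec_eq_iff diag_nth)
  finally show ?thesis .
qed

lemma stiefel_curve_stiefel: "stiefel_curve U_A U_B \<theta> t \<in> stiefel"
  unfolding stiefel_def stiefel_curve_eq frame_gram mem_Collect_eq
  by (auto simp: vec_eq_iff diag_nth mat_def simp flip: power2_eq_square)

lemma stiefel_curve_velocity_normal: "transpose (stiefel_curve U_A U_B \<theta> t) ** velocity t = 0"
  unfolding stiefel_curve_eq velocity_def frame_gram by (auto simp: vec_eq_iff diag_nth)

lemma velocity_gram: "transpose (velocity t) ** velocity t = diag (\<chi> i. (\<theta> $ i)\<^sup>2)"
proof -
  have "x * sin (x * t) * (x * sin (x * t)) + x * cos (x * t) * (x * cos (x * t)) = x\<^sup>2" for x :: real
  proof -
    have "x * sin (x * t) * (x * sin (x * t)) + x * cos (x * t) * (x * cos (x * t))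
        = x\<^sup>2 * ((sin (x * t))\<^sup>2 + (cos (x * t))\<^sup>2)" by algebra
    then show ?thesis by simp
  qed
  then show ?thesis
    unfolding velocity_def frame_gram by (auto simp: vec_eq_iff diag_nth)
qed

lemma stiefel_curve_0: "stiefel_curve U_A U_B \<theta> 0 = U_A"
proof -
  have "diag (\<chi> i. 0) = (0 :: real^'p^'p)" by (simp add: vec_eq_iff diag_nth)
  then show ?thesis by (simp add: stiefel_curve_eq diag_one)
qed

lemma stiefel_curve_1: "stiefel_curve U_A U_B \<theta> 1 = U_B"
  by (simp add: stiefel_curve_eq direction_sin)

lemma has_vector_derivative_mult_diag:
  fixes M :: "real^'p^'m"
  assumes "\<And>i. (f i has_real_derivative f' i) (at t)"
  shows "((\<lambda>t. M ** diag (\<chi> i. f i t)) has_vector_derivative M ** diag (\<chi> i. f' i)) (at t)"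
  by (intro bounded_linear.has_vector_derivative[OF bounded_linear_compose[OF
        bounded_bilinear.bounded_linear_right[OF bounded_bilinear_matrix_mult] bounded_linear_diag]]
      has_vector_derivative_vec_lambda assms)

lemma stiefel_curve_has_vector_derivative:
  "(stiefel_curve U_A U_B \<theta> has_vector_derivative velocity t) (at t)"
  unfolding stiefel_curve_eq[abs_def] velocity_def
  by (intro has_vector_derivative_add has_vector_derivative_mult_diag)
    (auto intro!: derivative_eq_intros)

text \<open>The acceleration is \<open>U\<close> times a symmetric matrix, hence normal to the Stiefel manifold: this is the
  geodesic equation there.\<close>

lemma velocity_has_vector_derivative:
  "(velocity has_vector_derivative - (stiefel_curve U_A U_B \<theta> t ** diag (\<chi> i. (\<theta> $ i)\<^sup>2))) (at t)"
proof -
  have "(velocity has_vector_derivative U_A ** diag (\<chi> i. - (\<theta> $ i)\<^sup>2 * cos (\<theta> $ i * t))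
      + direction ** diag (\<chi> i. - (\<theta> $ i)\<^sup>2 * sin (\<theta> $ i * t))) (at t)"
    unfolding velocity_def[abs_def]
    by (intro has_vector_derivative_add has_vector_derivative_mult_diag)
      (auto intro!: derivative_eq_intros simp: power2_eq_square)
  moreover have "U_A ** diag (\<chi> i. - (\<theta> $ i)\<^sup>2 * cos (\<theta> $ i * t))
      + direction ** diag (\<chi> i. - (\<theta> $ i)\<^sup>2 * sin (\<theta> $ i * t))
    = - (stiefel_curve U_A U_B \<theta> t ** diag (\<chi> i. (\<theta> $ i)\<^sup>2))"
    unfolding stiefel_curve_eq matrix_mult_simps
    by (simp add: vec_eq_iff matrix_mult_diag_nth)
  ultimately show ?thesis by simp
qed

end

section \<open>The positive definite part of the curve\<close>

definition spd_geodesic :: "real^'p^'p \<Rightarrow> real^'p^'p \<Rightarrow> real \<Rightarrow> real^'p^'p" where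
  "spd_geodesic R L t = R ** mexp (t *\<^sub>R L) ** R"

definition spd_velocity :: "real^'p^'p \<Rightarrow> real^'p^'p \<Rightarrow> real \<Rightarrow> real^'p^'p" where
  "spd_velocity R L t = R ** (L ** mexp (t *\<^sub>R L)) ** R"

lemma mexp_commute:
  fixes L :: "real^'n^'n"
  assumes "transpose L = L"
  shows "L ** mexp (t *\<^sub>R L) = mexp (t *\<^sub>R L) ** L"
proof -
  obtain P d where P: "orthogonal_matrix P" and L: "L = P ** diag d ** transpose P"
    using spectral_theorem[OF assms] .
  then show ?thesis by (simp add: L spectral_scaleR mexp_spectral spectral_mult mult.commute)
qed

locale spd_line =
  fixes R L :: "real^'p^'p"
  assumes R: "R \<in> spd" and L: "transpose L = L"
begin

lemma R_symmetric: "transpose R = R" using spd_symmetric[OF R] .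

lemma scaled_symmetric: "transpose (t *\<^sub>R L) = t *\<^sub>R L"
  by (simp add: transpose_simps L)

lemma spd_geodesic_spd: "spd_geodesic R L t \<in> spd"
  using spd_congruence[OF mexp_spd[OF scaled_symmetric] invertible_injective[OF spd_invertible[OF R]]]
  by (simp add: spd_geodesic_def R_symmetric)

lemma spd_geodesic_has_vector_derivative:
  "(spd_geodesic R L has_vector_derivative spd_velocity R L t) (at t)"
  unfolding spd_geodesic_def[abs_def] spd_velocity_def
  by (intro bounded_linear.has_vector_derivative[OF bounded_linear_conjugation]
      mexp_scaleR_vector_derivative L)

lemma spd_velocity_symmetric: "transpose (spd_velocity R L t) = spd_velocity R L t"
  by (simp add: spd_velocity_def matrix_transpose_mul R_symmetric mexp_symmetric scaled_symmetric L
      mexp_commute matrix_mul_assoc)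

text \<open>The geodesic equation of the affine invariant metric in integrated form: the logarithmic velocity
  \<open>S\<inverse> S'\<close> is constant, because \<open>L\<close> commutes with \<open>exp(t L)\<close>.\<close>

lemma spd_velocity_log:
  "matrix_inv (spd_geodesic R L t) ** spd_velocity R L t = matrix_inv R ** L ** R"
proof -
  have "spd_velocity R L t = spd_geodesic R L t ** (matrix_inv R ** L ** R)"
    by (simp add: spd_velocity_def spd_geodesic_def mexp_commute L matrix_mul_assoc
        mult_cancel_middle spd_inv_cancel R)
  then show ?thesis
    by (simp add: matrix_mul_assoc spd_inv_cancel[OF spd_geodesic_spd])
qed

lemma spd_velocity_norm:
  "trace (matrix_inv (spd_geodesic R L t) ** spd_velocity R L t
      ** matrix_inv (spd_geodesic R L t) ** spd_velocity R L t) = (norm L)\<^sup>2"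
proof -
  have "trace (matrix_inv (spd_geodesic R L t) ** spd_velocity R L t
      ** matrix_inv (spd_geodesic R L t) ** spd_velocity R L t)
    = trace (matrix_inv R ** L ** R ** (matrix_inv R ** L ** R))"
    by (simp add: spd_velocity_log flip: matrix_mul_assoc)
  also have "\<dots> = trace (R ** (matrix_inv R ** L ** R ** matrix_inv R) ** L)"
    by (metis matrix_mul_assoc trace_mul_sym)
  also have "\<dots> = trace (transpose L ** L)"
    by (simp add: matrix_mul_assoc spd_inv_cancel[OF R] mult_cancel_middle L)
  finally show ?thesis by (simp add: power2_norm_eq_inner inner_matrix_eq_trace)
qed

lemma spd_geodesic_0: "spd_geodesic R L 0 = R ** R"
  by (simp add: spd_geodesic_def mexp_0)

end

section \<open>The connecting curve, its lift and its length\<close>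

lemma spsdD:
  assumes "A \<in> spsd p"
  shows "transpose A = A" "0 \<le> x \<bullet> (A *v x)"
  using assms by (auto simp: spsd_def symmetric_mats_def)

text \<open>The eigenvalues are nonnegative by semidefiniteness and nonzero by injectivity.\<close>

lemma psd_injective_spd:
  fixes S :: "real^'p^'p"
  assumes sym: "transpose S = S" and psd: "\<And>x. 0 \<le> x \<bullet> (S *v x)"
    and inj: "\<And>x. S *v x = 0 \<Longrightarrow> x = 0"
  shows "S \<in> spd"
proof -
  obtain P d where P: "orthogonal_matrix P" and S: "S = P ** diag d ** transpose P"
    using spectral_theorem[OF sym] .
  have "0 < d $ i" for i
  proof -
    let ?x = "P *v axis i 1"
    have "column i (diag d) = d $ i *\<^sub>R axis i 1"
      by (simp add: column_def diag_def vec_eq_iff axis_def)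
    then have "diag d *v axis i 1 = d $ i *\<^sub>R axis i 1"
      by (simp only: matrix_vector_mult_basis)
    then have "S *v ?x = d $ i *\<^sub>R ?x"
      by (simp add: S matrix_vector_mul_assoc orthogonal_matrix_cancel[OF P] matrix_vector_mult_scaleR
          flip: matrix_vector_mul_assoc[of P "diag d"])
    moreover have x: "?x \<noteq> 0"
      using invertible_injective[OF invertible_orthogonal[OF P], of "axis i 1"] by (simp add: axis_eq_0_iff)
    ultimately have "d $ i \<noteq> 0" "0 \<le> d $ i * (?x \<bullet> ?x)"
      using inj[of ?x] psd[of ?x] by auto
    moreover have "0 < ?x \<bullet> ?x" using x by (simp only: inner_gt_zero_iff) simp
    ultimately show ?thesis by (meson linorder_neqE_linordered_idom linorder_not_le mult_neg_pos)
  qed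
  then show ?thesis unfolding S by (intro spd_spectral P)
qed

lemma range_frame:
  fixes U :: "real^'p^'n"
  assumes "S \<in> spd" "U \<in> stiefel"
  shows "range ((*v) (U ** S ** transpose U)) = range ((*v) U)"
proof (intro equalityI image_subsetI)
  fix x
  show "(U ** S ** transpose U) *v x \<in> range ((*v) U)"
    by (metis matrix_vector_mul_assoc matrix_mul_assoc rangeI)
next
  fix x
  have "U ** S ** transpose U ** U ** matrix_inv S = U"
    by (simp add: stiefel_cancel assms mult_cancel_middle spd_inv_cancel)
  then have "U *v x = (U ** S ** transpose U) *v ((U ** matrix_inv S) *v x)"
    by (simp add: matrix_vector_mul_assoc matrix_mul_assoc)
  then show "U *v x \<in> range ((*v) (U ** S ** transpose U))" by blast
qed

lemma frame_spsd:
  fixes U :: "real^'p^'n"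
  assumes S: "S \<in> spd" and U: "U \<in> stiefel"
  shows "U ** S ** transpose U \<in> spsd CARD('p)"
proof -
  have "rank (U ** S ** transpose U) = rank U"
    by (simp add: rank_dim_range range_frame S U)
  moreover have "0 \<le> x \<bullet> ((U ** S ** transpose U) *v x)" for x
    using inner_congruence[of x "transpose U" S] S
    by (cases "transpose U *v x = 0") (auto simp: spd_def less_imp_le)
  ultimately show ?thesis
    using spd_symmetric[OF S]
    by (simp add: spsd_def symmetric_mats_def rank_stiefel U matrix_transpose_mul matrix_mul_assoc)
qed

text \<open>A symmetric semidefinite matrix is determined by its compression to its range, where it is definite:
  if \<open>A U x = 0\<close>, then \<open>U x\<close> lies in the range of the symmetric matrix \<open>A\<close> and in its kernel, hence is
  orthogonal to itself.\<close>

lemma frame_compression: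
  fixes U :: "real^'p^'n"
  assumes A: "A \<in> spsd r" and U: "U \<in> stiefel" and range: "range ((*v) U) = range ((*v) A)"
  shows "U ** (transpose U ** A ** U) ** transpose U = A" "transpose U ** A ** U \<in> spd"
proof -
  have At: "transpose A = A" using spsdD[OF A] by simp
  have UA: "U ** transpose U ** A = A" using stiefel_projection[OF U] range by blast
  then have AU: "A ** U ** transpose U = A"
    by (metis At matrix_transpose_mul transpose_transpose matrix_mul_assoc)
  show "U ** (transpose U ** A ** U) ** transpose U = A"
    by (simp add: matrix_mul_assoc UA AU)
  show "transpose U ** A ** U \<in> spd"
  proof (rule psd_injective_spd)
    show "transpose (transpose U ** A ** U) = transpose U ** A ** U"
      by (simp add: matrix_transpose_mul At matrix_mul_assoc)
    show "0 \<le> x \<bullet> ((transpose U ** A ** U) *v x)" for x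
      unfolding inner_congruence using spsdD(2)[OF A] .
    fix x assume "(transpose U ** A ** U) *v x = 0"
    then have "U *v ((transpose U ** A ** U) *v x) = 0" by simp
    then have AUx: "A *v (U *v x) = 0" by (simp add: matrix_vector_mul_assoc matrix_mul_assoc UA)
    obtain y where "U *v x = A *v y" using range by (metis rangeE rangeI)
    then have "(U *v x) \<bullet> (U *v x) = (A *v (U *v x)) \<bullet> y"
      using symmetric_inner[OF At] by simp
    then have "U *v x = 0" by (simp add: AUx)
    then show "x = 0" using stiefel_injective[OF U] by blast
  qed
qed

lemma range_matrix_mult: "range ((*v) (M ** N)) = (*v) M ` range ((*v) N)"
  for M :: "real^'n^'m" and N :: "real^'k^'n"
  by (auto simp: image_image matrix_vector_mul_assoc)

lemma range_mult_orthogonal: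
  fixes V :: "real^'p^'n"
  assumes "orthogonal_matrix Q" shows "range ((*v) (V ** Q)) = range ((*v) V)"
proof -
  have "x = Q *v (transpose Q *v x)" for x
    using assms by (simp add: matrix_vector_mul_assoc orthogonal_matrix_cancel del: transpose_matrix_vector)
  then have "surj ((*v) Q)" by (rule surjI[OF sym])
  then show ?thesis by (simp add: range_matrix_mult)
qed

lemma stiefel_mult_orthogonal:
  fixes V :: "real^'p^'n"
  assumes "V \<in> stiefel" "orthogonal_matrix Q" shows "V ** Q \<in> stiefel"
proof -
  have "transpose (V ** Q) ** (V ** Q) = transpose Q ** (transpose V ** V) ** Q"
    by (simp add: matrix_transpose_mul matrix_mul_assoc)
  then show ?thesis using assms by (simp add: stiefel_def orthogonal_matrix_cancel)
qed

locale spsd_connection = principal_frames U_A U_B \<theta>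
  for U_A U_B :: "real^'p^'n" and \<theta> +
  fixes A B :: "real^'n^'n"
  assumes A: "A \<in> spsd CARD('p)" and B: "B \<in> spsd CARD('p)"
    and range_A: "range ((*v) U_A) = range ((*v) A)"
    and range_B: "range ((*v) U_B) = range ((*v) B)"
begin

abbreviation "R_A \<equiv> compressed_sqrt A U_A"
abbreviation "R_B \<equiv> compressed_sqrt B U_B"
abbreviation "L \<equiv> log_ratio A B U_A U_B"
abbreviation "lift \<equiv> lifted_curve A B U_A U_B \<theta>"
abbreviation "lift_velocity t \<equiv> (velocity t, spd_velocity R_A L t)"

lemmas compress_A = frame_compression[OF A frame_A range_A]
lemmas compress_B = frame_compression[OF B frame_B range_B]

lemma roots_spd: "R_A \<in> spd" "R_B \<in> spd"
  and root_squares: "R_A ** R_A = transpose U_A ** A ** U_A" "R_B ** R_B = transpose U_B ** B ** U_B"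
  using compress_A compress_B by (simp_all add: compressed_sqrt_def msqrt_spd msqrt_square)

lemma ratio_spd: "matrix_inv R_A ** (R_B ** R_B) ** matrix_inv R_A \<in> spd"
  using spd_congruence[of "R_B ** R_B" "matrix_inv R_A"] compress_B(2) spd_symmetric[OF spd_matrix_inv]
    invertible_injective[OF invertible_matrix_inv[OF spd_invertible]] roots_spd
  unfolding root_squares by metis

lemma log_ratio_symmetric: "transpose L = L"
  by (simp add: log_ratio_def Let_def mlog_symmetric ratio_spd)

sublocale spd_line R_A L
  by unfold_locales (rule roots_spd log_ratio_symmetric)+

lemma spd_curve_eq: "spd_curve A B U_A U_B = spd_geodesic R_A L"
  by (rule ext) (simp add: spd_curve_def spd_geodesic_def Let_def)

lemma lift_eq: "lift t = (stiefel_curve U_A U_B \<theta> t, spd_geodesic R_A L t)"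
  by (simp add: lifted_curve_def spd_curve_eq)

lemma quotient_lift: "quotient_proj (lift t) = spsd_curve A B U_A U_B \<theta> t"
  by (simp add: quotient_proj_def lifted_curve_def spsd_curve_def)

lemma spsd_curve_0: "spsd_curve A B U_A U_B \<theta> 0 = A"
  by (simp add: spsd_curve_def stiefel_curve_0 spd_curve_eq spd_geodesic_0 root_squares compress_A)

lemma spsd_curve_1: "spsd_curve A B U_A U_B \<theta> 1 = B"
proof -
  have "mexp L = matrix_inv R_A ** (R_B ** R_B) ** matrix_inv R_A"
    by (simp add: log_ratio_def Let_def mexp_mlog ratio_spd)
  then have "spd_geodesic R_A L 1 = R_B ** R_B"
    by (simp add: spd_geodesic_def matrix_mul_assoc spd_inv_cancel roots_spd mult_cancel_middle)
  then show ?thesis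
    by (simp add: spsd_curve_def stiefel_curve_1 spd_curve_eq root_squares compress_B)
qed

lemma spsd_curve_spsd: "spsd_curve A B U_A U_B \<theta> t \<in> spsd CARD('p)"
  unfolding spsd_curve_def spd_curve_eq by (intro frame_spsd spd_geodesic_spd stiefel_curve_stiefel)

lemma lift_structure_space: "lift t \<in> structure_space"
  by (simp add: lift_eq structure_space_def spd_geodesic_spd stiefel_curve_stiefel)

lemma lift_has_vector_derivative: "(lift has_vector_derivative lift_velocity t) (at t)"
  unfolding lift_eq[abs_def]
  by (intro has_vector_derivative_Pair stiefel_curve_has_vector_derivative
      spd_geodesic_has_vector_derivative)

lemma lift_velocity_horizontal: "lift_velocity t \<in> horizontal_space (lift t)"
  by (simp add: lift_eq horizontal_space_iff stiefel_curve_stiefel spd_geodesic_spd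
      stiefel_curve_velocity_normal spd_velocity_symmetric)

lemma lift_horizontal: "horizontal_lift lift (spsd_curve A B U_A U_B \<theta>)"
  unfolding horizontal_lift_def
  using lift_structure_space quotient_lift lift_velocity_horizontal lift_has_vector_derivative by blast

lemma spsd_curve_has_vector_derivative:
  "(spsd_curve A B U_A U_B \<theta> has_vector_derivative quotient_differential (lift t) (lift_velocity t)) (at t)"
proof -
  have "spsd_curve A B U_A U_B \<theta> = quotient_proj \<circ> lift"
    by (simp add: fun_eq_iff quotient_lift)
  then show ?thesis
    using vector_derivative_diff_chain_within[OF lift_has_vector_derivative[of t]
        has_derivative_at_withinI[OF quotient_proj_has_derivative]] by simp
qed

text \<open>The lift is horizontal, so the speed of the curve in the quotient is that of the lift, where the two
  factors contribute \<open>velocity_gram\<close> and \<open>spd_velocity_norm\<close>.\<close>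

lemma speed:
  "spsd_metric TYPE('p) k (spsd_curve A B U_A U_B \<theta> t)
      (quotient_differential (lift t) (lift_velocity t)) (quotient_differential (lift t) (lift_velocity t))
    = (norm (diag \<theta>))\<^sup>2 + k * (norm L)\<^sup>2"
proof -
  have "velocity t \<bullet> velocity t = (norm (diag \<theta>))\<^sup>2"
    unfolding inner_matrix_eq_trace velocity_gram norm_diag by (simp add: trace_def diag_nth)
  then show ?thesis
    unfolding quotient_lift[symmetric]
      spsd_metric_horizontal[OF lift_structure_space lift_velocity_horizontal lift_velocity_horizontal]
    by (simp add: lift_eq horizontal_metric_eq spd_geodesic_spd spd_velocity_norm)
qed

lemma sq_length:
  assumes "0 < k"
  shows "spsd_curve_sq_length k A B U_A U_B \<theta> = (norm (diag \<theta>))\<^sup>2 + k * (norm L)\<^sup>2"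
proof -
  have vd: "vector_derivative (spsd_curve A B U_A U_B \<theta>) (at t within {0..1})
      = quotient_differential (lift t) (lift_velocity t)" if "t \<in> {0..1}" for t
    using vector_derivative_within_cbox[of 0 1 t, unfolded cbox_interval,
        OF _ that has_vector_derivative_at_within[OF spsd_curve_has_vector_derivative]] by simp
  have "riemannian_length (spsd_metric TYPE('p) k) (spsd_curve A B U_A U_B \<theta>) 0 1
      = integral {0..1} (\<lambda>t::real. sqrt ((norm (diag \<theta>))\<^sup>2 + k * (norm L)\<^sup>2))"
    unfolding riemannian_length_def
    by (rule integral_cong) (simp only: vd speed)
  also have "\<dots> = sqrt ((norm (diag \<theta>))\<^sup>2 + k * (norm L)\<^sup>2)" by simp
  finally show ?thesis using assms by (simp add: spsd_curve_sq_length_def)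
qed

end

subsection \<open>Invariance\<close>

lemma pinv_frame:
  fixes U :: "real^'p^'n"
  assumes S: "S \<in> spd" and U: "U \<in> stiefel"
  shows "pinv (U ** S ** transpose U) = U ** matrix_inv S ** transpose U"
proof -
  have m: "U ** S ** transpose U ** (U ** matrix_inv S ** transpose U) = U ** transpose U"
    "U ** matrix_inv S ** transpose U ** (U ** S ** transpose U) = U ** transpose U"
    by (simp_all add: matrix_mul_assoc stiefel_cancel U mult_cancel_middle spd_inv_cancel S)
  show ?thesis
    by (rule pinv_unique; simp only: m)
      (simp_all add: matrix_transpose_mul matrix_mul_assoc stiefel_cancel U)
qed

lemma principal_choice_connection:
  fixes V_A V_B :: "real^('p::{finite,linorder})^'n"
  assumes "A \<in> spsd CARD('p)" "B \<in> spsd CARD('p)"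
    and c: "principal_choice A B V_A V_B O_A O_B \<sigma> \<theta>"
  shows "spsd_connection (V_A ** O_A) (V_B ** O_B) \<theta> A B"
proof
  have O: "orthogonal_matrix O_A" "orthogonal_matrix O_B" and V: "V_A \<in> stiefel" "V_B \<in> stiefel"
    using c by (auto simp: principal_choice_def)
  show "V_A ** O_A \<in> stiefel" "V_B ** O_B \<in> stiefel" using stiefel_mult_orthogonal V O by auto
  show "range ((*v) (V_A ** O_A)) = range ((*v) A)" "range ((*v) (V_B ** O_B)) = range ((*v) B)"
    using c O by (auto simp: principal_choice_def range_mult_orthogonal)
  have "\<sigma> = (\<chi> i. cos (\<theta> $ i))" using c by (simp add: principal_choice_def vec_eq_iff)
  then show "transpose (V_A ** O_A) ** (V_B ** O_B) = diag (\<chi> i. cos (\<theta> $ i))"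
    using c by (simp add: principal_choice_def matrix_transpose_mul matrix_mul_assoc)
  show "0 \<le> \<theta> $ i" "\<theta> $ i \<le> pi / 2" for i using c by (auto simp: principal_choice_def)
qed (use assms in auto)

lemma principal_choice_cong:
  assumes choice: "principal_choice A B V_A V_B O_A O_B \<sigma> \<theta>"
    and frames: "W_A \<in> stiefel" "W_B \<in> stiefel"
      "range ((*v) W_A) = range ((*v) A')" "range ((*v) W_B) = range ((*v) B')"
    and gram: "transpose W_A ** W_B = transpose V_A ** V_B"
  shows "principal_choice A' B' W_A W_B O_A O_B \<sigma> \<theta>"
proof -
  have "transpose O_A ** transpose W_A ** W_B ** O_B = transpose O_A ** transpose V_A ** V_B ** O_B"
    using gram by (metis matrix_mul_assoc)
  then show ?thesis
    using choice unfolding principal_choice_def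
    by (elim conjE, intro conjI) (rule frames | assumption | simp only:)+
qed

lemma pinv_spsd:
  fixes U :: "real^'p^'n"
  assumes A: "A \<in> spsd CARD('p)" and U: "U \<in> stiefel" and range: "range ((*v) U) = range ((*v) A)"
  shows "pinv A \<in> spsd CARD('p)" "range ((*v) (pinv A)) = range ((*v) A)"
    "transpose U ** pinv A ** U = matrix_inv (transpose U ** A ** U)"
proof -
  let ?S = "transpose U ** A ** U"
  have S: "?S \<in> spd" and Ae: "U ** ?S ** transpose U = A" using frame_compression[OF A U range] by auto
  have p: "pinv A = U ** matrix_inv ?S ** transpose U" using pinv_frame[OF S U] Ae by simp
  show "pinv A \<in> spsd CARD('p)" unfolding p by (intro frame_spsd spd_matrix_inv S U)
  show "range ((*v) (pinv A)) = range ((*v) A)" unfolding p range_frame[OF spd_matrix_inv[OF S] U] range ..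
  show "transpose U ** pinv A ** U = matrix_inv ?S"
    unfolding p by (simp add: matrix_mul_assoc stiefelD U stiefel_cancel)
qed

text \<open>Pseudoinversion inverts \<open>R_A\<close> and \<open>R_B\<close>. The new ratio \<open>R\<^sub>A R\<^sub>B\<^sup>-\<^sup>2 R\<^sub>A\<close> is the inverse of the old one, so
  its logarithm only changes sign.\<close>

lemma (in spsd_connection) sq_length_pinv:
  assumes "0 < k"
  shows "spsd_curve_sq_length k (pinv A) (pinv B) U_A U_B \<theta> = spsd_curve_sq_length k A B U_A U_B \<theta>"
proof -
  interpret pinv: spsd_connection U_A U_B \<theta> "pinv A" "pinv B"
    by unfold_locales
      (simp_all add: pinv_spsd[OF A frame_A range_A] pinv_spsd[OF B frame_B range_B] range_A range_B)
  have r: "pinv.R_A = matrix_inv R_A" "pinv.R_B = matrix_inv R_B"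
    by (simp_all add: compressed_sqrt_def pinv_spsd(3)[OF A frame_A range_A]
        pinv_spsd(3)[OF B frame_B range_B] msqrt_matrix_inv compress_A compress_B)
  have i: "invertible R_A" "invertible R_B" "invertible (matrix_inv R_A)"
    by (simp_all add: spd_invertible roots_spd invertible_matrix_inv)
  have "matrix_inv (matrix_inv R_A ** (R_B ** R_B) ** matrix_inv R_A)
      = R_A ** (matrix_inv R_B ** matrix_inv R_B) ** R_A"
    by (simp add: matrix_inv_mult i invertible_mult matrix_inv_matrix_inv matrix_mul_assoc)
  then have "pinv.L = - L"
    unfolding log_ratio_def Let_def r
    by (simp add: matrix_inv_matrix_inv i mlog_matrix_inv[OF ratio_spd, symmetric])
  then show ?thesis using assms by (simp add: sq_length pinv.sq_length)
qed

lemma frame_congruence: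
  fixes U :: "real^'p^'n" and Q :: "real^'n^'n"
  assumes A: "A \<in> spsd CARD('p)" and U: "U \<in> stiefel" and range: "range ((*v) U) = range ((*v) A)"
    and Q: "orthogonal_matrix Q"
  shows "Q ** A ** transpose Q \<in> spsd CARD('p)" "Q ** U \<in> stiefel"
    "range ((*v) (Q ** U)) = range ((*v) (Q ** A ** transpose Q))"
    "transpose (Q ** U) ** (Q ** A ** transpose Q) ** (Q ** U) = transpose U ** A ** U"
proof -
  note compress = frame_compression[OF A U range]
  show QU: "Q ** U \<in> stiefel"
    using U by (simp add: stiefel_def matrix_transpose_mul matrix_mul_assoc orthogonal_matrix_cancel[OF Q])
  have e: "Q ** A ** transpose Q = (Q ** U) ** (transpose U ** A ** U) ** transpose (Q ** U)"
    by (subst (1) compress(1)[symmetric]) (simp add: matrix_transpose_mul matrix_mul_assoc)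
  show "Q ** A ** transpose Q \<in> spsd CARD('p)" unfolding e by (intro frame_spsd compress QU)
  show "range ((*v) (Q ** U)) = range ((*v) (Q ** A ** transpose Q))"
    unfolding e range_frame[OF compress(2) QU] ..
  show "transpose (Q ** U) ** (Q ** A ** transpose Q) ** (Q ** U) = transpose U ** A ** U"
    by (simp add: matrix_transpose_mul matrix_mul_assoc orthogonal_matrix_cancel[OF Q])
qed

lemma spd_scaleR:
  fixes S :: "real^'p^'p"
  assumes "S \<in> spd" "0 < c" shows "c *\<^sub>R S \<in> spd"
  using assms by (auto simp: spd_def symmetric_mats_def transpose_simps scaleR_matrix_vector_assoc[symmetric])

lemma frame_scaling:
  fixes U :: "real^'p^'n"
  assumes A: "A \<in> spsd CARD('p)" and U: "U \<in> stiefel" and range: "range ((*v) U) = range ((*v) A)"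
    and c: "0 < c"
  shows "c *\<^sub>R A \<in> spsd CARD('p)" "range ((*v) (c *\<^sub>R A)) = range ((*v) A)"
proof -
  note compress = frame_compression[OF A U range]
  have e: "c *\<^sub>R A = U ** (c *\<^sub>R (transpose U ** A ** U)) ** transpose U"
    by (subst (1) compress(1)[symmetric]) (simp add: matrix_mult_simps)
  show "c *\<^sub>R A \<in> spsd CARD('p)" unfolding e by (intro frame_spsd spd_scaleR compress U c)
  show "range ((*v) (c *\<^sub>R A)) = range ((*v) A)"
    unfolding e range_frame[OF spd_scaleR[OF compress(2) c] U] range ..
qed

context spsd_connection
begin

text \<open>The compressions to the frames do not change when the frames are moved along with the matrices.\<close>

lemma sq_length_congruence:
  fixes Q :: "real^'n^'n"
  assumes k: "0 < k" and Q: "orthogonal_matrix Q"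
  shows "spsd_curve_sq_length k (Q ** A ** transpose Q) (Q ** B ** transpose Q) (Q ** U_A) (Q ** U_B) \<theta>
    = spsd_curve_sq_length k A B U_A U_B \<theta>"
proof -
  interpret congr: spsd_connection "Q ** U_A" "Q ** U_B" \<theta> "Q ** A ** transpose Q" "Q ** B ** transpose Q"
  proof
    show "transpose (Q ** U_A) ** (Q ** U_B) = diag (\<chi> i. cos (\<theta> $ i))"
      using cosines by (simp add: matrix_transpose_mul matrix_mul_assoc orthogonal_matrix_cancel[OF Q])
  qed (use frame_congruence[OF A frame_A range_A Q] frame_congruence[OF B frame_B range_B Q]
      angle_nonneg angle_le in auto)
  have "congr.L = L"
    by (simp add: log_ratio_def compressed_sqrt_def frame_congruence(4)[OF A frame_A range_A Q]
        frame_congruence(4)[OF B frame_B range_B Q])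
  then show ?thesis using k by (simp add: sq_length congr.sq_length)
qed

text \<open>Both square roots acquire the factor \<open>\<bar>\<mu>\<bar>\<close>, which cancels in the ratio.\<close>

lemma sq_length_scaling:
  assumes k: "0 < k" and \<mu>: "\<mu> \<noteq> 0"
  shows "spsd_curve_sq_length k (\<mu>\<^sup>2 *\<^sub>R A) (\<mu>\<^sup>2 *\<^sub>R B) U_A U_B \<theta> = spsd_curve_sq_length k A B U_A U_B \<theta>"
proof -
  have \<mu>2: "0 < \<mu>\<^sup>2" "0 < \<bar>\<mu>\<bar>" using \<mu> by auto
  interpret scaled: spsd_connection U_A U_B \<theta> "\<mu>\<^sup>2 *\<^sub>R A" "\<mu>\<^sup>2 *\<^sub>R B"
    by unfold_locales
      (simp_all add: frame_scaling[OF A frame_A range_A \<mu>2(1)] frame_scaling[OF B frame_B range_B \<mu>2(1)]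
        range_A range_B)
  have sqrt: "msqrt (\<mu>\<^sup>2 *\<^sub>R (R ** R)) = \<bar>\<mu>\<bar> *\<^sub>R R" if "R \<in> spd" for R :: "real^'p^'p"
    using msqrt_unique[OF spd_scaleR[OF that \<mu>2(2)]]
    by (simp add: matrix_mult_simps power2_eq_square)
  have r: "scaled.R_A = \<bar>\<mu>\<bar> *\<^sub>R R_A" "scaled.R_B = \<bar>\<mu>\<bar> *\<^sub>R R_B"
    using sqrt[OF roots_spd(1)] sqrt[OF roots_spd(2)] unfolding root_squares
    by (simp_all add: compressed_sqrt_def matrix_mult_simps)
  have "matrix_inv (\<bar>\<mu>\<bar> *\<^sub>R R_A) = (1 / \<bar>\<mu>\<bar>) *\<^sub>R matrix_inv R_A"
    using \<mu> by (intro matrix_inv_unique) (simp add: matrix_mult_simps spd_inv_cancel roots_spd)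
  then have "scaled.L = L"
    using \<mu> unfolding log_ratio_def Let_def r by (simp add: matrix_mult_simps)
  then show ?thesis using k by (simp add: sq_length scaled.sq_length)
qed

end

section \<open>Differentiating the matrix inverse\<close>

lemma tendsto_det:
  fixes M :: "'a \<Rightarrow> real^'n^'n"
  assumes "\<And>i j. ((\<lambda>x. M x $ i $ j) \<longlongrightarrow> N $ i $ j) F"
  shows "((\<lambda>x. det (M x)) \<longlongrightarrow> det N) F"
  unfolding det_def by (intro tendsto_intros assms)

text \<open>Cramer's rule, from which the continuity of the inverse is read off.\<close>

lemma matrix_inv_cramer:
  fixes A :: "real^'n^'n"
  assumes "invertible A"
  shows "matrix_inv A $ k $ l = det (\<chi> i j. if j = k then axis l 1 $ i else A $ i $ j) / det A"
proof -
  have "A *v (matrix_inv A *v axis l 1) = axis l 1"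
    by (simp add: matrix_vector_mul_assoc matrix_inv_inverse assms)
  then have "matrix_inv A *v axis l 1
      = (\<chi> k. det (\<chi> i j. if j = k then axis l 1 $ i else A $ i $ j) / det A)"
    using assms by (subst (asm) cramer) (simp_all add: invertible_det_nz)
  moreover have "(matrix_inv A *v axis l 1) $ k = matrix_inv A $ k $ l"
    by (simp only: matrix_vector_mult_basis) (simp add: column_def)
  ultimately show ?thesis by simp
qed

lemma eventually_invertible:
  fixes A :: "real^'n^'n"
  assumes "invertible A"
  shows "\<forall>\<^sub>F Y in at A. invertible Y"
proof -
  have "((\<lambda>Y. det Y) \<longlongrightarrow> det A) (at A)"
    by (intro tendsto_det tendsto_vec_nth tendsto_ident_at)
  then have "\<forall>\<^sub>F Y in at A. det Y \<noteq> 0"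
    using assms by (intro tendsto_imp_eventually_ne) (simp_all add: invertible_det_nz)
  then show ?thesis by (simp add: invertible_det_nz)
qed

lemma tendsto_matrix_inv:
  fixes A :: "real^'n^'n"
  assumes A: "invertible A"
  shows "(matrix_inv \<longlongrightarrow> matrix_inv A) (at A)"
proof (intro vec_tendstoI)
  fix k l
  have "((\<lambda>Y. if j = k then axis l 1 $ i else Y $ i $ j) \<longlongrightarrow>
      (if j = k then axis l 1 $ i else A $ i $ j)) (at A)" for i j
    by (cases "j = k") (auto intro!: tendsto_vec_nth tendsto_ident_at)
  then have "((\<lambda>Y. det (\<chi> i j. if j = k then axis l 1 $ i else Y $ i $ j)) \<longlongrightarrow>
      det (\<chi> i j. if j = k then axis l 1 $ i else A $ i $ j)) (at A)"
    by (intro tendsto_det) (simp only: vec_lambda_beta)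
  then have "((\<lambda>Y. det (\<chi> i j. if j = k then axis l 1 $ i else Y $ i $ j) / det Y) \<longlongrightarrow>
      det (\<chi> i j. if j = k then axis l 1 $ i else A $ i $ j) / det A) (at A)"
    by (rule tendsto_divide)
      (use A in \<open>auto intro!: tendsto_det tendsto_vec_nth tendsto_ident_at simp: invertible_det_nz\<close>)
  then show "((\<lambda>Y. matrix_inv Y $ k $ l) \<longlongrightarrow> matrix_inv A $ k $ l) (at A)"
    unfolding matrix_inv_cramer[OF A]
    by (rule Lim_transform_eventually)
      (use eventually_invertible[OF A] in eventually_elim, simp only: matrix_inv_cramer)
qed

text \<open>By the resolvent identity \<open>Y\<inverse> - A\<inverse> = - Y\<inverse> (Y - A) A\<inverse>\<close> the remainder of the linear approximation is
  \<open>(A\<inverse> - Y\<inverse>) (Y - A) A\<inverse>\<close>; continuity of the inverse makes it small compared with \<open>Y - A\<close>.\<close>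

lemma matrix_inv_has_derivative:
  fixes A :: "real^'n^'n"
  assumes A: "invertible A"
  shows "(matrix_inv has_derivative (\<lambda>H. - (matrix_inv A ** H ** matrix_inv A))) (at A)"
proof -
  let ?A = "matrix_inv A"
  obtain K where K: "0 < K" "\<And>(x :: real^'n^'n) (y :: real^'n^'n). norm (x ** y) \<le> norm x * norm y * K"
    using bounded_bilinear.pos_bounded[OF bounded_bilinear_matrix_mult] by blast
  have "((\<lambda>Y. norm (?A - matrix_inv Y) * K * (norm ?A * K)) \<longlongrightarrow> norm (?A - ?A) * K * (norm ?A * K)) (at A)"
    by (intro tendsto_intros tendsto_matrix_inv A)
  then have lim: "((\<lambda>Y. norm (?A - matrix_inv Y) * K * (norm ?A * K)) \<longlongrightarrow> 0) (at A)" by simp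
  have "\<forall>\<^sub>F Y in at A. norm (matrix_inv Y - ?A - - (?A ** (Y - A) ** ?A)) / norm (Y - A)
      \<le> norm (?A - matrix_inv Y) * K * (norm ?A * K)"
    using eventually_invertible[OF A]
  proof eventually_elim
    case (elim Y)
    have "matrix_inv Y - ?A - - (?A ** (Y - A) ** ?A) = (?A - matrix_inv Y) ** (Y - A) ** ?A"
      by (simp only: matrix_mult_simps matrix_inv_inverse[OF A] matrix_inv_inverse[OF elim]
          matrix_mul_lid mult_cancel_middle[OF matrix_inv_inverse(1)[OF A]])
        (simp add: algebra_simps)
    also have "norm \<dots> \<le> norm ((?A - matrix_inv Y) ** (Y - A)) * (norm ?A * K)"
      using K(2)[of "(?A - matrix_inv Y) ** (Y - A)" ?A] by (simp add: mult.assoc)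
    also have "\<dots> \<le> norm (?A - matrix_inv Y) * norm (Y - A) * K * (norm ?A * K)"
      using K by (intro mult_right_mono) auto
    finally show ?case
      by (cases "Y = A") (auto simp: divide_simps algebra_simps)
  qed
  then have "((\<lambda>Y. norm (matrix_inv Y - ?A - - (?A ** (Y - A) ** ?A)) / norm (Y - A)) \<longlongrightarrow> 0) (at A)"
    by (intro tendsto_sandwich[OF _ _ tendsto_const lim]) (auto intro!: always_eventually)
  moreover have "bounded_linear (\<lambda>H. - (?A ** H ** ?A))"
    by (intro bounded_linear_minus bounded_linear_conjugation)
  ultimately show ?thesis by (simp only: has_derivative_iff_norm simp_thms)
qed

lemma has_vector_derivative_matrix_inv:
  fixes f :: "real \<Rightarrow> real^'n^'n"
  assumes "(f has_vector_derivative f') (at x)" "invertible (f x)"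
  shows "((\<lambda>x. matrix_inv (f x)) has_vector_derivative - (matrix_inv (f x) ** f' ** matrix_inv (f x))) (at x)"
  using vector_derivative_diff_chain_within[OF assms(1)
      has_derivative_at_withinI[OF matrix_inv_has_derivative[OF assms(2)]]]
  by (simp add: o_def)

lemma continuous_on_matrix_inv:
  fixes f :: "'a::topological_space \<Rightarrow> real^'n^'n"
  assumes "continuous_on T f" "\<And>x. x \<in> T \<Longrightarrow> invertible (f x)"
  shows "continuous_on T (\<lambda>x. matrix_inv (f x))"
proof -
  have "continuous_on {A :: real^'n^'n. invertible A} matrix_inv"
    by (intro continuous_at_imp_continuous_on) (auto simp: isCont_def intro!: tendsto_matrix_inv)
  then show ?thesis
    by (rule continuous_on_compose2[OF _ assms(1)]) (use assms(2) in auto)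
qed

section \<open>Smooth maps of one and two parameters\<close>

lemma smooth_onD:
  assumes "smooth_on W f"
  obtains D where "\<And>z. z \<in> W \<Longrightarrow> (f has_derivative D z) (at z)" "\<And>h. smooth_on W (\<lambda>z. D z h)"
  by (rule smooth_on.cases[OF assms]) (use that in blast)

lemma smooth_on_continuous_on: "smooth_on W f \<Longrightarrow> continuous_on W f"
  by (elim smooth_onD) (meson continuous_at_imp_continuous_on has_derivative_continuous)

lemma partial_derivatives:
  fixes f :: "real \<times> real \<Rightarrow> 'b::real_normed_vector"
  assumes "(f has_derivative D) (at (s, t))"
  shows "((\<lambda>s. f (s, t)) has_vector_derivative D (1, 0)) (at s)"
    "((\<lambda>t. f (s, t)) has_vector_derivative D (0, 1)) (at t)"
proof -
  have lin: "linear D" using assms by (rule has_derivative_linear)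
  have "((\<lambda>s. (s, t)) has_derivative (\<lambda>h. (h, 0))) (at s)" "((\<lambda>t. (s, t)) has_derivative (\<lambda>h. (0, h))) (at t)"
    by (auto intro!: derivative_eq_intros)
  from this[THEN has_derivative_compose, of f D] assms
  have "((\<lambda>s. f (s, t)) has_derivative (\<lambda>h. D (h, 0))) (at s)"
    "((\<lambda>t. f (s, t)) has_derivative (\<lambda>h. D (0, h))) (at t)" by auto
  moreover have "(\<lambda>h. D (h, 0)) = (\<lambda>h. h *\<^sub>R D (1, 0))" "(\<lambda>h. D (0, h)) = (\<lambda>h. h *\<^sub>R D (0, 1))"
    by (simp_all add: fun_eq_iff flip: linear_scale[OF lin])
  ultimately show "((\<lambda>s. f (s, t)) has_vector_derivative D (1, 0)) (at s)"
    "((\<lambda>t. f (s, t)) has_vector_derivative D (0, 1)) (at t)"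
    by (simp_all only: has_vector_derivative_def)
qed

text \<open>Differentiate \<open>f(s, t) = f(s, a) + \<integral> f\<^sub>t(s, \<tau>) d\<tau>\<close>, with the integral from \<open>a\<close> to \<open>t\<close>, first in \<open>s\<close>
  under the integral sign and then in \<open>t\<close>.\<close>

lemma mixed_partials_commute:
  fixes f :: "real \<times> real \<Rightarrow> 'b::euclidean_space"
  assumes I: "open I" "convex I" and J: "open J"
    and fs: "\<And>s t. s \<in> I \<Longrightarrow> t \<in> J \<Longrightarrow> ((\<lambda>s. f (s, t)) has_vector_derivative fs (s, t)) (at s)"
    and ft: "\<And>s t. s \<in> I \<Longrightarrow> t \<in> J \<Longrightarrow> ((\<lambda>t. f (s, t)) has_vector_derivative ft (s, t)) (at t)"
    and fts: "\<And>s t. s \<in> I \<Longrightarrow> t \<in> J \<Longrightarrow> ((\<lambda>s. ft (s, t)) has_vector_derivative fts (s, t)) (at s)"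
    and cont: "continuous_on (I \<times> J) ft" "continuous_on (I \<times> J) fts"
    and s: "s \<in> I" and t: "t \<in> J"
  shows "((\<lambda>t. fs (s, t)) has_vector_derivative fts (s, t)) (at t)"
proof -
  obtain e where e: "0 < e" "cball t e \<subseteq> J"
    using J t open_contains_cball by blast
  \<comment> \<open>A compact neighbourhood of \<open>t\<close>, so that the integrals below stay inside \<open>J\<close>.\<close>
  define a b where "a = t - e" and "b = t + e"
  have ab: "{a..b} \<subseteq> J" "t \<in> {a<..<b}" "a \<in> J"
    using e by (auto simp: a_def b_def cball_eq_atLeastAtMost)
  have c1: "continuous_on {a..b} (\<lambda>\<tau>. g (r, \<tau>))" if "continuous_on (I \<times> J) g" "r \<in> I"
    for g :: "real \<times> real \<Rightarrow> 'b" and r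
    by (rule continuous_on_compose2[OF that(1)]) (use ab that in \<open>auto intro!: continuous_intros\<close>)
  have int: "integral {a..u} (\<lambda>\<tau>. ft (r, \<tau>)) = f (r, u) - f (r, a)" if "r \<in> I" "u \<in> {a..b}" for r u
    by (intro integral_unique fundamental_theorem_of_calculus)
      (use that ab in \<open>auto intro!: has_vector_derivative_at_within[OF ft]\<close>)
  have fs_eq: "fs (s, u) = fs (s, a) + integral {a..u} (\<lambda>\<tau>. fts (s, \<tau>))" if u: "u \<in> {a..b}" for u
  proof -
    have "((\<lambda>r. integral (cbox a u) (\<lambda>\<tau>. ft (r, \<tau>))) has_vector_derivative
        integral (cbox a u) (\<lambda>\<tau>. fts (s, \<tau>))) (at s within I)"
    proof (rule leibniz_rule_vector_derivative[where fx = "\<lambda>r \<tau>. fts (r, \<tau>)"])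
      show "((\<lambda>r. ft (r, \<tau>)) has_vector_derivative fts (r, \<tau>)) (at r within I)"
        if "r \<in> I" "\<tau> \<in> cbox a u" for r \<tau>
        using that u ab by (intro has_vector_derivative_at_within[OF fts]) auto
      show "(\<lambda>\<tau>. ft (r, \<tau>)) integrable_on cbox a u" if "r \<in> I" for r
        using continuous_on_subset[OF c1[OF cont(1) that], of "{a..u}"] u
        by (auto intro!: integrable_continuous_interval)
      show "continuous_on (I \<times> cbox a u) (\<lambda>(r, \<tau>). fts (r, \<tau>))"
        using u ab by (auto intro!: continuous_on_subset[OF cont(2)])
    qed (use s I in auto)
    then have "((\<lambda>r. integral {a..u} (\<lambda>\<tau>. ft (r, \<tau>))) has_vector_derivative
        integral {a..u} (\<lambda>\<tau>. fts (s, \<tau>))) (at s)"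
      by (simp only: at_within_open[OF s I(1)] cbox_interval)
    then have "((\<lambda>r. f (r, u) - f (r, a)) has_vector_derivative integral {a..u} (\<lambda>\<tau>. fts (s, \<tau>))) (at s)"
      by (rule has_vector_derivative_transform_within_open[OF _ I(1) s]) (use int u in auto)
    moreover have "((\<lambda>r. f (r, u) - f (r, a)) has_vector_derivative fs (s, u) - fs (s, a)) (at s)"
      using u ab s by (intro has_vector_derivative_diff fs) auto
    ultimately have "integral {a..u} (\<lambda>\<tau>. fts (s, \<tau>)) = fs (s, u) - fs (s, a)"
      by (rule vector_derivative_unique_at)
    then show ?thesis by simp
  qed
  have "((\<lambda>u. integral {a..u} (\<lambda>\<tau>. fts (s, \<tau>))) has_vector_derivative fts (s, t)) (at t within {a..b})"
    using integral_has_vector_derivative[OF c1[OF cont(2) s], of t] ab by auto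
  then have "((\<lambda>u. integral {a..u} (\<lambda>\<tau>. fts (s, \<tau>))) has_vector_derivative fts (s, t)) (at t within {a<..<b})"
    by (rule has_vector_derivative_within_subset) auto
  then have "((\<lambda>u. integral {a..u} (\<lambda>\<tau>. fts (s, \<tau>))) has_vector_derivative fts (s, t)) (at t)"
    by (simp only: at_within_open[OF ab(2) open_greaterThanLessThan])
  then have "((\<lambda>u. fs (s, a) + integral {a..u} (\<lambda>\<tau>. fts (s, \<tau>))) has_vector_derivative 0 + fts (s, t)) (at t)"
    by (intro has_vector_derivative_add has_vector_derivative_const)
  then have "((\<lambda>u. fs (s, u)) has_vector_derivative 0 + fts (s, t)) (at t)"
  proof (rule has_vector_derivative_transform_within_open[OF _ open_greaterThanLessThan ab(2)])
    show "fs (s, a) + integral {a..u} (\<lambda>\<tau>. fts (s, \<tau>)) = fs (s, u)" if "u \<in> {a<..<b}" for u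
      using that by (intro fs_eq[symmetric]) auto
  qed
  then show ?thesis by simp
qed

locale two_parameter_map =
  fixes I J :: "real set" and f fs ft fts :: "real \<times> real \<Rightarrow> 'b::euclidean_space"
  assumes I: "open I" "convex I" and J: "open J"
    and fs: "\<And>s t. s \<in> I \<Longrightarrow> t \<in> J \<Longrightarrow> ((\<lambda>s. f (s, t)) has_vector_derivative fs (s, t)) (at s)"
    and ft: "\<And>s t. s \<in> I \<Longrightarrow> t \<in> J \<Longrightarrow> ((\<lambda>t. f (s, t)) has_vector_derivative ft (s, t)) (at t)"
    and fts: "\<And>s t. s \<in> I \<Longrightarrow> t \<in> J \<Longrightarrow> ((\<lambda>s. ft (s, t)) has_vector_derivative fts (s, t)) (at s)"
    and fst: "\<And>s t. s \<in> I \<Longrightarrow> t \<in> J \<Longrightarrow> ((\<lambda>t. fs (s, t)) has_vector_derivative fts (s, t)) (at t)"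
    and cont: "continuous_on (I \<times> J) f" "continuous_on (I \<times> J) fs"
      "continuous_on (I \<times> J) ft" "continuous_on (I \<times> J) fts"

lemma smooth_on_two_parameter_map:
  fixes f :: "real \<times> real \<Rightarrow> 'b::euclidean_space"
  assumes I: "open I" "convex I" and J: "open J" and f: "smooth_on (I \<times> J) f"
  obtains fs ft fts where "two_parameter_map I J f fs ft fts"
proof -
  obtain D where D: "\<And>z. z \<in> I \<times> J \<Longrightarrow> (f has_derivative D z) (at z)" "\<And>h. smooth_on (I \<times> J) (\<lambda>z. D z h)"
    using f by (rule smooth_onD) (rule that)
  define fs ft where "fs z = D z (1, 0)" and "ft z = D z (0, 1)" for z
  have smooth: "smooth_on (I \<times> J) fs" "smooth_on (I \<times> J) ft"
    unfolding fs_def[abs_def] ft_def[abs_def] by (rule D(2))+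
  obtain E where E: "\<And>z. z \<in> I \<times> J \<Longrightarrow> (ft has_derivative E z) (at z)" "\<And>h. smooth_on (I \<times> J) (\<lambda>z. E z h)"
    using smooth(2) by (rule smooth_onD) (rule that)
  define fts where "fts z = E z (1, 0)" for z
  have smooth': "smooth_on (I \<times> J) fts"
    unfolding fts_def[abs_def] by (rule E(2))
  note cont = smooth_on_continuous_on[OF f] smooth_on_continuous_on[OF smooth(1)]
    smooth_on_continuous_on[OF smooth(2)] smooth_on_continuous_on[OF smooth']
  have d: "((\<lambda>s. f (s, t)) has_vector_derivative fs (s, t)) (at s)"
    "((\<lambda>t. f (s, t)) has_vector_derivative ft (s, t)) (at t)"
    "((\<lambda>s. ft (s, t)) has_vector_derivative fts (s, t)) (at s)" if "s \<in> I" "t \<in> J" for s t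
    unfolding fs_def ft_def[of "(s, t)"] fts_def using that by (auto intro!: partial_derivatives D(1) E(1))
  show ?thesis
    using that[of fs ft fts] I J d cont mixed_partials_commute[OF I J d cont(3,4)]
    by (simp add: two_parameter_map_def)
qed

text \<open>Such sums are closed under differentiation, which acts on the coefficients by
  \<open>(a, b, c) \<mapsto> (\<alpha> b, - \<alpha> a, \<beta> c)\<close>; this closure is the invariant for coinduction.\<close>

lemma trig_exp_polynomial_smooth:
  fixes \<alpha> \<beta> :: "'i::finite \<Rightarrow> real" and a b c :: "'i \<Rightarrow> 'b::real_normed_vector"
  shows "smooth_on UNIV (\<lambda>t. \<Sum>i\<in>UNIV. cos (\<alpha> i * t) *\<^sub>R a i + sin (\<alpha> i * t) *\<^sub>R b i + exp (\<beta> i * t) *\<^sub>R c i)"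
proof -
  define F where "F a b c t = (\<Sum>i\<in>UNIV. cos (\<alpha> i * t) *\<^sub>R a i + sin (\<alpha> i * t) *\<^sub>R b i + exp (\<beta> i * t) *\<^sub>R c i)"
    for a b c :: "'i \<Rightarrow> 'b" and t
  let ?D = "\<lambda>a b c. F (\<lambda>i. \<alpha> i *\<^sub>R b i) (\<lambda>i. - \<alpha> i *\<^sub>R a i) (\<lambda>i. \<beta> i *\<^sub>R c i)"
  have deriv: "(F a b c has_derivative (\<lambda>h. h *\<^sub>R ?D a b c t)) (at t)" for a b c t
    unfolding has_vector_derivative_def[symmetric] F_def[abs_def]
    by (rule has_vector_derivative_sum) (auto intro!: derivative_eq_intros simp: algebra_simps)
  have scale: "h *\<^sub>R F a b c t = F (\<lambda>i. h *\<^sub>R a i) (\<lambda>i. h *\<^sub>R b i) (\<lambda>i. h *\<^sub>R c i) t" for h a b c t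
    by (simp add: F_def scaleR_sum_right scaleR_add_right mult.commute)
  have "smooth_on UNIV (F a b c)"
  proof (rule smooth_on.coinduct[where X = "\<lambda>f. \<exists>a b c. f = F a b c"])
    fix f :: "real \<Rightarrow> 'b" assume "\<exists>a b c. f = F a b c"
    then obtain a b c where f: "f = F a b c" by blast
    have "\<exists>a' b' c'. (\<lambda>t. h *\<^sub>R ?D a b c t) = F a' b' c'" for h
      unfolding scale by blast
    then show "\<exists>g D. f = g \<and> (\<forall>z\<in>UNIV. (g has_derivative D z) (at z)) \<and>
        (\<forall>h. (\<exists>a b c. (\<lambda>z. D z h) = F a b c) \<or> smooth_on UNIV (\<lambda>z. D z h))"
      unfolding f using deriv by (intro exI[of _ "F a b c"] exI[of _ "\<lambda>t h. h *\<^sub>R ?D a b c t"]) blast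
  qed blast
  then show ?thesis by (simp add: F_def[abs_def])
qed

section \<open>First variation of the energy in the structure space\<close>

lemma bounded_linear_trace: "bounded_linear (trace :: real^'n^'n \<Rightarrow> real)"
  unfolding linear_conv_bounded_linear[symmetric]
  by (auto intro!: linearI simp: trace_add trace_scaleR)

text \<open>Differentiate the constraint \<open>U\<^sup>T U = 1\<close>.\<close>

lemma stiefel_curve_tangent:
  fixes f :: "real \<Rightarrow> real^'p^'n"
  assumes f: "(f has_vector_derivative f') (at x)" and T: "open T" "x \<in> T" "\<And>y. y \<in> T \<Longrightarrow> f y \<in> stiefel"
  shows "transpose (f x) ** f' \<in> skew_mats"
proof -
  have "((\<lambda>y. transpose (f y) ** f y) has_vector_derivative transpose (f x) ** f' + transpose f' ** f x) (at x)"
    by (intro bounded_bilinear.has_vector_derivative[OF bounded_bilinear_matrix_mult]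
        bounded_linear.has_vector_derivative[OF bounded_linear_transpose] f)
  moreover have "((\<lambda>y. transpose (f y) ** f y) has_vector_derivative 0) (at x)"
    by (rule has_vector_derivative_transform_within_open[OF has_vector_derivative_const T(1,2)])
      (simp add: T(3) stiefelD)
  ultimately have "transpose (f x) ** f' + transpose f' ** f x = 0"
    by (rule vector_derivative_unique_at)
  then show ?thesis
    by (simp add: skew_mats_def matrix_transpose_mul add_eq_0_iff2 add.commute)
qed

lemma symmetric_curve_tangent:
  fixes f :: "real \<Rightarrow> real^'p^'p"
  assumes f: "(f has_vector_derivative f') (at x)" and T: "open T" "x \<in> T" "\<And>y. y \<in> T \<Longrightarrow> f y \<in> spd"
  shows "f' \<in> symmetric_mats"
proof -
  have "((\<lambda>y. transpose (f y)) has_vector_derivative transpose f') (at x)"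
    by (intro bounded_linear.has_vector_derivative[OF bounded_linear_transpose] f)
  moreover have "((\<lambda>y. transpose (f y)) has_vector_derivative f') (at x)"
    by (rule has_vector_derivative_transform_within_open[OF f T(1,2)])
      (simp add: T(3) spd_symmetric)
  ultimately show ?thesis
    using vector_derivative_unique_at by (auto simp: symmetric_mats_def)
qed

text \<open>A smooth two-parameter family in the structure space, with variation parameter \<open>s\<close> and curve
  parameter \<open>t\<close>. Tangency of \<open>Ht\<close> makes \<open>structure_metric_tangent\<close> applicable, so the energy
  density is the explicit function \<open>sq_speed\<close>.\<close>

locale structure_variation = two_parameter_map I J H Hs Ht Hts
  for I J and H Hs Ht Hts :: "real \<times> real \<Rightarrow> (real^'p^'n) \<times> (real^'p^'p)" +
  fixes k :: real
  assumes in_structure_space: "\<And>s t. s \<in> I \<Longrightarrow> t \<in> J \<Longrightarrow> H (s, t) \<in> structure_space"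
begin

definition log_speed :: "real \<times> real \<Rightarrow> real^'p^'p" where
  "log_speed z = matrix_inv (snd (H z)) ** snd (Ht z)"

definition log_speed_variation :: "real \<times> real \<Rightarrow> real^'p^'p" where
  "log_speed_variation z = matrix_inv (snd (H z)) ** snd (Hts z)
    - matrix_inv (snd (H z)) ** snd (Hs z) ** log_speed z"

definition sq_speed :: "real \<times> real \<Rightarrow> real" where
  "sq_speed z = fst (Ht z) \<bullet> fst (Ht z) + k * trace (log_speed z ** log_speed z)"

definition sq_speed_variation :: "real \<times> real \<Rightarrow> real" where
  "sq_speed_variation z = fst (Ht z) \<bullet> fst (Hts z) + k * trace (log_speed z ** log_speed_variation z)"

lemma components:
  assumes "s \<in> I" "t \<in> J"
  shows "fst (H (s, t)) \<in> stiefel" "snd (H (s, t)) \<in> spd"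
  using in_structure_space[OF assms] by (auto simp: structure_space_def)

lemmas fst_derivs = fs[THEN bounded_linear.has_vector_derivative[OF bounded_linear_fst]]
  ft[THEN bounded_linear.has_vector_derivative[OF bounded_linear_fst]]
  fts[THEN bounded_linear.has_vector_derivative[OF bounded_linear_fst]]
  fst[THEN bounded_linear.has_vector_derivative[OF bounded_linear_fst]]

lemmas snd_derivs = fs[THEN bounded_linear.has_vector_derivative[OF bounded_linear_snd]]
  ft[THEN bounded_linear.has_vector_derivative[OF bounded_linear_snd]]
  fts[THEN bounded_linear.has_vector_derivative[OF bounded_linear_snd]]
  fst[THEN bounded_linear.has_vector_derivative[OF bounded_linear_snd]]

lemma log_speed_deriv:
  assumes "s \<in> I" "t \<in> J"
  shows "((\<lambda>s. log_speed (s, t)) has_vector_derivative log_speed_variation (s, t)) (at s)"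
proof -
  let ?M = "matrix_inv (snd (H (s, t)))"
  have "((\<lambda>s. log_speed (s, t)) has_vector_derivative
      ?M ** snd (Hts (s, t)) + - (?M ** snd (Hs (s, t)) ** ?M) ** snd (Ht (s, t))) (at s)"
    unfolding log_speed_def
    by (intro bounded_bilinear.has_vector_derivative[OF bounded_bilinear_matrix_mult]
        has_vector_derivative_matrix_inv snd_derivs assms spd_invertible components)
  then show ?thesis
    by (simp add: log_speed_variation_def log_speed_def matrix_mult_simps)
qed

lemma sq_speed_deriv:
  assumes "s \<in> I" "t \<in> J"
  shows "((\<lambda>s. sq_speed (s, t)) has_real_derivative 2 * sq_speed_variation (s, t)) (at s)"
proof -
  have "((\<lambda>s. sq_speed (s, t)) has_vector_derivative
      (fst (Ht (s, t)) \<bullet> fst (Hts (s, t)) + fst (Hts (s, t)) \<bullet> fst (Ht (s, t)))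
      + k * trace (log_speed (s, t) ** log_speed_variation (s, t)
        + log_speed_variation (s, t) ** log_speed (s, t))) (at s)"
    unfolding sq_speed_def
    by (intro has_vector_derivative_add bounded_bilinear.has_vector_derivative[OF bounded_bilinear_inner]
        has_vector_derivative_mult_right bounded_linear.has_vector_derivative[OF bounded_linear_trace]
        bounded_bilinear.has_vector_derivative[OF bounded_bilinear_matrix_mult]
        log_speed_deriv fst_derivs assms)
  moreover have "(fst (Ht (s, t)) \<bullet> fst (Hts (s, t)) + fst (Hts (s, t)) \<bullet> fst (Ht (s, t)))
      + k * trace (log_speed (s, t) ** log_speed_variation (s, t)
        + log_speed_variation (s, t) ** log_speed (s, t)) = 2 * sq_speed_variation (s, t)"
    unfolding trace_add trace_mul_sym[of "log_speed_variation (s, t)"]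
      inner_commute[of "fst (Hts (s, t))"]
    by (simp add: sq_speed_variation_def)
  ultimately show ?thesis by (simp add: has_real_derivative_iff_has_vector_derivative)
qed

lemma speed_continuous: "continuous_on (I \<times> J) sq_speed" "continuous_on (I \<times> J) sq_speed_variation"
proof -
  have inv: "continuous_on (I \<times> J) (\<lambda>z. matrix_inv (snd (H z)))"
    using components(2) by (intro continuous_on_matrix_inv continuous_on_snd cont) (auto intro: spd_invertible)
  note mult = bounded_bilinear.continuous_on[OF bounded_bilinear_matrix_mult]
  have W: "continuous_on (I \<times> J) log_speed"
    unfolding log_speed_def[abs_def] by (intro mult inv continuous_on_snd cont)
  then have Ws: "continuous_on (I \<times> J) log_speed_variation"
    unfolding log_speed_variation_def[abs_def] by (intro continuous_on_diff mult inv continuous_on_snd cont)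
  show "continuous_on (I \<times> J) sq_speed" "continuous_on (I \<times> J) sq_speed_variation"
    unfolding sq_speed_def[abs_def] sq_speed_variation_def[abs_def]
    by (intro continuous_on_add continuous_on_inner continuous_on_mult_left continuous_on_fst cont
        bounded_linear.continuous_on[OF bounded_linear_trace] mult W Ws)+
qed

lemma metric_eq_sq_speed:
  assumes st: "s \<in> I" "t \<in> J"
  shows "structure_metric k (H (s, t)) (Ht (s, t)) (Ht (s, t)) = sq_speed (s, t)"
proof -
  obtain U S X D where e: "H (s, t) = (U, S)" "Ht (s, t) = (X, D)" by fastforce
  have "transpose (fst (H (s, t))) ** fst (Ht (s, t)) \<in> skew_mats"
    using st by (intro stiefel_curve_tangent[OF fst_derivs(2) J]) (auto intro: components)
  moreover have "snd (Ht (s, t)) \<in> symmetric_mats"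
    using st by (intro symmetric_curve_tangent[OF snd_derivs(2) J]) (auto intro: components)
  moreover have "trace (D ** matrix_inv S ** D ** matrix_inv S) = trace (matrix_inv S ** D ** (matrix_inv S ** D))"
    by (metis matrix_mul_assoc trace_mul_sym)
  ultimately show ?thesis
    using components[OF st] by (simp add: e structure_metric_tangent sq_speed_def log_speed_def)
qed

lemma energy_eq:
  assumes s: "s \<in> I" and ab: "a < b" "{a..b} \<subseteq> J"
  shows "riemannian_energy (structure_metric k) (\<lambda>t. H (s, t)) a b = 1 / 2 * integral {a..b} (\<lambda>t. sq_speed (s, t))"
proof -
  have "vector_derivative (\<lambda>t. H (s, t)) (at t within {a..b}) = Ht (s, t)" if "t \<in> {a..b}" for t
    using vector_derivative_within_cbox[of a b t, unfolded cbox_interval,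
        OF ab(1) that has_vector_derivative_at_within[OF ft[OF s]]] that ab(2) by auto
  then have "integral {a..b} (\<lambda>t. structure_metric k (H (s, t))
      (vector_derivative (\<lambda>t. H (s, t)) (at t within {a..b}))
      (vector_derivative (\<lambda>t. H (s, t)) (at t within {a..b}))) = integral {a..b} (\<lambda>t. sq_speed (s, t))"
    using s ab by (intro integral_cong) (auto simp: metric_eq_sq_speed)
  then show ?thesis by (simp add: riemannian_energy_def)
qed

lemma energy_first_variation:
  assumes s: "s \<in> I" and ab: "a < b" "{a..b} \<subseteq> J"
  shows "((\<lambda>s. riemannian_energy (structure_metric k) (\<lambda>t. H (s, t)) a b)
    has_real_derivative integral {a..b} (\<lambda>t. sq_speed_variation (s, t))) (at s)"
proof -
  have sub: "I \<times> {a..b} \<subseteq> I \<times> J" using ab by auto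
  have "((\<lambda>s. integral (cbox a b) (\<lambda>t. sq_speed (s, t))) has_field_derivative
      integral (cbox a b) (\<lambda>t. 2 * sq_speed_variation (s, t))) (at s within I)"
  proof (rule leibniz_rule_field_derivative[where fx = "\<lambda>s t. 2 * sq_speed_variation (s, t)"])
    show "((\<lambda>s. sq_speed (s, t)) has_field_derivative 2 * sq_speed_variation (r, t)) (at r within I)"
      if "r \<in> I" "t \<in> cbox a b" for r t
      using that ab by (intro has_field_derivative_at_within[OF sq_speed_deriv]) auto
    show "(\<lambda>t. sq_speed (r, t)) integrable_on cbox a b" if "r \<in> I" for r
      unfolding cbox_interval
      by (intro integrable_continuous_interval continuous_on_compose2[OF speed_continuous(1)])
        (use that ab in \<open>auto intro!: continuous_intros\<close>)
    have "continuous_on (I \<times> cbox a b) (\<lambda>z. 2 * sq_speed_variation z)"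
      using sub unfolding cbox_interval
      by (intro continuous_on_mult_left continuous_on_subset[OF speed_continuous(2)])
    then show "continuous_on (I \<times> cbox a b) (\<lambda>(s, t). 2 * sq_speed_variation (s, t))"
      by (simp add: split_beta)
  qed (use s I in auto)
  then have "((\<lambda>s. 1 / 2 * integral {a..b} (\<lambda>t. sq_speed (s, t))) has_real_derivative
      1 / 2 * integral {a..b} (\<lambda>t. 2 * sq_speed_variation (s, t))) (at s)"
    unfolding cbox_interval at_within_open[OF s I(1)] by (rule DERIV_cmult)
  then have "((\<lambda>s. 1 / 2 * integral {a..b} (\<lambda>t. sq_speed (s, t))) has_real_derivative
      integral {a..b} (\<lambda>t. sq_speed_variation (s, t))) (at s)"
    by simp
  then show ?thesis
    by (rule has_field_derivative_transform_within_open[OF _ I(1) s]) (simp add: energy_eq ab)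
qed

end

context spsd_connection
begin

text \<open>In an eigenbasis of \<open>L\<close> the lift is a combination of functions \<open>cos (\<theta>\<^sub>i t)\<close>, \<open>sin (\<theta>\<^sub>i t)\<close> and
  \<open>exp (d\<^sub>i t)\<close>.\<close>

lemma smooth_lift: "smooth_on UNIV lift"
proof -
  obtain P d where P: "orthogonal_matrix P" and Ld: "L = P ** diag d ** transpose P"
    using spectral_theorem[OF log_ratio_symmetric] .
  have expand: "M ** diag v ** N = (\<Sum>i\<in>UNIV. v $ i *\<^sub>R (M ** diag (axis i 1) ** N))"
    for M :: "real^'p^'m" and N :: "real^'l^'p" and v :: "real^'p"
  proof -
    have "M ** diag v ** N = M ** diag (\<Sum>i\<in>UNIV. v $ i *\<^sub>R axis i 1) ** N"
      using basis_expansion[of v] by (simp add: scalar_mult_eq_scaleR)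
    also have "\<dots> = (\<Sum>i\<in>UNIV. v $ i *\<^sub>R (M ** diag (axis i 1) ** N))"
      using linear_sum[OF bounded_linear.linear[OF spectral_bounded_linear[of M N]],
          of "\<lambda>i. v $ i *\<^sub>R axis i 1" UNIV]
        linear_scale[OF bounded_linear.linear[OF spectral_bounded_linear[of M N]]] by simp
    finally show ?thesis .
  qed
  have S: "spd_geodesic R_A L t
      = (\<Sum>i\<in>UNIV. exp (d $ i * t) *\<^sub>R (R_A ** P ** diag (axis i 1) ** (transpose P ** R_A)))" for t
    using expand[of "R_A ** P" "\<chi> i. exp (d $ i * t)" "transpose P ** R_A"]
    by (simp add: spd_geodesic_def Ld spectral_scaleR mexp_spectral P matrix_mul_assoc mult.commute)
  have U: "stiefel_curve U_A U_B \<theta> t = (\<Sum>i\<in>UNIV. cos (\<theta> $ i * t) *\<^sub>R (U_A ** diag (axis i 1)))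
      + (\<Sum>i\<in>UNIV. sin (\<theta> $ i * t) *\<^sub>R (direction ** diag (axis i 1)))" for t
    using expand[of U_A "\<chi> i. cos (\<theta> $ i * t)" "mat 1"]
      expand[of direction "\<chi> i. sin (\<theta> $ i * t)" "mat 1"]
    by (simp add: stiefel_curve_eq)
  have "lift = (\<lambda>t. \<Sum>i\<in>UNIV. cos (\<theta> $ i * t) *\<^sub>R (U_A ** diag (axis i 1), 0)
      + sin (\<theta> $ i * t) *\<^sub>R (direction ** diag (axis i 1), 0)
      + exp (d $ i * t) *\<^sub>R (0, R_A ** P ** diag (axis i 1) ** (transpose P ** R_A)))"
    unfolding fun_eq_iff lift_eq U S
    by (simp add: prod_eq_iff fst_sum snd_sum sum.distrib)
  then show ?thesis
    by (simp only: trig_exp_polynomial_smooth)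
qed

text \<open>The first variation is the integral of an exact derivative. Its primitive \<open>g\<close> pairs the velocity of
  the lift with the variation field, which vanishes at the fixed end points.\<close>

lemma lift_geodesic: "riemannian_geodesic structure_space (structure_metric k) lift"
  unfolding riemannian_geodesic_def
proof (intro conjI allI impI)
  show "smooth_on UNIV lift" by (rule smooth_lift)
  show "range lift \<subseteq> structure_space" using lift_structure_space by blast
  fix a b \<epsilon> :: real and H :: "real \<times> real \<Rightarrow> (real^'p^'n) \<times> (real^'p^'p)"
  define I J where "I = {-\<epsilon><..<\<epsilon>}" and "J = {a-\<epsilon><..<b+\<epsilon>}"
  assume ab: "a < b" and eps: "0 < \<epsilon>"
    and "smooth_on ({-\<epsilon><..<\<epsilon>} \<times> {a-\<epsilon><..<b+\<epsilon>}) H"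
    and "H ` ({-\<epsilon><..<\<epsilon>} \<times> {a-\<epsilon><..<b+\<epsilon>}) \<subseteq> structure_space"
    and "\<forall>t\<in>{a-\<epsilon><..<b+\<epsilon>}. H (0, t) = lift t"
    and "\<forall>s\<in>{-\<epsilon><..<\<epsilon>}. H (s, a) = lift a \<and> H (s, b) = lift b"
  then have H: "smooth_on (I \<times> J) H" "\<And>s t. s \<in> I \<Longrightarrow> t \<in> J \<Longrightarrow> H (s, t) \<in> structure_space"
      "\<And>t. t \<in> J \<Longrightarrow> H (0, t) = lift t" "\<And>s. s \<in> I \<Longrightarrow> H (s, a) = lift a" "\<And>s. s \<in> I \<Longrightarrow> H (s, b) = lift b"
    unfolding I_def[symmetric] J_def[symmetric] by auto
  have IJ: "open I" "convex I" "open J" "0 \<in> I" "{a..b} \<subseteq> J"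
    using eps by (auto simp: I_def J_def)
  obtain Hs Ht Hts where "two_parameter_map I J H Hs Ht Hts"
    using smooth_on_two_parameter_map[OF IJ(1-3) H(1)] .
  then interpret structure_variation I J H Hs Ht Hts k
    by (intro structure_variation.intro structure_variation_axioms.intro H(2))
  \<comment> \<open>At \<open>s = 0\<close> the variation is the lift, whose logarithmic velocity \<open>?K\<close> is constant.\<close>
  have Ht0: "Ht (0, t) = lift_velocity t" if "t \<in> J" for t
  proof (rule vector_derivative_unique_at[OF ft[OF IJ(4) that]])
    show "((\<lambda>t. H (0, t)) has_vector_derivative lift_velocity t) (at t)"
      by (rule has_vector_derivative_transform_within_open[OF lift_has_vector_derivative IJ(3) that])
        (simp add: H(3))
  qed
  let ?K = "matrix_inv R_A ** L ** R_A"
  have K: "matrix_inv (snd (H (0, t))) ** snd (Ht (0, t)) = ?K" if "t \<in> J" for t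
    using that by (simp add: H(3) Ht0 lift_eq spd_velocity_log)
  define g where "g t = velocity t \<bullet> fst (Hs (0, t))
      + k * trace (?K ** (matrix_inv (snd (H (0, t))) ** snd (Hs (0, t))))" for t
  have g': "(g has_real_derivative sq_speed_variation (0, t)) (at t)" if t: "t \<in> J" for t
  proof -
    let ?M = "matrix_inv (snd (H (0, t)))" and ?U = "stiefel_curve U_A U_B \<theta> t"
    have "(g has_vector_derivative
        (velocity t \<bullet> fst (Hts (0, t)) + (- (?U ** diag (\<chi> i. (\<theta> $ i)\<^sup>2))) \<bullet> fst (Hs (0, t)))
        + k * trace (?K ** (?M ** snd (Hts (0, t)) + - (?M ** snd (Ht (0, t)) ** ?M) ** snd (Hs (0, t))))) (at t)"
      unfolding g_def[abs_def]
      by (intro has_vector_derivative_add bounded_bilinear.has_vector_derivative[OF bounded_bilinear_inner]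
          has_vector_derivative_mult_right bounded_linear.has_vector_derivative[OF bounded_linear_trace]
          bounded_linear.has_vector_derivative[OF bounded_bilinear.bounded_linear_right[OF bounded_bilinear_matrix_mult]]
          bounded_bilinear.has_vector_derivative[OF bounded_bilinear_matrix_mult]
          velocity_has_vector_derivative has_vector_derivative_matrix_inv
          fst_derivs snd_derivs IJ(4) t spd_invertible components)
    \<comment> \<open>The acceleration is normal, while the variation field is tangent.\<close>
    moreover have "(?U ** diag (\<chi> i. (\<theta> $ i)\<^sup>2)) \<bullet> fst (Hs (0, t)) = 0"
    proof -
      have "transpose (fst (H (0, t))) ** fst (Hs (0, t)) \<in> skew_mats"
        using t by (intro stiefel_curve_tangent[OF fst_derivs(1) IJ(1)]) (auto intro: components IJ)
      then have "transpose (transpose ?U ** fst (Hs (0, t))) = - (transpose ?U ** fst (Hs (0, t)))"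
        by (simp add: H(3)[OF t] lift_eq skew_mats_def)
      from trace_skew_symmetric[OF transpose_diag this] show ?thesis
        by (simp add: inner_matrix_eq_trace matrix_transpose_mul matrix_mul_assoc)
    qed
    moreover have "trace (?K ** (?M ** snd (Hts (0, t)) + - (?M ** snd (Ht (0, t)) ** ?M) ** snd (Hs (0, t))))
        = trace (log_speed (0, t) ** log_speed_variation (0, t))"
    proof -
      have "trace (?K ** (?M ** snd (Ht (0, t)) ** ?M ** snd (Hs (0, t)))) = trace (?K ** ?K ** (?M ** snd (Hs (0, t))))"
        unfolding K[OF t] by (simp add: matrix_mul_assoc)
      also have "\<dots> = trace (?K ** (?M ** snd (Hs (0, t))) ** ?K)"
        using trace_mul_sym[of ?K "?K ** (?M ** snd (Hs (0, t)))"] by (simp add: matrix_mul_assoc)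
      finally show ?thesis
        unfolding log_speed_variation_def log_speed_def K[OF t]
        by (simp add: matrix_mult_simps trace_sub)
    qed
    ultimately show ?thesis
      unfolding has_real_derivative_iff_has_vector_derivative sq_speed_variation_def
      by (simp add: Ht0[OF t] inner_minus_left)
  qed
  \<comment> \<open>The end points do not move.\<close>
  have "Hs (0, t) = 0" if "t \<in> {a, b}" for t
  proof (rule vector_derivative_unique_at[OF fs[OF IJ(4)]])
    show "t \<in> J" using that IJ(5) ab by auto
    show "((\<lambda>s. H (s, t)) has_vector_derivative 0) (at 0)"
      by (rule has_vector_derivative_transform_within_open[OF has_vector_derivative_const[of "lift t"] IJ(1,4)])
        (use that H(4,5) in auto)
  qed
  then have "g a = 0" "g b = 0" by (simp_all add: g_def trace_def)
  moreover have "((\<lambda>t. sq_speed_variation (0, t)) has_integral g b - g a) {a..b}"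
  proof (rule fundamental_theorem_of_calculus)
    show "a \<le> b" using ab by simp
    fix t assume "t \<in> {a..b}"
    then have "(g has_real_derivative sq_speed_variation (0, t)) (at t)" using IJ(5) g' by blast
    then show "(g has_vector_derivative sq_speed_variation (0, t)) (at t within {a..b})"
      by (simp only: has_real_derivative_iff_has_vector_derivative has_vector_derivative_at_within)
  qed
  ultimately have "integral {a..b} (\<lambda>t. sq_speed_variation (0, t)) = 0"
    by (simp add: integral_unique)
  then show "((\<lambda>s. riemannian_energy (structure_metric k) (\<lambda>t. H (s, t)) a b) has_real_derivative 0) (at 0)"
    using energy_first_variation[OF IJ(4) ab IJ(5)] by simp
qed

end

section \<open>Uniqueness of the curve\<close>

lemma orthogonal_matrix_sum_squares:
  fixes P :: "real^'n^'n"
  assumes "orthogonal_matrix P"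
  shows "(\<Sum>j\<in>UNIV. (P $ i $ j)\<^sup>2) = 1" "(\<Sum>j\<in>UNIV. (P $ j $ i)\<^sup>2) = 1"
proof -
  have "(P ** transpose P) $ i $ i = 1" "(transpose P ** P) $ i $ i = 1"
    using assms by (simp_all add: orthogonal_matrix_cancel mat_def)
  then show "(\<Sum>j\<in>UNIV. (P $ i $ j)\<^sup>2) = 1" "(\<Sum>j\<in>UNIV. (P $ j $ i)\<^sup>2) = 1"
    by (simp_all add: matrix_matrix_mult_def transpose_def power2_eq_square)
qed

text \<open>Otherwise the rows of \<open>P\<close> up to \<open>m\<close> are supported on the columns before \<open>m\<close>. Summing the squares
  of these entries by rows gives the number of rows, and by columns at most the number of columns,
  which is smaller by one.\<close>

lemma sorted_intertwined_le:
  fixes P :: "real^('p::{finite,linorder})^('p::{finite,linorder})" and \<sigma> \<tau> :: "real^('p::{finite,linorder})"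
  assumes P: "orthogonal_matrix P" and PS: "\<And>i j. P $ i $ j = 0 \<or> \<sigma> $ i = \<tau> $ j"
    and sorted: "\<And>i j. i \<le> j \<Longrightarrow> \<sigma> $ j \<le> \<sigma> $ i" "\<And>i j. i \<le> j \<Longrightarrow> \<tau> $ j \<le> \<tau> $ i"
  shows "\<sigma> $ m \<le> \<tau> $ m"
proof (rule ccontr)
  assume "\<not> \<sigma> $ m \<le> \<tau> $ m"
  then have zero: "P $ i $ j = 0" if "i \<le> m" "m \<le> j" for i j
    using PS[of i j] sorted(1)[OF that(1)] sorted(2)[OF that(2)] by linarith
  have "real (card {..m}) = (\<Sum>i\<le>m. \<Sum>j\<in>UNIV. (P $ i $ j)\<^sup>2)"
    by (simp add: orthogonal_matrix_sum_squares P)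
  also have "\<dots> = (\<Sum>i\<le>m. \<Sum>j<m. (P $ i $ j)\<^sup>2)"
    using zero by (intro sum.cong refl sum.mono_neutral_right) auto
  also have "\<dots> = (\<Sum>j<m. \<Sum>i\<le>m. (P $ i $ j)\<^sup>2)" by (rule sum.swap)
  also have "\<dots> \<le> (\<Sum>j<m. \<Sum>i\<in>UNIV. (P $ i $ j)\<^sup>2)"
    by (intro sum_mono sum_mono2) auto
  also have "\<dots> = real (card {..<m})"
    by (simp add: orthogonal_matrix_sum_squares P)
  also have "\<dots> < real (card {..m})"
    by (intro of_nat_less_iff[THEN iffD2] psubset_card_mono) auto
  finally show False by simp
qed

text \<open>Multiplying the equation by its transpose eliminates \<open>Q\<close> and shows that \<open>P\<close> intertwines the squares
  of the singular values; comparison in both directions identifies the sorted values.\<close>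

lemma sorted_singular_values_unique:
  fixes P Q :: "real^('p::{finite,linorder})^('p::{finite,linorder})" and \<sigma> \<tau> :: "real^('p::{finite,linorder})"
  assumes P: "orthogonal_matrix P" and Q: "orthogonal_matrix Q"
    and eq: "transpose P ** diag \<sigma> ** Q = diag \<tau>"
    and nonneg: "\<And>i. 0 \<le> \<sigma> $ i" "\<And>i. 0 \<le> \<tau> $ i"
    and sorted: "\<And>i j. i \<le> j \<Longrightarrow> \<sigma> $ j \<le> \<sigma> $ i" "\<And>i j. i \<le> j \<Longrightarrow> \<tau> $ j \<le> \<tau> $ i"
  shows "\<tau> = \<sigma>" "P $ i $ j = 0 \<or> \<sigma> $ i = \<sigma> $ j"
proof -
  have "diag \<tau> ** transpose (diag \<tau>) = transpose P ** diag \<sigma> ** (Q ** transpose Q) ** diag \<sigma> ** P"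
    by (simp only: eq[symmetric] matrix_transpose_mul transpose_transpose transpose_diag matrix_mul_assoc)
  then have "P ** (diag \<tau> ** diag \<tau>) = P ** transpose P ** (diag \<sigma> ** diag \<sigma>) ** P"
    by (simp add: orthogonal_matrix_cancel Q matrix_mul_assoc)
  then have "(P ** diag (\<chi> i. \<tau> $ i * \<tau> $ i)) $ i $ j = (diag (\<chi> i. \<sigma> $ i * \<sigma> $ i) ** P) $ i $ j" for i j
    by (simp add: orthogonal_matrix_cancel P diag_mult)
  then have "P $ i $ j = 0 \<or> \<tau> $ j * \<tau> $ j = \<sigma> $ i * \<sigma> $ i" for i j
    by (simp add: matrix_mult_diag_nth diag_mult_matrix_nth)
  then have PS: "P $ i $ j = 0 \<or> \<sigma> $ i = \<tau> $ j" for i j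
    using nonneg by (metis abs_of_nonneg abs_mult_self_eq real_sqrt_abs2)
  have "\<sigma> $ m \<le> \<tau> $ m" for m
    using sorted_intertwined_le[OF P PS sorted] .
  moreover have "\<tau> $ m \<le> \<sigma> $ m" for m
  proof (rule sorted_intertwined_le[of "transpose P"])
    show "transpose P $ i $ j = 0 \<or> \<tau> $ i = \<sigma> $ j" for i j
      using PS[of j i] by (auto simp: transpose_def)
  qed (use P sorted in auto)
  ultimately show \<tau>: "\<tau> = \<sigma>" by (simp add: vec_eq_iff order_antisym)
  show "P $ i $ j = 0 \<or> \<sigma> $ i = \<sigma> $ j" using PS by (simp add: \<tau>)
qed

lemma stiefel_same_range:
  fixes U V :: "real^'p^'n"
  assumes U: "U \<in> stiefel" and V: "V \<in> stiefel" and range: "range ((*v) V) = range ((*v) U)"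
  obtains P where "orthogonal_matrix P" "V = U ** P"
proof -
  have UV: "U ** transpose U ** V = V" using stiefel_projection[OF U] range by blast
  have "transpose (transpose U ** V) ** (transpose U ** V) = transpose V ** (U ** transpose U ** V)"
    by (simp add: matrix_transpose_mul matrix_mul_assoc)
  then have "orthogonal_matrix (transpose U ** V)"
    unfolding orthogonal_matrix UV by (simp add: stiefelD V)
  then show ?thesis using that UV by (simp add: matrix_mul_assoc)
qed

text \<open>\<open>P\<close> only mixes coordinates with equal angles.\<close>

lemma commute_diag:
  fixes P :: "real^'p^'p"
  assumes "\<And>i j. P $ i $ j = 0 \<or> \<theta> $ i = \<theta> $ j"
  shows "P ** diag (\<chi> i. f (\<theta> $ i)) = diag (\<chi> i. f (\<theta> $ i)) ** P"
proof -
  have "P $ i $ j * f (\<theta> $ j) = f (\<theta> $ i) * P $ i $ j" for i j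
    using assms[of i j] by (auto simp: mult.commute)
  then show ?thesis by (simp add: vec_eq_iff matrix_mult_diag_nth diag_mult_matrix_nth)
qed

text \<open>A rotation \<open>P\<close> of both frames within the eigenspaces of \<open>\<Theta>\<close> changes the lift from \<open>(U, S)\<close> to
  \<open>(U P, P\<^sup>T S P)\<close>, which lies in the same fibre.\<close>

lemma (in spsd_connection) spsd_curve_equivariant:
  assumes P: "orthogonal_matrix P" and P\<theta>: "\<And>i j. P $ i $ j = 0 \<or> \<theta> $ i = \<theta> $ j"
  shows "spsd_curve A B (U_A ** P) (U_B ** P) \<theta> = spsd_curve A B U_A U_B \<theta>"
proof
  fix t
  note comm = commute_diag[OF P\<theta>]
  note cancel = orthogonal_matrix_cancel[OF P]
  have F: "P ** pinv (diag (\<chi> i. sin (\<theta> $ i))) = pinv (diag (\<chi> i. sin (\<theta> $ i))) ** P"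
    using comm[of "\<lambda>x. inverse (sin x)"] by (simp add: pinv_diag)
  have "(mat 1 - U_A ** P ** transpose (U_A ** P)) ** (U_B ** P) ** pinv (diag (\<chi> i. sin (\<theta> $ i)))
      = (mat 1 - U_A ** transpose U_A) ** U_B ** (P ** pinv (diag (\<chi> i. sin (\<theta> $ i))))"
    by (simp add: matrix_transpose_mul matrix_mul_assoc cancel)
  also have "\<dots> = direction ** P" unfolding F by (simp add: direction_def matrix_mul_assoc)
  finally have "stiefel_curve (U_A ** P) (U_B ** P) \<theta> t
      = U_A ** (P ** diag (\<chi> i. cos (\<theta> $ i * t))) + direction ** (P ** diag (\<chi> i. sin (\<theta> $ i * t)))"
    by (simp add: stiefel_curve_def matrix_mul_assoc)
  then have U: "stiefel_curve (U_A ** P) (U_B ** P) \<theta> t = stiefel_curve U_A U_B \<theta> t ** P"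
    using comm[of "\<lambda>x. cos (x * t)"] comm[of "\<lambda>x. sin (x * t)"]
    by (simp add: stiefel_curve_eq matrix_mult_simps)
  have e: "transpose (V ** P) ** M ** (V ** P) = transpose P ** (transpose V ** M ** V) ** P"
    for M :: "real^'n^'n" and V :: "real^'p^'n"
    by (simp add: matrix_transpose_mul matrix_mul_assoc)
  have R: "compressed_sqrt A (U_A ** P) = transpose P ** R_A ** P"
    "compressed_sqrt B (U_B ** P) = transpose P ** R_B ** P"
    by (simp_all add: compressed_sqrt_def e msqrt_orthogonal_congruence P compress_A compress_B)
  have "log_ratio A B (U_A ** P) (U_B ** P)
      = mlog (transpose P ** (matrix_inv R_A ** (R_B ** R_B) ** matrix_inv R_A) ** P)"
    by (simp add: log_ratio_def R matrix_inv_orthogonal_congruence spd_invertible roots_spd P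
        matrix_mul_assoc cancel)
  also have "\<dots> = transpose P ** L ** P"
    by (simp only: mlog_orthogonal_congruence[OF ratio_spd P]) (simp add: log_ratio_def Let_def)
  finally have Le: "log_ratio A B (U_A ** P) (U_B ** P) = transpose P ** L ** P" .
  have "t *\<^sub>R (transpose P ** L ** P) = transpose P ** (t *\<^sub>R L) ** P"
    by (simp add: matrix_mult_simps)
  then have "spd_curve A B (U_A ** P) (U_B ** P) t = transpose P ** spd_curve A B U_A U_B t ** P"
    by (simp add: spd_curve_def Let_def R Le mexp_orthogonal_congruence scaled_symmetric P matrix_mul_assoc cancel)
  then show "spsd_curve A B (U_A ** P) (U_B ** P) \<theta> t = spsd_curve A B U_A U_B \<theta> t"
    by (simp add: spsd_curve_def U matrix_transpose_mul matrix_mul_assoc cancel)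
qed

text \<open>Each of the other rows has length one and already contains a diagonal entry one, so the last column
  vanishes off the diagonal; its diagonal entry is then determined up to sign.\<close>

lemma orthogonal_fixing_all_but_last:
  fixes T :: "real^('p::{finite,linorder})^('p::{finite,linorder})"
  assumes T: "orthogonal_matrix T" and unit: "\<And>i j. j \<noteq> Max UNIV \<Longrightarrow> T $ i $ j = (if i = j then 1 else 0)"
  shows "T = mat 1 \<or> T = flip_last"
proof -
  let ?m = "Max (UNIV :: 'p set)"
  have last: "T $ i $ ?m = 0" if i: "i \<noteq> ?m" for i
  proof -
    have "(\<Sum>j\<in>{i, ?m}. (T $ i $ j)\<^sup>2) \<le> (\<Sum>j\<in>UNIV. (T $ i $ j)\<^sup>2)"
      by (intro sum_mono2) auto
    then show ?thesis
      using i unit[OF i, of i] by (simp add: orthogonal_matrix_sum_squares T)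
  qed
  have "(\<Sum>j\<in>UNIV. (T $ j $ ?m)\<^sup>2) = (T $ ?m $ ?m)\<^sup>2"
    using last by (subst sum.remove[of _ ?m]) auto
  then have "(T $ ?m $ ?m)\<^sup>2 = 1" by (simp add: orthogonal_matrix_sum_squares T)
  then consider "T $ ?m $ ?m = 1" | "T $ ?m $ ?m = - 1" by (auto simp: power2_eq_1_iff)
  then show ?thesis
  proof cases
    case 1
    have "T $ i $ j = mat 1 $ i $ j" for i j
      using unit[of j i] last[of i] 1 by (cases "j = ?m"; cases "i = ?m") (auto simp: mat_def)
    then show ?thesis by (simp add: vec_eq_iff)
  next
    case 2
    have "T $ i $ j = flip_last $ i $ j" for i j
      using unit[of j i] last[of i] 2 by (cases "j = ?m"; cases "i = ?m") (auto simp: flip_last_def diag_nth)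
    then show ?thesis by (simp add: vec_eq_iff)
  qed
qed

lemma orthogonal_flip_last: "orthogonal_matrix flip_last"
  unfolding orthogonal_matrix flip_last_def transpose_diag diag_mult
  by (auto simp: vec_eq_iff diag_nth mat_def)

text \<open>The predecessor \<open>i\<close> of the last index is the one with \<open>card {..i} = p - 1\<close>, and the angles are
  nondecreasing.\<close>

lemma last_but_one_angle:
  fixes \<theta> :: "real^('p::{finite,linorder})"
  assumes sorted: "\<And>i j. i \<le> j \<Longrightarrow> \<theta> $ i \<le> \<theta> $ j" and le: "\<And>i. \<theta> $ i \<le> c"
    and second: "\<And>i. card {..i} = CARD('p) - 1 \<Longrightarrow> \<theta> $ i \<noteq> c"
    and i: "i \<noteq> Max UNIV"
  shows "\<theta> $ i < c"
proof -
  let ?m = "Max (UNIV :: 'p set)"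
  let ?X = "UNIV - {?m}"
  have i': "i \<in> ?X" using i by simp
  then have "Max ?X \<in> ?X" by (intro Max_in) auto
  have "{..Max ?X} = ?X"
  proof (intro equalityI subsetI)
    fix x assume "x \<in> {..Max ?X}"
    moreover have "Max ?X < ?m"
      using \<open>Max ?X \<in> ?X\<close> Max_ge[of UNIV "Max ?X"] by (auto simp: less_le)
    ultimately show "x \<in> ?X" by auto
  qed (auto intro: Max_ge)
  then have "card {..Max ?X} = CARD('p) - 1" by (simp add: card_Diff_singleton)
  then have "\<theta> $ Max ?X < c" using second le[of "Max ?X"] by fastforce
  moreover have "\<theta> $ i \<le> \<theta> $ Max ?X" using i' by (intro sorted Max_ge) auto
  ultimately show ?thesis by simp
qed

text \<open>Let \<open>P\<close> and \<open>Q\<close> relate the two pairs of frames. Then \<open>T = P\<^sup>T Q\<close> satisfies \<open>cos(\<Theta>) T = cos(\<Theta>)\<close>, so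
  \<open>T\<close> agrees with the identity wherever the cosine does not vanish. Up to the common rotation \<open>P\<close> the
  second pair of frames is therefore the first one, possibly with the last column of \<open>U_B\<close> reflected.\<close>

lemma spsd_curve_unique:
  fixes A B :: "real^'n^'n"
    and V_A V_B V_A' V_B' :: "real^('p::{finite,linorder})^'n"
  assumes A: "A \<in> spsd CARD('p)" and B: "B \<in> spsd CARD('p)"
    and c: "principal_choice A B V_A V_B O_A O_B \<sigma> \<theta>"
    and c': "principal_choice A B V_A' V_B' O_A' O_B' \<sigma>' \<theta>'"
    and second: "\<And>i. card {..i} = CARD('p) - 1 \<Longrightarrow> \<theta> $ i \<noteq> pi / 2"
  shows "spsd_curve A B (V_A' ** O_A') (V_B' ** O_B') \<theta>' = spsd_curve A B (V_A ** O_A) (V_B ** O_B) \<theta> \<or>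
    \<theta> $ Max UNIV = pi / 2 \<and>
    spsd_curve A B (V_A' ** O_A') (V_B' ** O_B') \<theta>' = spsd_curve A B (V_A ** O_A) (V_B ** O_B ** flip_last) \<theta>"
proof -
  let ?m = "Max (UNIV :: 'p set)"
  interpret spsd_connection "V_A ** O_A" "V_B ** O_B" \<theta> A B
    by (rule principal_choice_connection[OF A B c])
  interpret other: spsd_connection "V_A' ** O_A'" "V_B' ** O_B'" \<theta>' A B
    by (rule principal_choice_connection[OF A B c'])
  obtain P where P: "orthogonal_matrix P" "V_A' ** O_A' = V_A ** O_A ** P"
    using stiefel_same_range[OF frame_A other.frame_A] range_A other.range_A by metis
  obtain Q where Q: "orthogonal_matrix Q" "V_B' ** O_B' = V_B ** O_B ** Q"
    using stiefel_same_range[OF frame_B other.frame_B] range_B other.range_B by metis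
  have s: "\<sigma> = (\<chi> i. cos (\<theta> $ i))" "\<sigma>' = (\<chi> i. cos (\<theta>' $ i))"
    and nn: "\<And>i. 0 \<le> \<sigma> $ i" "\<And>i. 0 \<le> \<sigma>' $ i"
    and srt: "\<And>i j. i \<le> j \<Longrightarrow> \<sigma> $ j \<le> \<sigma> $ i" "\<And>i j. i \<le> j \<Longrightarrow> \<sigma>' $ j \<le> \<sigma>' $ i"
      "\<And>i j. i \<le> j \<Longrightarrow> \<theta> $ i \<le> \<theta> $ j"
    using c c' unfolding principal_choice_def by (auto simp: vec_eq_iff)
  have "transpose P ** diag \<sigma> ** Q = transpose (V_A ** O_A ** P) ** (V_B ** O_B ** Q)"
    using cosines by (simp add: s(1) matrix_transpose_mul[of _ P] matrix_mul_assoc flip: cosines)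
  then have eq: "transpose P ** diag \<sigma> ** Q = diag \<sigma>'"
    using other.cosines by (simp only: P(2) Q(2) s(2))
  have \<sigma>: "\<sigma>' = \<sigma>" and P\<sigma>: "\<And>i j. P $ i $ j = 0 \<or> \<sigma> $ i = \<sigma> $ j"
    using sorted_singular_values_unique[OF P(1) Q(1) eq nn srt(1,2)] by blast+
  have cos_inj: "x = y" if "cos x = cos y" "0 \<le> x" "x \<le> pi / 2" "0 \<le> y" "y \<le> pi / 2" for x y
    by (rule cos_inj_pi) (use that pi_gt_zero in auto)
  have P\<theta>: "P $ i $ j = 0 \<or> \<theta> $ i = \<theta> $ j" for i j
    using P\<sigma>[of i j] angle_nonneg angle_le by (auto simp: s(1) intro: cos_inj)
  have "\<theta>' $ i = \<theta> $ i" for i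
    by (rule cos_inj)
      (use arg_cong[OF \<sigma>, of "\<lambda>v. v $ i"] angle_nonneg angle_le other.angle_nonneg other.angle_le
        in \<open>auto simp: s\<close>)
  then have \<theta>: "\<theta>' = \<theta>" by (simp add: vec_eq_iff)
  define T where "T = transpose P ** Q"
  have QT: "Q = P ** T" by (simp add: T_def matrix_mul_assoc orthogonal_matrix_cancel P)
  have T: "orthogonal_matrix T" using P Q by (simp add: T_def orthogonal_matrix_mul)
  \<comment> \<open>Cancel \<open>P\<close>, which commutes with \<open>diag \<sigma>\<close>.\<close>
  have "diag \<sigma> ** T = diag \<sigma>"
  proof -
    have "transpose P ** diag \<sigma> = diag \<sigma> ** transpose P"
      using commute_diag[of P \<sigma> "\<lambda>x. x", OF P\<sigma>] by (metis matrix_transpose_mul transpose_diag vec_lambda_eta)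
    then show ?thesis using eq by (simp add: T_def \<sigma> matrix_mul_assoc)
  qed
  then have Trow: "\<sigma> $ i * T $ i $ j = (if i = j then \<sigma> $ i else 0)" for i j
    by (metis diag_mult_matrix_nth diag_nth)
  have "\<sigma> $ i \<noteq> 0" if "\<theta> $ i < pi / 2" for i
    using cos_gt_zero_pi[of "\<theta> $ i"] that angle_nonneg[of i] by (simp add: s(1))
  then have Tfix: "T $ i $ j = (if i = j then 1 else 0)" if "\<theta> $ i < pi / 2" for i j
    using Trow[of i j] that by (auto split: if_splits)
  have small: "\<theta> $ i < pi / 2" if "i \<noteq> ?m" for i
    using last_but_one_angle[OF srt(3) angle_le second that] .
  have "transpose T = mat 1 \<or> transpose T = flip_last"
  proof (rule orthogonal_fixing_all_but_last)
    show "orthogonal_matrix (transpose T)" using T by simp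
    show "transpose T $ i $ j = (if i = j then 1 else 0)" if "j \<noteq> ?m" for i j
      using Tfix[OF small[OF that], of i] by (auto simp: transpose_def)
  qed
  then have "T = mat 1 \<or> T = flip_last"
    by (metis flip_last_def transpose_diag transpose_mat transpose_transpose)
  then consider "T = mat 1" | "T = flip_last" "T \<noteq> mat 1" by blast
  then show ?thesis
  proof cases
    case 1
    then show ?thesis
      using spsd_curve_equivariant[OF P(1) P\<theta>] by (simp add: P(2) Q(2) QT \<theta>)
  next
    case 2
    have m: "\<theta> $ ?m = pi / 2"
    proof (rule ccontr)
      assume "\<theta> $ ?m \<noteq> pi / 2"
      then have "\<theta> $ i < pi / 2" for i
        using small[of i] angle_le[of ?m] by (cases "i = ?m") auto
      then have "T = mat 1" using Tfix by (simp add: vec_eq_iff mat_def)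
      then show False using 2 by simp
    qed
    \<comment> \<open>The reflection is a function of \<open>\<Theta>\<close>: the last angle is the only one equal to \<open>\<pi>/2\<close>.\<close>
    have flip: "flip_last = diag (\<chi> i. if \<theta> $ i = pi / 2 then - 1 else 1)"
      using small m unfolding flip_last_def by (auto simp: vec_eq_iff diag_nth) (metis less_irrefl)
    interpret flipped: spsd_connection "V_A ** O_A" "V_B ** O_B ** flip_last" \<theta> A B
    proof
      show "V_B ** O_B ** flip_last \<in> stiefel"
        by (intro stiefel_mult_orthogonal frame_B orthogonal_flip_last)
      show "range ((*v) (V_B ** O_B ** flip_last)) = range ((*v) B)"
        using range_mult_orthogonal[OF orthogonal_flip_last] range_B by metis
      have "transpose (V_A ** O_A) ** (V_B ** O_B ** flip_last) = diag (\<chi> i. cos (\<theta> $ i)) ** flip_last"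
        using cosines by (simp add: matrix_mul_assoc)
      also have "\<dots> = diag (\<chi> i. cos (\<theta> $ i))"
      proof -
        have "cos x * (if x = pi / 2 then - 1 else 1) = cos x" for x :: real
          by (cases "x = pi / 2") (simp_all only: cos_pi_half if_True if_False mult_zero_left mult_1_right)
        then show ?thesis unfolding flip diag_mult by (simp only: vec_lambda_beta)
      qed
      finally show "transpose (V_A ** O_A) ** (V_B ** O_B ** flip_last) = diag (\<chi> i. cos (\<theta> $ i))" .
    qed (use frame_A range_A angle_nonneg angle_le A B in auto)
    have "P ** flip_last = flip_last ** P"
      unfolding flip by (rule commute_diag[OF P\<theta>])
    then have "V_B' ** O_B' = V_B ** O_B ** flip_last ** P"
      by (simp add: Q(2) QT 2(1) flip: matrix_mul_assoc)
    then show ?thesis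
      using flipped.spsd_curve_equivariant[OF P(1) P\<theta>] m by (simp add: P(2) \<theta>)
  qed
qed

theorem theorem2:
  fixes A B :: "real^'n^'n"
    and V_A V_B :: "real^('p::{finite,linorder})^'n"
    and O_A O_B :: "real^('p::{finite,linorder})^('p::{finite,linorder})"
    and \<sigma> \<theta> :: "real^('p::{finite,linorder})"
    and k :: real
  assumes "CARD('p) < CARD('n)" and "0 < k"
    and "A \<in> spsd CARD('p)" and "B \<in> spsd CARD('p)"
    and "principal_choice A B V_A V_B O_A O_B \<sigma> \<theta>"
  shows
    "\<comment> \<open>(i)\<close>
     (spsd_curve A B (V_A ** O_A) (V_B ** O_B) \<theta> 0 = A \<and>
      spsd_curve A B (V_A ** O_A) (V_B ** O_B) \<theta> 1 = B \<and>
      (\<forall>t\<in>{0..1}. spsd_curve A B (V_A ** O_A) (V_B ** O_B) \<theta> t \<in> spsd CARD('p))) \<and>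
     \<comment> \<open>(ii)\<close>
     (horizontal_lift (lifted_curve A B (V_A ** O_A) (V_B ** O_B) \<theta>)
                      (spsd_curve A B (V_A ** O_A) (V_B ** O_B) \<theta>) \<and>
      riemannian_geodesic structure_space (structure_metric k)
                      (lifted_curve A B (V_A ** O_A) (V_B ** O_B) \<theta>)) \<and>
     \<comment> \<open>(iii); \<open>norm\<close> is the Frobenius norm on matrices\<close>
     (spsd_curve_sq_length k A B (V_A ** O_A) (V_B ** O_B) \<theta> =
        (norm (diag \<theta>))\<^sup>2 + k * (norm (log_ratio A B (V_A ** O_A) (V_B ** O_B)))\<^sup>2 \<and>
      (principal_choice (pinv A) (pinv B) V_A V_B O_A O_B \<sigma> \<theta> \<and>
       spsd_curve_sq_length k (pinv A) (pinv B) (V_A ** O_A) (V_B ** O_B) \<theta> =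
       spsd_curve_sq_length k A B (V_A ** O_A) (V_B ** O_B) \<theta>) \<and>
      (\<forall>Q. orthogonal_matrix Q \<longrightarrow>
         principal_choice (Q ** A ** transpose Q) (Q ** B ** transpose Q)
           (Q ** V_A) (Q ** V_B) O_A O_B \<sigma> \<theta> \<and>
         spsd_curve_sq_length k (Q ** A ** transpose Q) (Q ** B ** transpose Q)
           (Q ** V_A ** O_A) (Q ** V_B ** O_B) \<theta> =
         spsd_curve_sq_length k A B (V_A ** O_A) (V_B ** O_B) \<theta>) \<and>
      (\<forall>\<mu>. \<mu> \<noteq> 0 \<longrightarrow>
         principal_choice (\<mu>\<^sup>2 *\<^sub>R A) (\<mu>\<^sup>2 *\<^sub>R B) V_A V_B O_A O_B \<sigma> \<theta> \<and>
         spsd_curve_sq_length k (\<mu>\<^sup>2 *\<^sub>R A) (\<mu>\<^sup>2 *\<^sub>R B) (V_A ** O_A) (V_B ** O_B) \<theta> =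
         spsd_curve_sq_length k A B (V_A ** O_A) (V_B ** O_B) \<theta>)) \<and>
     \<comment> \<open>(iv); \<open>card {..i} = p - 1\<close> says that \<open>i\<close> is the \<open>(p - 1)\<close>th index\<close>
     ((\<forall>i. card {..i} = CARD('p) - 1 \<longrightarrow> \<theta> $ i \<noteq> pi / 2) \<longrightarrow>
      (\<forall>V_A' V_B' O_A' O_B'. \<forall>\<sigma>' \<theta>' :: real^('p::{finite,linorder}).
         principal_choice A B V_A' V_B' O_A' O_B' \<sigma>' \<theta>' \<longrightarrow>
         spsd_curve A B (V_A' ** O_A') (V_B' ** O_B') \<theta>' =
           spsd_curve A B (V_A ** O_A) (V_B ** O_B) \<theta> \<or>
         \<theta> $ Max UNIV = pi / 2 \<and>
         spsd_curve A B (V_A' ** O_A') (V_B' ** O_B') \<theta>' =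
           spsd_curve A B (V_A ** O_A) (V_B ** O_B ** flip_last) \<theta>))"
proof -
  interpret spsd_connection "V_A ** O_A" "V_B ** O_B" \<theta> A B
    by (rule principal_choice_connection[OF assms(3-5)])
  note choice = assms(5)
  have V: "V_A \<in> stiefel" "V_B \<in> stiefel" "range ((*v) V_A) = range ((*v) A)" "range ((*v) V_B) = range ((*v) B)"
    using choice by (auto simp: principal_choice_def)
  show ?thesis
  proof (intro conjI allI impI ballI)
    show "principal_choice (pinv A) (pinv B) V_A V_B O_A O_B \<sigma> \<theta>"
      by (rule principal_choice_cong[OF choice]) 
        (simp_all add: V pinv_spsd(2)[OF assms(3) V(1,3)] pinv_spsd(2)[OF assms(4) V(2,4)])
  next
    fix Q :: "real^'n^'n" assume Q: "orthogonal_matrix Q"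
    show "principal_choice (Q ** A ** transpose Q) (Q ** B ** transpose Q) (Q ** V_A) (Q ** V_B) O_A O_B \<sigma> \<theta>"
      using frame_congruence(2,3)[OF assms(3) V(1,3) Q] frame_congruence(2,3)[OF assms(4) V(2,4) Q]
      by (intro principal_choice_cong[OF choice])
        (simp_all add: matrix_transpose_mul matrix_mul_assoc orthogonal_matrix_cancel[OF Q])
    show "spsd_curve_sq_length k (Q ** A ** transpose Q) (Q ** B ** transpose Q)
        (Q ** V_A ** O_A) (Q ** V_B ** O_B) \<theta> = spsd_curve_sq_length k A B (V_A ** O_A) (V_B ** O_B) \<theta>"
      using sq_length_congruence[OF assms(2) Q] by (simp add: matrix_mul_assoc)
  next
    fix \<mu> :: real assume \<mu>: "\<mu> \<noteq> 0"
    then have \<mu>2: "0 < \<mu>\<^sup>2" by simp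
    show "principal_choice (\<mu>\<^sup>2 *\<^sub>R A) (\<mu>\<^sup>2 *\<^sub>R B) V_A V_B O_A O_B \<sigma> \<theta>"
      by (intro principal_choice_cong[OF choice]) 
        (simp_all add: V frame_scaling(2)[OF assms(3) V(1,3) \<mu>2] frame_scaling(2)[OF assms(4) V(2,4) \<mu>2])
    show "spsd_curve_sq_length k (\<mu>\<^sup>2 *\<^sub>R A) (\<mu>\<^sup>2 *\<^sub>R B) (V_A ** O_A) (V_B ** O_B) \<theta>
        = spsd_curve_sq_length k A B (V_A ** O_A) (V_B ** O_B) \<theta>"
      by (rule sq_length_scaling[OF assms(2) \<mu>])
  next
    fix V_A' V_B' :: "real^('p::{finite,linorder})^'n"
      and O_A' O_B' :: "real^('p::{finite,linorder})^('p::{finite,linorder})"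
      and \<sigma>' \<theta>' :: "real^('p::{finite,linorder})"
    assume "\<forall>i. card {..i} = CARD('p) - 1 \<longrightarrow> \<theta> $ i \<noteq> pi / 2"
      and "principal_choice A B V_A' V_B' O_A' O_B' \<sigma>' \<theta>'"
    then show "spsd_curve A B (V_A' ** O_A') (V_B' ** O_B') \<theta>' = spsd_curve A B (V_A ** O_A) (V_B ** O_B) \<theta> \<or>
        \<theta> $ Max UNIV = pi / 2 \<and>
        spsd_curve A B (V_A' ** O_A') (V_B' ** O_B') \<theta>' = spsd_curve A B (V_A ** O_A) (V_B ** O_B ** flip_last) \<theta>"
      by (intro spsd_curve_unique[OF assms(3,4) choice]) auto
  qed (simp_all add: spsd_curve_0 spsd_curve_1 spsd_curve_spsd lift_horizontal lift_geodesic
      sq_length[OF assms(2)] sq_length_pinv[OF assms(2)])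
qed

end
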